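(* Let $\chi$ be an arbitrary irreducible (complex) character of $U$. Then $\chi$ is a constituent of a unique supercharacter of $U$; in other words, there exist a unique basic subset $D\subseteq\Phi$ and a unique map $\phi\colon D\to\mathbb{F}_q^{\times}$ such that $\langle\chi,\xi_{D,\phi}\rangle\neq 0$.
   Context: Let $p\ge 3$ be a prime, $q=p^e$ ($e\ge 1$), $\mathbb{F}_q$ the field with $q$ elements, and $n\ge 1$. Let $G$ be one of $Sp_{2n}(q)$ (symplectic case), $O_{2n}(q)$ (even orthogonal case), $O_{2n+1}(q)$ (odd orthogonal case); put $m=2n$ in the first two cases and $m=2n+1$ in the third. Let $U_m(q)$ be the group of unipotent upper-triangular $m\times m$ matrices over $\mathbb{F}_q$, and $U=G\cap U_m(q)$, a Sylow $p$-subgroup of $G$. Explicitly, with $J$ the $n\times n$ matrix with 1's on the anti-diagonal and 0's elsewhere, $U$ consists of all block matrices $\begin{pmatrix} x & xu & xz \\ 0 & I_r & -u^TJ \\ 0 & 0 & Jx^{-T}J\end{pmatrix}$ with $x\in U_n(q)$, $u$ an $n\times r$ matrix and $z$ an $n\times n$ matrix over $\mathbb{F}_q$, where: $r=0$ and $Jz^T-zJ=0$ in the symplectic case; $r=0$ and $Jz^T+zJ=0$ in the even orthogonal case; $r=1$ and $Jz^T+zJ=-uu^T$ in the odd orthogonal case. Rows and columns of $m\times m$ matrices are indexed, in order, by $1,\dots,n,-n,\dots,-1$ if $m=2n$ and by $1,\dots,n,0,-n,\dots,-1$ if $m=2n+1$; this order is denoted $\prec$, so $1\prec\cdots\prec n\prec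 0\prec -n\prec\cdots\prec -1$. Roots: $\Phi=\{\varepsilon_i\pm\varepsilon_j:1\le i<j\le n\}\cup\Phi'$, with $\Phi'=\{2\varepsilon_i:1\le i\le n\}$ (symplectic), $\Phi'=\emptyset$ (even orthogonal), $\Phi'=\{\varepsilon_i:1\le i\le n\}$ (odd orthogonal), where $\varepsilon_1,\dots,\varepsilon_n$ are the coordinate functions on the diagonal torus. Entries: for $i<j$, $\mathcal{E}(\varepsilon_i-\varepsilon_j)=\{(i,j),(-j,-i)\}$, $\mathcal{E}(\varepsilon_i+\varepsilon_j)=\{(i,-j),(j,-i)\}$; $\mathcal{E}(2\varepsilon_i)=\{(i,-i)\}$ (symplectic); $\mathcal{E}(\varepsilon_i)=\{(i,0),(0,-i)\}$ (odd orthogonal). For $\Psi\subseteq\Phi$, $\mathcal{E}(\Psi)=\bigcup_{\alpha\in\Psi}\mathcal{E}(\alpha)$, and $\mathcal{E}=\mathcal{E}(\Phi)$. For each $\alpha\in\Phi$ there is exactly one $(i,j)\in\mathcal{E}(\alpha)$ with $1\le i\le n$ and $i\prec j\preceq -i$. A subset of $\mathcal{E}$ is basic if it contains at most one entry from each row and at most one entry from each column; $D\subseteq\Phi$ is a basic subset if $\mathcal{E}(D)$ is basic. Supercharacters: for $i<j$, $U_{\varepsilon_i-\varepsilon_j}=\{x\in U: x_{i,k}=0,\ i<k<j\}$; $U_{\varepsilon_i+\varepsilon_j}=\{x\in U:x_{i,k}=x_{j,l}=0,\ i<k\le n,\ j\prec l\preceq 0\}$; and for $\alpha=2\varepsilon_i$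 (symplectic) or $\alpha=\varepsilon_i$ (odd orthogonal), $U_\alpha=\{x\in U:x_{i,k}=0,\ i<k\le n\}$. Fix a nontrivial linear character $\vartheta\colon\mathbb{F}_q^+\to\mathbb{C}^\times$. For $\alpha\in\Phi$, $r\in\mathbb{F}_q^\times$, $\lambda_{\alpha,r}(x)=\vartheta(rx_{i,j})$ (with $(i,j)$ the distinguished entry of $\mathcal{E}(\alpha)$ above) is a linear character of $U_\alpha$, and the elementary character is the induced character $\xi_{\alpha,r}=(\lambda_{\alpha,r})^U$. For a basic subset $D\subseteq\Phi$ and a map $\phi\colon D\to\mathbb{F}_q^\times$, the supercharacter is $\xi_{D,\phi}=\prod_{\alpha\in D}\xi_{\alpha,\phi(\alpha)}$ (the trivial character $1_U$ if $D=\emptyset$). $\langle\cdot,\cdot\rangle$ is the usual scalar product of class functions on $U$. *)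

theory Defs
  imports "Jordan_Normal_Form.VS_Connect" "HOL-Computational_Algebra.Primes"
begin

text \<open>Matrices are those of \<^theory>\<open>Jordan_Normal_Form.Matrix\<close> (rows and columns numbered from 0).\<close>

definition GL :: "nat \<Rightarrow> 'a::field mat monoid" where
  "GL m = units_of (ring_mat TYPE('a) m ())"

definition mat_trace :: "'a::comm_monoid_add mat \<Rightarrow> 'a" where
  "mat_trace A = (\<Sum>i<dim_row A. A $$ (i, i))"

definition irreducible_rep :: "('g, 'b) monoid_scheme \<Rightarrow> nat \<Rightarrow> ('g \<Rightarrow> complex mat) \<Rightarrow> bool" where
  "irreducible_rep G d \<rho> \<longleftrightarrow>
     d > 0 \<and> \<rho> \<in> hom G (GL d) \<and>
     (\<forall>W. VectorSpace.subspace class_ring W (module_vec TYPE(complex) d) \<and>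
          (\<forall>g\<in>carrier G. \<forall>w\<in>W. \<rho> g *\<^sub>v w \<in> W) \<longrightarrow>
          W = {0\<^sub>v d} \<or> W = carrier_vec d)"

text \<open>Class functions are total functions of which only the values on the carrier matter.\<close>

definition irreducible_character :: "('g, 'b) monoid_scheme \<Rightarrow> ('g \<Rightarrow> complex) \<Rightarrow> bool" where
  "irreducible_character G \<chi> \<longleftrightarrow>
     (\<exists>d \<rho>. irreducible_rep G d \<rho> \<and> (\<forall>g\<in>carrier G. \<chi> g = mat_trace (\<rho> g)))"

definition scalar_product :: "('g, 'b) monoid_scheme \<Rightarrow> ('g \<Rightarrow> complex) \<Rightarrow> ('g \<Rightarrow> complex) \<Rightarrow> complex" where
  "scalar_product G f g = (\<Sum>x\<in>carrier G. f x * cnj (g x)) / of_nat (card (carrier G))"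

definition induced :: "('g, 'b) monoid_scheme \<Rightarrow> 'g set \<Rightarrow> ('g \<Rightarrow> complex) \<Rightarrow> 'g \<Rightarrow> complex" where
  "induced G H f x =
     (\<Sum>y | y \<in> carrier G \<and> y \<otimes>\<^bsub>G\<^esub> x \<otimes>\<^bsub>G\<^esub> inv\<^bsub>G\<^esub> y \<in> H. f (y \<otimes>\<^bsub>G\<^esub> x \<otimes>\<^bsub>G\<^esub> inv\<^bsub>G\<^esub> y))
       / of_nat (card H)"

definition linear_character_add :: "('a::field \<Rightarrow> complex) \<Rightarrow> bool" where
  "linear_character_add \<theta> \<longleftrightarrow> (\<forall>a. \<theta> a \<noteq> 0) \<and> (\<forall>a b. \<theta> (a + b) = \<theta> a * \<theta> b)"

datatype gtype = Symplectic | EvenOrthogonal | OddOrthogonal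

definition rdim :: "gtype \<Rightarrow> nat" where
  "rdim T = (if T = OddOrthogonal then 1 else 0)"

definition mdim :: "gtype \<Rightarrow> nat \<Rightarrow> nat" where
  "mdim T n = 2 * n + rdim T"

definition antidiag :: "nat \<Rightarrow> 'a::field mat" where
  "antidiag n = mat n n (\<lambda>(i, j). if i + j + 1 = n then 1 else 0)"

text \<open>Gram matrix of the form defining the classical group, in the normalization for which the
  unipotent upper-triangular elements are those described by \<open>carrier_U_explicit\<close>.\<close>

definition gram :: "gtype \<Rightarrow> nat \<Rightarrow> 'a::field mat" where
  "gram T n =
     (if T = Symplectic
      then four_block_mat (0\<^sub>m n n) (antidiag n) (- antidiag n) (0\<^sub>m n n)
      else antidiag (mdim T n))"

definition classical_group :: "gtype \<Rightarrow> nat \<Rightarrow> 'a::field mat set" where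
  "classical_group T n =
     {g \<in> carrier (GL (mdim T n)). transpose_mat g * gram T n * g = gram T n}"

definition unitriangular :: "nat \<Rightarrow> 'a::field mat set" where
  "unitriangular m = {g \<in> carrier_mat m m. upper_triangular g \<and> (\<forall>i<m. g $$ (i, i) = 1)}"

definition U :: "gtype \<Rightarrow> nat \<Rightarrow> 'a::field mat monoid" where
  "U T n = GL (mdim T n) \<lparr>carrier := classical_group T n \<inter> unitriangular (mdim T n)\<rparr>"

text \<open>Rows and columns carry the labels \<open>1, \<dots>, n, (0,) -n, \<dots>, -1\<close>, in this order; \<open>pos\<close> gives the
  number, counted from 0, of the row or column with a given label.\<close>

definition labels :: "gtype \<Rightarrow> nat \<Rightarrow> int set" where
  "labels T n = {1..int n} \<union> (if T = OddOrthogonal then {0} else {}) \<union> {- int n..-1}"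

definition prec :: "int \<Rightarrow> int \<Rightarrow> bool"  (infix \<open>\<prec>\<close> 50) where
  "i \<prec> j \<longleftrightarrow> (if i > 0 then i < j \<or> j \<le> 0 else if i = 0 then j < 0 else i < j \<and> j < 0)"

definition preceq :: "int \<Rightarrow> int \<Rightarrow> bool"  (infix \<open>\<preceq>\<close> 50) where
  "i \<preceq> j \<longleftrightarrow> i \<prec> j \<or> i = j"

definition pos :: "gtype \<Rightarrow> nat \<Rightarrow> int \<Rightarrow> nat" where
  "pos T n k = (if k > 0 then nat k - 1 else if k = 0 then n else mdim T n - nat (- k))"

definition coef :: "gtype \<Rightarrow> nat \<Rightarrow> 'a mat \<Rightarrow> int \<Rightarrow> int \<Rightarrow> 'a" where
  "coef T n x i j = x $$ (pos T n i, pos T n j)"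

text \<open>The constructors stand for \<open>\<epsilon>\<^sub>i - \<epsilon>\<^sub>j\<close>, \<open>\<epsilon>\<^sub>i + \<epsilon>\<^sub>j\<close>, \<open>2\<epsilon>\<^sub>i\<close> and \<open>\<epsilon>\<^sub>i\<close>.\<close>

datatype eps_root = EpsMinus int int | EpsPlus int int | TwoEps int | Eps int

definition \<Phi> :: "gtype \<Rightarrow> nat \<Rightarrow> eps_root set" where
  "\<Phi> T n =
     {EpsMinus i j | i j. 1 \<le> i \<and> i < j \<and> j \<le> int n} \<union>
     {EpsPlus i j | i j. 1 \<le> i \<and> i < j \<and> j \<le> int n} \<union>
     (case T of
        Symplectic \<Rightarrow> {TwoEps i | i. 1 \<le> i \<and> i \<le> int n}
      | EvenOrthogonal \<Rightarrow> {}
      | OddOrthogonal \<Rightarrow> {Eps i | i. 1 \<le> i \<and> i \<le> int n})"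

fun entries :: "eps_root \<Rightarrow> (int \<times> int) set" where
  "entries (EpsMinus i j) = {(i, j), (- j, - i)}"
| "entries (EpsPlus i j) = {(i, - j), (j, - i)}"
| "entries (TwoEps i) = {(i, - i)}"
| "entries (Eps i) = {(i, 0), (0, - i)}"

definition basic_entries :: "(int \<times> int) set \<Rightarrow> bool" where
  "basic_entries S \<longleftrightarrow> inj_on fst S \<and> inj_on snd S"

definition basic_subset :: "gtype \<Rightarrow> nat \<Rightarrow> eps_root set \<Rightarrow> bool" where
  "basic_subset T n D \<longleftrightarrow> D \<subseteq> \<Phi> T n \<and> basic_entries (\<Union>\<alpha>\<in>D. entries \<alpha>)"

definition dist_entry :: "nat \<Rightarrow> eps_root \<Rightarrow> int \<times> int" where
  "dist_entry n \<alpha> =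
     (THE (i, j). (i, j) \<in> entries \<alpha> \<and> 1 \<le> i \<and> i \<le> int n \<and> i \<prec> j \<and> j \<preceq> - i)"

fun U_root :: "gtype \<Rightarrow> nat \<Rightarrow> eps_root \<Rightarrow> 'a::field mat set" where
  "U_root T n (EpsMinus i j) =
     {x \<in> carrier (U T n). \<forall>k. i < k \<and> k < j \<longrightarrow> coef T n x i k = 0}"
| "U_root T n (EpsPlus i j) =
     {x \<in> carrier (U T n).
        (\<forall>k. i < k \<and> k \<le> int n \<longrightarrow> coef T n x i k = 0) \<and>
        (\<forall>l\<in>labels T n. j \<prec> l \<and> l \<preceq> 0 \<longrightarrow> coef T n x j l = 0)}"
| "U_root T n (TwoEps i) =
     {x \<in> carrier (U T n). \<forall>k. i < k \<and> k \<le> int n \<longrightarrow> coef T n x i k = 0}"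
| "U_root T n (Eps i) =
     {x \<in> carrier (U T n). \<forall>k. i < k \<and> k \<le> int n \<longrightarrow> coef T n x i k = 0}"

definition lin_char :: "gtype \<Rightarrow> nat \<Rightarrow> ('a::field \<Rightarrow> complex) \<Rightarrow> eps_root \<Rightarrow> 'a \<Rightarrow> 'a mat \<Rightarrow> complex" where
  "lin_char T n \<theta> \<alpha> r x = (case dist_entry n \<alpha> of (i, j) \<Rightarrow> \<theta> (r * coef T n x i j))"

definition elementary_character ::
    "gtype \<Rightarrow> nat \<Rightarrow> ('a::field \<Rightarrow> complex) \<Rightarrow> eps_root \<Rightarrow> 'a \<Rightarrow> 'a mat \<Rightarrow> complex" where
  "elementary_character T n \<theta> \<alpha> r = induced (U T n) (U_root T n \<alpha>) (lin_char T n \<theta> \<alpha> r)"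

definition supercharacter ::
    "gtype \<Rightarrow> nat \<Rightarrow> ('a::field \<Rightarrow> complex) \<Rightarrow> eps_root set \<Rightarrow> (eps_root \<Rightarrow> 'a) \<Rightarrow> 'a mat \<Rightarrow> complex" where
  "supercharacter T n \<theta> D \<phi> x = (\<Prod>\<alpha>\<in>D. elementary_character T n \<theta> \<alpha> (\<phi> \<alpha>) x)"

lemma GL_simps: "mult (GL m) = (*)" "one (GL m) = 1\<^sub>m m"
  by (simp_all add: GL_def units_of_def ring_mat_def)

lemma carrier_GL:
  "carrier (GL m) = {g \<in> carrier_mat m m. \<exists>h \<in> carrier_mat m m. h * g = 1\<^sub>m m \<and> g * h = 1\<^sub>m m}"
  by (auto simp: GL_def units_of_def ring_mat_def Units_def)

lemma group_GL: "group (GL m :: 'a::field mat monoid)"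
  unfolding GL_def by (intro monoid.units_group ring.axioms(2) ring_mat)

lemma unitriangular_inverse:
  assumes x: "x \<in> unitriangular m" and y: "y \<in> carrier_mat m m" and xy: "x * y = 1\<^sub>m m"
  shows "y \<in> unitriangular m"
proof -
  have xc: "x \<in> carrier_mat m m" using x by (simp add: unitriangular_def)
  have *: "j \<le> i \<Longrightarrow> y $$ (i, j) = (if i = j then 1 else 0)" if "i < m" for i j
    using that
  proof (induction "m - i" arbitrary: i rule: less_induct)
    case less
    have "(x * y) $$ (i, j) = (\<Sum>k<m. x $$ (i, k) * y $$ (k, j))"
      using less.prems xc y by (simp add: scalar_prod_def lessThan_atLeast0)
    also have "\<dots> = (\<Sum>k<m. if k = i then y $$ (i, j) else 0)"
    proof (rule sum.cong[OF refl])
      fix k assume k: "k \<in> {..<m}"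
      consider "k < i" | "k = i" | "k > i" by linarith
      then show "x $$ (i, k) * y $$ (k, j) = (if k = i then y $$ (i, j) else 0)"
      proof cases
        case 1 then show ?thesis using x less.prems by (auto simp: unitriangular_def)
      next
        case 2 then show ?thesis using x less.prems by (auto simp: unitriangular_def)
      next
        case 3
        then have "y $$ (k, j) = 0" using less.hyps[of k] less.prems k by auto
        then show ?thesis using 3 by simp
      qed
    qed
    also have "\<dots> = y $$ (i, j)" using less.prems by simp
    finally show ?case using xy less.prems by simp
  qed
  then show ?thesis using y by (auto simp: unitriangular_def)
qed

lemma unitriangular_mult:
  assumes x: "x \<in> unitriangular m" and y: "y \<in> unitriangular m"
  shows "x * y \<in> unitriangular m"
proof -
  have xc: "x \<in> carrier_mat m m" and yc: "y \<in> carrier_mat m m"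
    using x y by (simp_all add: unitriangular_def)
  have "(x * y) $$ (i, j) = (if i = j then 1 else 0)" if "i < m" "j \<le> i" for i j
  proof -
    have "(x * y) $$ (i, j) = (\<Sum>k<m. x $$ (i, k) * y $$ (k, j))"
      using that xc yc by (simp add: scalar_prod_def lessThan_atLeast0)
    also have "\<dots> = (\<Sum>k<m. if k = i then y $$ (i, j) else 0)"
    proof (rule sum.cong[OF refl])
      fix k assume k: "k \<in> {..<m}"
      consider "k < i" | "k = i" | "k > i" by linarith
      then show "x $$ (i, k) * y $$ (k, j) = (if k = i then y $$ (i, j) else 0)"
        using x y k that by cases (auto simp: unitriangular_def upper_triangular_def)
    qed
    also have "\<dots> = y $$ (i, j)" using that by simp
    finally show ?thesis using y that by (auto simp: unitriangular_def)
  qed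
  then show ?thesis using xc yc by (auto simp: unitriangular_def)
qed

lemma unitriangular_in_GL:
  assumes "x \<in> unitriangular m" shows "x \<in> carrier (GL m)"
proof -
  have x: "x \<in> carrier_mat m m" "upper_triangular x" using assms by (auto simp: unitriangular_def)
  have "diag_mat x = map (\<lambda>_. 1) [0..<m]"
    using assms by (auto simp: diag_mat_def unitriangular_def intro!: map_cong)
  then have "det x = 1"
    using det_upper_triangular[OF x(2,1)] by (simp add: prod_list_replicate map_replicate_const)
  then show ?thesis
    using det_non_zero_imp_unit[OF x(1), of "()"] by (simp add: GL_def units_of_def)
qed

lemma gram_carrier: "gram T n \<in> carrier_mat (mdim T n) (mdim T n)"
  by (cases T) (auto simp: gram_def mdim_def rdim_def antidiag_def mult_2)

lemma subgroup_U: "subgroup (carrier (U T n)) (GL (mdim T n) :: 'a::field mat monoid)"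
proof -
  let ?m = "mdim T n" and ?B = "gram T n :: 'a mat"
  interpret group "GL ?m :: 'a mat monoid" by (rule group_GL)
  have B: "?B \<in> carrier_mat ?m ?m" by (rule gram_carrier)
  show ?thesis
  proof
    show "carrier (U T n) \<subseteq> carrier (GL ?m :: 'a mat monoid)"
      by (auto simp: U_def classical_group_def)
  next
    fix x y :: "'a mat" assume xy: "x \<in> carrier (U T n)" "y \<in> carrier (U T n)"
    have c: "x \<in> carrier_mat ?m ?m" "y \<in> carrier_mat ?m ?m"
      using xy by (auto simp: U_def unitriangular_def)
    have xB: "transpose_mat x * ?B * x = ?B" and yB: "transpose_mat y * ?B * y = ?B"
      using xy by (auto simp: U_def classical_group_def)
    have "transpose_mat (x * y) * ?B * (x * y) = transpose_mat y * (transpose_mat x * ?B * x) * y"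
      using c B by (simp add: transpose_mult[of _ ?m ?m] assoc_mult_mat[of _ ?m ?m _ ?m _ ?m])
    also have "\<dots> = ?B" by (simp add: xB yB)
    finally show "x \<otimes>\<^bsub>GL ?m\<^esub> y \<in> carrier (U T n)"
      using xy m_closed[of x y] unitriangular_mult[of x ?m y]
      by (auto simp: U_def classical_group_def GL_simps)
  next
    show "\<one>\<^bsub>GL ?m\<^esub> \<in> carrier (U T n :: 'a mat monoid)"
      using one_closed B
      by (auto simp: U_def classical_group_def GL_simps unitriangular_def)
  next
    fix x :: "'a mat" assume x: "x \<in> carrier (U T n)"
    let ?y = "inv\<^bsub>GL ?m\<^esub> x"
    have xG: "x \<in> carrier (GL ?m)" using x by (auto simp: U_def classical_group_def)
    have y: "?y \<in> carrier (GL ?m)" using xG by (rule inv_closed)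
    have c: "x \<in> carrier_mat ?m ?m" "?y \<in> carrier_mat ?m ?m"
      using xG y by (auto simp: carrier_GL)
    have xy: "x * ?y = 1\<^sub>m ?m" using r_inv[OF xG] by (simp add: GL_simps)
    have xB: "transpose_mat x * ?B * x = ?B" using x by (auto simp: U_def classical_group_def)
    have "transpose_mat ?y * ?B * ?y = transpose_mat ?y * (transpose_mat x * ?B * x) * ?y"
      by (simp add: xB)
    also have "\<dots> = transpose_mat (x * ?y) * ?B * (x * ?y)"
      using c B by (simp add: transpose_mult[of _ ?m ?m] assoc_mult_mat[of _ ?m ?m _ ?m _ ?m] del: xy)
    also have "\<dots> = ?B" using B by (simp add: xy)
    finally show "?y \<in> carrier (U T n)"
      using y x unitriangular_inverse[OF _ c(2) xy] by (auto simp: U_def classical_group_def)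
  qed
qed

lemma group_U: "group (U T n :: 'a::field mat monoid)"
proof -
  have "U T n = GL (mdim T n) \<lparr>carrier := carrier (U T n :: 'a mat monoid)\<rparr>" by (simp add: U_def)
  then show ?thesis using subgroup.subgroup_is_group[OF subgroup_U group_GL] by metis
qed

definition block3 :: "nat \<Rightarrow> nat \<Rightarrow> 'a mat \<Rightarrow> 'a mat \<Rightarrow> 'a mat \<Rightarrow> 'a mat \<Rightarrow> 'a mat \<Rightarrow> 'a mat
    \<Rightarrow> 'a mat \<Rightarrow> 'a mat \<Rightarrow> 'a mat \<Rightarrow> 'a::field mat" where
  "block3 n r A11 A12 A13 A21 A22 A23 A31 A32 A33 = mat (n + r + n) (n + r + n) (\<lambda>(i, j).
     if i < n then
       (if j < n then A11 $$ (i, j) else if j < n + r then A12 $$ (i, j - n) else A13 $$ (i, j - n - r))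
     else if i < n + r then
       (if j < n then A21 $$ (i - n, j) else if j < n + r then A22 $$ (i - n, j - n)
        else A23 $$ (i - n, j - n - r))
     else
       (if j < n then A31 $$ (i - n - r, j) else if j < n + r then A32 $$ (i - n - r, j - n)
        else A33 $$ (i - n - r, j - n - r)))"

lemma block3_carrier: "block3 n r A B C D E F G H K \<in> carrier_mat (n + r + n) (n + r + n)"
  by (simp add: block3_def)

lemma block3_index:
  "i < n \<Longrightarrow> j < n \<Longrightarrow> block3 n r A B C D E F G H K $$ (i, j) = A $$ (i, j)"
  "i < n \<Longrightarrow> j < r \<Longrightarrow> block3 n r A B C D E F G H K $$ (i, n + j) = B $$ (i, j)"
  "i < n \<Longrightarrow> j < n \<Longrightarrow> block3 n r A B C D E F G H K $$ (i, n + r + j) = C $$ (i, j)"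
  "i < r \<Longrightarrow> j < n \<Longrightarrow> block3 n r A B C D E F G H K $$ (n + i, j) = D $$ (i, j)"
  "i < r \<Longrightarrow> j < r \<Longrightarrow> block3 n r A B C D E F G H K $$ (n + i, n + j) = E $$ (i, j)"
  "i < r \<Longrightarrow> j < n \<Longrightarrow> block3 n r A B C D E F G H K $$ (n + i, n + r + j) = F $$ (i, j)"
  "i < n \<Longrightarrow> j < n \<Longrightarrow> block3 n r A B C D E F G H K $$ (n + r + i, j) = G $$ (i, j)"
  "i < n \<Longrightarrow> j < r \<Longrightarrow> block3 n r A B C D E F G H K $$ (n + r + i, n + j) = H $$ (i, j)"
  "i < n \<Longrightarrow> j < n \<Longrightarrow> block3 n r A B C D E F G H K $$ (n + r + i, n + r + j) = K $$ (i, j)"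
  by (simp_all add: block3_def)

lemma sum_split3:
  "(\<Sum>k = 0..<n + r + n. f k) =
     (\<Sum>k = 0..<n. f k) + (\<Sum>k = 0..<r. f (n + k)) + (\<Sum>k = 0..<(n::nat). f (n + r + k) :: 'a::comm_monoid_add)"
proof -
  have "(\<Sum>k = 0..<n + r + n. f k) = (\<Sum>k = 0..<n. f k) + (\<Sum>k = n..<n+r. f k) + (\<Sum>k = n+r..<n+r+n. f k)"
    by (simp add: sum.atLeastLessThan_concat)
  also have "(\<Sum>k = n..<n+r. f k) = (\<Sum>k = 0..<r. f (n + k))"
    using sum.shift_bounds_nat_ivl[of f 0 n r] by (simp add: add.commute)
  also have "(\<Sum>k = n+r..<n+r+n. f k) = (\<Sum>k = 0..<n. f (n + r + k))"
    using sum.shift_bounds_nat_ivl[of f 0 "n+r" n] by (simp add: add.commute)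
  finally show ?thesis .
qed

lemma block3_mult:
  assumes "A \<in> carrier_mat n n" "B \<in> carrier_mat n r" "C \<in> carrier_mat n n"
    "D \<in> carrier_mat r n" "E \<in> carrier_mat r r" "F \<in> carrier_mat r n"
    "G \<in> carrier_mat n n" "H \<in> carrier_mat n r" "K \<in> carrier_mat n n"
    "A' \<in> carrier_mat n n" "B' \<in> carrier_mat n r" "C' \<in> carrier_mat n n"
    "D' \<in> carrier_mat r n" "E' \<in> carrier_mat r r" "F' \<in> carrier_mat r n"
    "G' \<in> carrier_mat n n" "H' \<in> carrier_mat n r" "K' \<in> carrier_mat n n"
  shows "block3 n r A B C D E F G H K * block3 n r A' B' C' D' E' F' G' H' K' =
    block3 n r (A*A' + B*D' + C*G') (A*B' + B*E' + C*H') (A*C' + B*F' + C*K')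
               (D*A' + E*D' + F*G') (D*B' + E*E' + F*H') (D*C' + E*F' + F*K')
               (G*A' + H*D' + K*G') (G*B' + H*E' + K*H') (G*C' + H*F' + K*K')"
  (is "?L = ?R")
proof (rule eq_matI)
  fix i j assume "i < dim_row ?R" "j < dim_col ?R"
  then have ij: "i < n + r + n" "j < n + r + n" by (simp_all add: block3_def)
  have dims: "dim_row A = n" "dim_row B = n" "dim_row C = n" "dim_row D = r" "dim_row E = r"
      "dim_row F = r" "dim_row G = n" "dim_row H = n" "dim_row K = n"
      "dim_col A = n" "dim_col B = r" "dim_col C = n" "dim_col D = n" "dim_col E = r"
      "dim_col F = n" "dim_col G = n" "dim_col H = r" "dim_col K = n"
      "dim_row A' = n" "dim_row B' = n" "dim_row C' = n" "dim_row D' = r" "dim_row E' = r"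
      "dim_row F' = r" "dim_row G' = n" "dim_row H' = n" "dim_row K' = n"
      "dim_col A' = n" "dim_col B' = r" "dim_col C' = n" "dim_col D' = n" "dim_col E' = r"
      "dim_col F' = n" "dim_col G' = n" "dim_col H' = r" "dim_col K' = n"
    using assms by (simp_all only: carrier_mat_def mem_Collect_eq)
  let ?P = "block3 n r A B C D E F G H K" and ?Q = "block3 n r A' B' C' D' E' F' G' H' K'"
  have L: "?L $$ (i, j) = (\<Sum>k = 0..<n + r + n. ?P $$ (i, k) * ?Q $$ (k, j))"
    using ij block3_carrier[of n r A B C D E F G H K] block3_carrier[of n r A' B' C' D' E' F' G' H' K']
    by (simp add: scalar_prod_def)
  consider "i < n" | i' where "i = n + i'" "i' < r" | i' where "i = n + r + i'" "i' < n"
    using ij(1) by (metis add.assoc less_diff_conv2 linorder_not_less nat_add_left_cancel_less le_iff_add)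
  note ci = this
  consider "j < n" | j' where "j = n + j'" "j' < r" | j' where "j = n + r + j'" "j' < n"
    using ij(2) by (metis add.assoc less_diff_conv2 linorder_not_less nat_add_left_cancel_less le_iff_add)
  note cj = this
  show "?L $$ (i, j) = ?R $$ (i, j)"
    unfolding L sum_split3
    by (rule ci; rule cj) (simp_all add: block3_index scalar_prod_def dims)
qed (simp_all add: block3_def)

lemma block3_transpose:
  assumes "A \<in> carrier_mat n n" "B \<in> carrier_mat n r" "C \<in> carrier_mat n n"
    "D \<in> carrier_mat r n" "E \<in> carrier_mat r r" "F \<in> carrier_mat r n"
    "G \<in> carrier_mat n n" "H \<in> carrier_mat n r" "K \<in> carrier_mat n n"
  shows "transpose_mat (block3 n r A B C D E F G H K) =
    block3 n r (transpose_mat A) (transpose_mat D) (transpose_mat G)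
       (transpose_mat B) (transpose_mat E) (transpose_mat H)
       (transpose_mat C) (transpose_mat F) (transpose_mat K)"
  using assms by (intro eq_matI) (auto simp: block3_def)

lemma block3_eq_iff:
  assumes "A \<in> carrier_mat n n" "B \<in> carrier_mat n r" "C \<in> carrier_mat n n"
    "D \<in> carrier_mat r n" "E \<in> carrier_mat r r" "F \<in> carrier_mat r n"
    "G \<in> carrier_mat n n" "H \<in> carrier_mat n r" "K \<in> carrier_mat n n"
    "A' \<in> carrier_mat n n" "B' \<in> carrier_mat n r" "C' \<in> carrier_mat n n"
    "D' \<in> carrier_mat r n" "E' \<in> carrier_mat r r" "F' \<in> carrier_mat r n"
    "G' \<in> carrier_mat n n" "H' \<in> carrier_mat n r" "K' \<in> carrier_mat n n"
  shows "block3 n r A B C D E F G H K = block3 n r A' B' C' D' E' F' G' H' K' \<longleftrightarrow>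
    A = A' \<and> B = B' \<and> C = C' \<and> D = D' \<and> E = E' \<and> F = F' \<and> G = G' \<and> H = H' \<and> K = K'"
  (is "?P = ?Q \<longleftrightarrow> _")
proof
  assume eq: "?P = ?Q"
  have e: "?P $$ (i, j) = ?Q $$ (i, j)" for i j by (simp add: eq)
  have "A = A'"
  proof (rule eq_matI)
    fix i j assume "i < dim_row A'" "j < dim_col A'"
    then show "A $$ (i, j) = A' $$ (i, j)" using assms e[of i j] by (simp add: block3_index)
  qed (use assms in auto)
  moreover have "B = B'"
  proof (rule eq_matI)
    fix i j assume "i < dim_row B'" "j < dim_col B'"
    then show "B $$ (i, j) = B' $$ (i, j)" using assms e[of i "n + j"] by (simp add: block3_index)
  qed (use assms in auto)
  moreover have "C = C'"
  proof (rule eq_matI)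
    fix i j assume "i < dim_row C'" "j < dim_col C'"
    then show "C $$ (i, j) = C' $$ (i, j)" using assms e[of i "n + r + j"] by (simp add: block3_index)
  qed (use assms in auto)
  moreover have "D = D'"
  proof (rule eq_matI)
    fix i j assume "i < dim_row D'" "j < dim_col D'"
    then show "D $$ (i, j) = D' $$ (i, j)" using assms e[of "n + i" j] by (simp add: block3_index)
  qed (use assms in auto)
  moreover have "E = E'"
  proof (rule eq_matI)
    fix i j assume "i < dim_row E'" "j < dim_col E'"
    then show "E $$ (i, j) = E' $$ (i, j)" using assms e[of "n + i" "n + j"] by (simp add: block3_index)
  qed (use assms in auto)
  moreover have "F = F'"
  proof (rule eq_matI)
    fix i j assume "i < dim_row F'" "j < dim_col F'"
    then show "F $$ (i, j) = F' $$ (i, j)" using assms e[of "n + i" "n + r + j"] by (simp add: block3_index)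
  qed (use assms in auto)
  moreover have "G = G'"
  proof (rule eq_matI)
    fix i j assume "i < dim_row G'" "j < dim_col G'"
    then show "G $$ (i, j) = G' $$ (i, j)" using assms e[of "n + r + i" j] by (simp add: block3_index)
  qed (use assms in auto)
  moreover have "H = H'"
  proof (rule eq_matI)
    fix i j assume "i < dim_row H'" "j < dim_col H'"
    then show "H $$ (i, j) = H' $$ (i, j)" using assms e[of "n + r + i" "n + j"] by (simp add: block3_index)
  qed (use assms in auto)
  moreover have "K = K'"
  proof (rule eq_matI)
    fix i j assume "i < dim_row K'" "j < dim_col K'"
    then show "K $$ (i, j) = K' $$ (i, j)" using assms e[of "n + r + i" "n + r + j"] by (simp add: block3_index)
  qed (use assms in auto)
  ultimately show "A = A' \<and> B = B' \<and> C = C' \<and> D = D' \<and> E = E' \<and> F = F' \<and> G = G' \<and> H = H' \<and> K = K'"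
    by blast
qed simp

lemma dist_entry_iff:
  assumes "\<alpha> \<in> \<Phi> T n"
  shows "(i, j) \<in> entries \<alpha> \<and> 1 \<le> i \<and> i \<le> int n \<and> i \<prec> j \<and> j \<preceq> - i \<longleftrightarrow>
    (i, j) = (case \<alpha> of EpsMinus a b \<Rightarrow> (a, b) | EpsPlus a b \<Rightarrow> (a, - b) | TwoEps a \<Rightarrow> (a, - a) | Eps a \<Rightarrow> (a, 0))"
proof (cases \<alpha>)
  case (EpsMinus a b)
  then have "1 \<le> a" "a < b" "b \<le> int n" using assms by (auto simp: \<Phi>_def split: gtype.splits)
  then show ?thesis using EpsMinus by (auto simp: prec_def preceq_def)
next
  case (EpsPlus a b)
  then have "1 \<le> a" "a < b" "b \<le> int n" using assms by (auto simp: \<Phi>_def split: gtype.splits)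
  then show ?thesis using EpsPlus by (auto simp: prec_def preceq_def)
next
  case (TwoEps a)
  then have "1 \<le> a" "a \<le> int n" using assms by (auto simp: \<Phi>_def split: gtype.splits)
  then show ?thesis using TwoEps by (auto simp: prec_def preceq_def)
next
  case (Eps a)
  then have "1 \<le> a" "a \<le> int n" using assms by (auto simp: \<Phi>_def split: gtype.splits)
  then show ?thesis using Eps by (auto simp: prec_def preceq_def)
qed

lemma dist_entry_eq:
  assumes "\<alpha> \<in> \<Phi> T n"
  shows "dist_entry n \<alpha> =
    (case \<alpha> of EpsMinus a b \<Rightarrow> (a, b) | EpsPlus a b \<Rightarrow> (a, - b) | TwoEps a \<Rightarrow> (a, - a) | Eps a \<Rightarrow> (a, 0))"
proof -
  have "(\<lambda>(i, j). (i, j) \<in> entries \<alpha> \<and> 1 \<le> i \<and> i \<le> int n \<and> i \<prec> j \<and> j \<preceq> - i) =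
    (\<lambda>p. p = (case \<alpha> of EpsMinus a b \<Rightarrow> (a, b) | EpsPlus a b \<Rightarrow> (a, - b) | TwoEps a \<Rightarrow> (a, - a) | Eps a \<Rightarrow> (a, 0)))"
    unfolding fun_eq_iff split_paired_All case_prod_conv dist_entry_iff[OF assms] by blast
  then show ?thesis unfolding dist_entry_def by simp
qed

lemma block3_cases:
  assumes "g \<in> carrier_mat (n + r + n) (n + r + n)"
  obtains A B C D E F G H K where
    "A \<in> carrier_mat n n" "B \<in> carrier_mat n r" "C \<in> carrier_mat n n"
    "D \<in> carrier_mat r n" "E \<in> carrier_mat r r" "F \<in> carrier_mat r n"
    "G \<in> carrier_mat n n" "H \<in> carrier_mat n r" "K \<in> carrier_mat n n"
    "g = block3 n r A B C D E F G H K"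
proof -
  let ?s = "\<lambda>a b c d. mat b d (\<lambda>(i, j). g $$ (a + i, c + j))"
  have "g = block3 n r (?s 0 n 0 n) (?s 0 n n r) (?s 0 n (n + r) n) (?s n r 0 n) (?s n r n r)
      (?s n r (n + r) n) (?s (n + r) n 0 n) (?s (n + r) n n r) (?s (n + r) n (n + r) n)"
    using assms by (intro eq_matI) (auto simp: block3_def)
  then show thesis by (intro that) auto
qed

lemma antidiag_carrier: "antidiag n \<in> carrier_mat n n"
  by (simp add: antidiag_def)

lemma antidiag_transpose: "transpose_mat (antidiag n) = antidiag n"
  by (intro eq_matI) (auto simp: antidiag_def add.commute)

lemma antidiag_mult_index:
  assumes "A \<in> carrier_mat n c" "i < n" "j < c"
  shows "(antidiag n * A) $$ (i, j) = A $$ (n - 1 - i, j)"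
proof -
  have "(antidiag n * A) $$ (i, j) = (\<Sum>k = 0..<n. antidiag n $$ (i, k) * A $$ (k, j))"
    using assms by (simp add: scalar_prod_def antidiag_def)
  also have "\<dots> = (\<Sum>k = 0..<n. if k = n - 1 - i then A $$ (k, j) else 0)"
    by (rule sum.cong) (use assms in \<open>auto simp: antidiag_def\<close>)
  finally show ?thesis using assms by simp
qed

lemma mult_antidiag_index:
  assumes "A \<in> carrier_mat c n" "i < c" "j < n"
  shows "(A * antidiag n) $$ (i, j) = A $$ (i, n - 1 - j)"
proof -
  have "(A * antidiag n) $$ (i, j) = (\<Sum>k = 0..<n. A $$ (i, k) * antidiag n $$ (k, j))"
    using assms by (simp add: scalar_prod_def antidiag_def)
  also have "\<dots> = (\<Sum>k = 0..<n. if k = n - 1 - j then A $$ (i, k) else 0)"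
    by (rule sum.cong) (use assms in \<open>auto simp: antidiag_def\<close>)
  finally show ?thesis using assms by simp
qed

lemma antidiag_square: "antidiag n * antidiag n = 1\<^sub>m n"
  by (intro eq_matI)
    (auto simp: antidiag_mult_index[OF antidiag_carrier] carrier_matD[OF antidiag_carrier] simp del: index_mult_mat(1),
      auto simp: antidiag_def)

lemma antidiag_cancel:
  "A \<in> carrier_mat n c \<Longrightarrow> antidiag n * (antidiag n * A) = A"
  using assoc_mult_mat[OF antidiag_carrier antidiag_carrier, of A n c]
  by (simp add: antidiag_square)

lemma gram_block3:
  "gram T n = block3 n (rdim T) (0\<^sub>m n n) (0\<^sub>m n (rdim T)) (antidiag n)
     (0\<^sub>m (rdim T) n) (1\<^sub>m (rdim T)) (0\<^sub>m (rdim T) n)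
     ((if T = Symplectic then -1 else 1) \<cdot>\<^sub>m antidiag n) (0\<^sub>m n (rdim T)) (0\<^sub>m n n)"
  by (cases T; intro eq_matI)
    (auto simp: gram_def mdim_def rdim_def antidiag_def block3_def mult_2)

lemma unitriangular_antidiag_conj:
  assumes "y \<in> unitriangular n"
  shows "antidiag n * transpose_mat y * antidiag n \<in> unitriangular n"
proof -
  have y: "y \<in> carrier_mat n n" using assms by (simp add: unitriangular_def)
  have c: "antidiag n * transpose_mat y \<in> carrier_mat n n"
    using y antidiag_carrier by (meson mult_carrier_mat transpose_carrier_mat)
  have "(antidiag n * transpose_mat y * antidiag n) $$ (i, j) = y $$ (n - 1 - j, n - 1 - i)"
    if "i < n" "j < n" for i j
    using that y c by (simp add: mult_antidiag_index[of _ n n] antidiag_mult_index[of _ n n] del: index_mult_mat)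
  then show ?thesis
    using c assms mult_carrier_mat[OF c antidiag_carrier]
    by (auto simp: unitriangular_def upper_triangular_def simp del: index_mult_mat(1))
qed

lemma upper_block_in_U_iff:
  fixes x :: "'a::field mat"
  assumes x: "x \<in> unitriangular n" and u: "u \<in> carrier_mat n (rdim T)" and z: "z \<in> carrier_mat n n"
    and f: "f \<in> carrier_mat (rdim T) n" and S: "S \<in> carrier_mat n n"
  defines "s \<equiv> (if T = Symplectic then -1 else 1 :: 'a)"
  shows "(let g = block3 n (rdim T) x (x * u) (x * z) (0\<^sub>m (rdim T) n) (1\<^sub>m (rdim T)) f
                    (0\<^sub>m n n) (0\<^sub>m n (rdim T)) S
          in transpose_mat g * gram T n * g = gram T n) \<longleftrightarrow>
    S = antidiag n * transpose_mat (inv\<^bsub>GL n\<^esub> x) * antidiag n \<and>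
    f = - (transpose_mat u * antidiag n) \<and>
    antidiag n * transpose_mat z + s \<cdot>\<^sub>m (z * antidiag n) = - (u * transpose_mat u)"
proof -
  define r where "r = rdim T"
  note [simp] = mult_carrier_mat[of _ n n _ n] mult_carrier_mat[of _ r n _ n]
    mult_carrier_mat[of _ n r _ n] mult_carrier_mat[of _ n n _ r]
  let ?J = "antidiag n :: 'a mat" and ?T = transpose_mat
  define y where "y = inv\<^bsub>GL n\<^esub> x"
  define w where "w = x * z" define v where "v = x * u"
  have xc: "x \<in> carrier_mat n n" using x by (simp add: unitriangular_def)
  have J: "?J \<in> carrier_mat n n" by (rule antidiag_carrier)
  interpret GL: group "GL n :: 'a mat monoid" by (rule group_GL)
  have xG: "x \<in> carrier (GL n)" using x by (rule unitriangular_in_GL)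
  have yc: "y \<in> carrier_mat n n" using GL.inv_closed[OF xG] by (auto simp: y_def carrier_GL)
  have yx: "y * x = 1\<^sub>m n" and xy: "x * y = 1\<^sub>m n"
    using GL.l_inv[OF xG] GL.r_inv[OF xG] by (simp_all add: y_def GL_simps)
  note u' = u[folded r_def] and f' = f[folded r_def]
  have wc: "w \<in> carrier_mat n n" and vc: "v \<in> carrier_mat n r"
    using xc z u' by (simp_all add: w_def v_def)
  let ?g = "block3 n r x v w (0\<^sub>m r n) (1\<^sub>m r) f (0\<^sub>m n n) (0\<^sub>m n r) S"
  have gT: "?T ?g = block3 n r (?T x) (0\<^sub>m n r) (0\<^sub>m n n) (?T v) (1\<^sub>m r) (0\<^sub>m r n) (?T w) (?T f) (?T S)"
    using xc vc wc f' S by (subst block3_transpose) simp_all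
  have gram: "gram T n = block3 n r (0\<^sub>m n n) (0\<^sub>m n r) ?J (0\<^sub>m r n) (1\<^sub>m r) (0\<^sub>m r n)
     (s \<cdot>\<^sub>m ?J) (0\<^sub>m n r) (0\<^sub>m n n)"
    using gram_block3[of T n, where 'a = 'a] by (simp add: s_def r_def)
  have 1: "?T ?g * gram T n =
    block3 n r (0\<^sub>m n n) (0\<^sub>m n r) (?T x * ?J)  (0\<^sub>m r n) (1\<^sub>m r) (?T v * ?J)
      (?T S * (s \<cdot>\<^sub>m ?J)) (?T f) (?T w * ?J)"
    unfolding gT gram using xc vc wc f' S J
    by (subst block3_mult) simp_all
  have cx: "?T S * (s \<cdot>\<^sub>m ?J) * x \<in> carrier_mat n n"
    using S J xc by (intro carrier_matI) simp_all
  have 2: "?T ?g * gram T n * ?g = block3 n r (0\<^sub>m n n) (0\<^sub>m n r) (?T x * ?J * S)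
     (0\<^sub>m r n) (1\<^sub>m r) (f + ?T v * ?J * S)
     (?T S * (s \<cdot>\<^sub>m ?J) * x) (?T S * (s \<cdot>\<^sub>m ?J) * v + ?T f)
     (?T S * (s \<cdot>\<^sub>m ?J) * w + ?T f * f + ?T w * ?J * S)"
    unfolding 1 using xc vc wc f' S J
    by (subst block3_mult) (simp_all add: right_add_zero_mat[OF cx])
  have 3: "?T ?g * gram T n * ?g = gram T n \<longleftrightarrow> ?T x * ?J * S = ?J \<and> f + ?T v * ?J * S = 0\<^sub>m r n \<and>
     ?T S * (s \<cdot>\<^sub>m ?J) * x = s \<cdot>\<^sub>m ?J \<and> ?T S * (s \<cdot>\<^sub>m ?J) * v + ?T f = 0\<^sub>m n r \<and>
     ?T S * (s \<cdot>\<^sub>m ?J) * w + ?T f * f + ?T w * ?J * S = 0\<^sub>m n n"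
    unfolding 2 unfolding gram using xc vc wc f' S J
    by (subst block3_eq_iff) (simp_all add: cx)
  have assoc: "A * B * C = A * (B * C)"
    if "A \<in> carrier_mat a b" "B \<in> carrier_mat b c" "C \<in> carrier_mat c d"
    for A B C :: "'a mat" and a b c d
    using that by (rule assoc_mult_mat)
  have tyx: "?T x * ?T y = 1\<^sub>m n" and txy: "?T y * ?T x = 1\<^sub>m n"
    by (simp_all add: yx xy flip: transpose_mult[OF yc xc] transpose_mult[OF xc yc])
  have S_iff: "?T x * ?J * S = ?J \<longleftrightarrow> S = ?J * ?T y * ?J"
  proof
    assume *: "?T x * ?J * S = ?J"
    have "?J * ?T y * ?J = ?J * ?T y * (?T x * ?J * S)" by (simp only: *)
    also have "\<dots> = ?J * ((?T y * ?T x) * (?J * S))"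
      using xc yc J S by (simp add: assoc[of _ n n _ n _ n] del: txy)
    also have "\<dots> = S" using J S by (simp add: txy antidiag_cancel[of _ n n])
    finally show "S = ?J * ?T y * ?J" ..
  next
    assume *: "S = ?J * ?T y * ?J"
    have "?T x * ?J * S = ?T x * (?J * (?J * (?T y * ?J)))"
      unfolding * using xc yc J by (simp add: assoc[of _ n n _ n _ n])
    also have "\<dots> = (?T x * ?T y) * ?J"
      using xc yc J by (simp add: antidiag_cancel[of _ n n] assoc[of _ n n _ n _ n])
    finally show "?T x * ?J * S = ?J" using J by (simp add: tyx)
  qed
  have main: "f + ?T v * ?J * S = 0\<^sub>m r n \<and>
     ?T S * (s \<cdot>\<^sub>m ?J) * x = s \<cdot>\<^sub>m ?J \<and> ?T S * (s \<cdot>\<^sub>m ?J) * v + ?T f = 0\<^sub>m n r \<and>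
     ?T S * (s \<cdot>\<^sub>m ?J) * w + ?T f * f + ?T w * ?J * S = 0\<^sub>m n n \<longleftrightarrow>
     f = - (?T u * ?J) \<and> ?J * ?T z + s \<cdot>\<^sub>m (z * ?J) = - (u * ?T u)"
    if S1: "?T x * ?J * S = ?J"
  proof -
    have e1: "?T v * ?J * S = ?T u * ?J"
    proof -
      have "?T v * ?J * S = ?T u * (?T x * ?J * S)"
        unfolding v_def transpose_mult[OF xc u'] using xc u' J S
        by (simp add: assoc[of _ r n _ n _ n] assoc[of _ n n _ n _ n])
      then show ?thesis by (simp add: S1)
    qed
    have e2: "?T w * ?J * S = ?T z * ?J"
    proof -
      have "?T w * ?J * S = ?T z * (?T x * ?J * S)"
        unfolding w_def transpose_mult[OF xc z] using xc z J S
        by (simp add: assoc[of _ n n _ n _ n])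
      then show ?thesis by (simp add: S1)
    qed
    have t: "?T S * (s \<cdot>\<^sub>m ?J) * a = s \<cdot>\<^sub>m ?T (?T a * ?J * S)" if a: "a \<in> carrier_mat n c" for a c
    proof -
      have "?T (?T a * ?J * S) = ?T S * (?J * a)"
        using transpose_mult[of "?T a * ?J" c n S n] transpose_mult[of "?T a" c n ?J n] a J S
        by (simp add: antidiag_transpose)
      moreover have "?T S * (s \<cdot>\<^sub>m ?J) * a = s \<cdot>\<^sub>m (?T S * (?J * a))"
        using a J S mult_smult_distrib[of "?T S" n n ?J n s]
          mult_smult_assoc_mat[of "?T S * ?J" n n a c s] assoc[of "?T S" n n ?J n a c] by simp
      ultimately show ?thesis by simp
    qed
    have e3: "?T S * (s \<cdot>\<^sub>m ?J) * x = s \<cdot>\<^sub>m ?J" by (simp add: t[OF xc] S1 antidiag_transpose)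
    have e4: "?T S * (s \<cdot>\<^sub>m ?J) * v = s \<cdot>\<^sub>m (?J * u)"
      using transpose_mult[of "?T u" r n ?J n] u' J
      by (simp add: t[OF vc] e1 antidiag_transpose)
    have e5: "?T S * (s \<cdot>\<^sub>m ?J) * w = s \<cdot>\<^sub>m (?J * z)"
      using transpose_mult[of "?T z" n n ?J n] z J
      by (simp add: t[OF wc] e2 antidiag_transpose)
    have f_iff: "f + ?T v * ?J * S = 0\<^sub>m r n \<longleftrightarrow> f = - (?T u * ?J)"
    proof
      assume *: "f + ?T v * ?J * S = 0\<^sub>m r n"
      have "f $$ (i, j) = - ((?T u * ?J) $$ (i, j))" if "i < r" "j < n" for i j
        using arg_cong[OF *, of "\<lambda>A. A $$ (i, j)"] that f' u' J
        by (simp add: e1 eq_neg_iff_add_eq_0 del: index_mult_mat(1))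
      then show "f = - (?T u * ?J)" using f' u' J by (intro eq_matI) (simp_all del: index_mult_mat(1))
    next
      assume "f = - (?T u * ?J)"
      then show "f + ?T v * ?J * S = 0\<^sub>m r n"
        using f' u' J by (intro eq_matI) (simp_all add: e1 del: index_mult_mat(1))
    qed
    have "?T S * (s \<cdot>\<^sub>m ?J) * v + ?T f = 0\<^sub>m n r \<and>
       (?T S * (s \<cdot>\<^sub>m ?J) * w + ?T f * f + ?T w * ?J * S = 0\<^sub>m n n \<longleftrightarrow>
        ?J * ?T z + s \<cdot>\<^sub>m (z * ?J) = - (u * ?T u))" if fe: "f = - (?T u * ?J)"
    proof
      have tf: "?T f = - (?J * u)"
        using transpose_mult[of "?T u" r n ?J n] u' J unfolding fe
        by (simp add: antidiag_transpose transpose_uminus)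
      show "?T S * (s \<cdot>\<^sub>m ?J) * v + ?T f = 0\<^sub>m n r"
        unfolding e4 tf using u' J
        by (intro eq_matI) (auto simp: s_def r_def rdim_def simp del: index_mult_mat(1) split: if_splits)
      have tff: "?T f * f = ?J * (u * ?T u) * ?J"
        unfolding tf unfolding fe using u' J by (simp add: assoc[of _ n n _ r _ n] assoc[of _ n r _ n _ n] assoc[of _ n n _ n _ n])
      let ?M = "s \<cdot>\<^sub>m (?J * z) + ?J * (u * ?T u) * ?J + ?T z * ?J"
      let ?N = "s \<cdot>\<^sub>m (z * ?J) + u * ?T u + ?J * ?T z"
      have uu: "u * ?T u \<in> carrier_mat n n" using u' by simp
      define q where "q = u * ?T u"
      have q: "q \<in> carrier_mat n n" using uu by (simp add: q_def)
      have idx: "(?J * A) $$ (i, j) = A $$ (n - 1 - i, j)" "(A * ?J) $$ (i, j) = A $$ (i, n - 1 - j)"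
        if "i < n" "j < n" "A \<in> carrier_mat n n" for i j A
        using that by (simp_all add: antidiag_mult_index[of _ n n] mult_antidiag_index[of _ n n])
      have M: "(s \<cdot>\<^sub>m (?J * z) + ?J * q * ?J + ?T z * ?J) $$ (i, j) =
          s * z $$ (n - 1 - i, j) + q $$ (n - 1 - i, n - 1 - j) + z $$ (n - 1 - j, i)" if "i < n" "j < n" for i j
        using that z q J mult_carrier_mat[OF J q] by (simp add: idx del: index_mult_mat(1))
      have N: "(?J * ?T z + s \<cdot>\<^sub>m (z * ?J)) $$ (i, j) = z $$ (j, n - 1 - i) + s * z $$ (i, n - 1 - j)"
         if "i < n" "j < n" for i j
        using that z J by (simp add: idx del: index_mult_mat(1))
      have "s \<cdot>\<^sub>m (?J * z) + ?J * q * ?J + ?T z * ?J = 0\<^sub>m n n \<longleftrightarrow>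
          ?J * ?T z + s \<cdot>\<^sub>m (z * ?J) = - q" (is "?A = _ \<longleftrightarrow> ?B = _")
      proof
        assume *: "?A = 0\<^sub>m n n"
        show "?B = - q"
        proof (rule eq_matI)
          fix i j assume "i < dim_row (- q)" "j < dim_col (- q)"
          then have ij: "i < n" "j < n" using q by auto
          have "?A $$ (n - 1 - i, n - 1 - j) = 0" unfolding * using ij by simp
          then have "s * z $$ (i, n - 1 - j) + q $$ (i, j) + z $$ (j, n - 1 - i) = 0"
            using ij by (subst (asm) M) simp_all
          then have "z $$ (j, n - 1 - i) + s * z $$ (i, n - 1 - j) = - q $$ (i, j)"
            by (simp add: eq_neg_iff_add_eq_0 ac_simps)
          then show "?B $$ (i, j) = (- q) $$ (i, j)" using ij q by (simp add: N)
        qed (use z q J in auto)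
      next
        assume *: "?B = - q"
        show "?A = 0\<^sub>m n n"
        proof (rule eq_matI)
          fix i j assume "i < dim_row (0\<^sub>m n n :: 'a mat)" "j < dim_col (0\<^sub>m n n :: 'a mat)"
          then have ij: "i < n" "j < n" by auto
          have "?B $$ (n - 1 - i, n - 1 - j) = - q $$ (n - 1 - i, n - 1 - j)" unfolding * using ij q by simp
          then have "z $$ (n - 1 - j, i) + s * z $$ (n - 1 - i, j) = - q $$ (n - 1 - i, n - 1 - j)"
            using ij by (subst (asm) N) simp_all
          then show "?A $$ (i, j) = 0\<^sub>m n n $$ (i, j)"
            using ij by (simp only: M) (simp add: eq_neg_iff_add_eq_0 ac_simps)
        qed (use z q J in auto)
      qed
      then show "?T S * (s \<cdot>\<^sub>m ?J) * w + ?T f * f + ?T w * ?J * S = 0\<^sub>m n n \<longleftrightarrow>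
        ?J * ?T z + s \<cdot>\<^sub>m (z * ?J) = - (u * ?T u)"
        unfolding e5 tff e2 q_def .
    qed
    then show ?thesis using f_iff e3 by blast
  qed
  show ?thesis
    unfolding Let_def r_def[symmetric] v_def[symmetric] w_def[symmetric] y_def[symmetric] 3
    using main S_iff by blast
qed

lemma carrier_U_explicit:
  "carrier (U T n :: 'a::field mat monoid) =
     {block3 n (rdim T)
        x                (x * u)        (x * z)
        (0\<^sub>m (rdim T) n) (1\<^sub>m (rdim T)) (- (transpose_mat u * antidiag n))
        (0\<^sub>m n n)        (0\<^sub>m n (rdim T)) (antidiag n * transpose_mat (inv\<^bsub>GL n\<^esub> x) * antidiag n)
      | x u z. x \<in> unitriangular n \<and> u \<in> carrier_mat n (rdim T) \<and> z \<in> carrier_mat n n \<and>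
        (case T of
           Symplectic \<Rightarrow> antidiag n * transpose_mat z - z * antidiag n = 0\<^sub>m n n
         | EvenOrthogonal \<Rightarrow> antidiag n * transpose_mat z + z * antidiag n = 0\<^sub>m n n
         | OddOrthogonal \<Rightarrow> antidiag n * transpose_mat z + z * antidiag n = - (u * transpose_mat u))}"
  (is "_ = ?R")
proof -
  define r where "r = rdim T"
  have m: "mdim T n = n + r + n" by (simp add: mdim_def r_def)
  let ?J = "antidiag n :: 'a mat" and ?T = transpose_mat
  let ?s = "if T = Symplectic then -1 else 1 :: 'a"
  interpret GL: group "GL n :: 'a mat monoid" by (rule group_GL)
  have J: "?J \<in> carrier_mat n n" by (rule antidiag_carrier)
  have cond: "(case T of
           Symplectic \<Rightarrow> ?J * ?T z - z * ?J = 0\<^sub>m n n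
         | EvenOrthogonal \<Rightarrow> ?J * ?T z + z * ?J = 0\<^sub>m n n
         | OddOrthogonal \<Rightarrow> ?J * ?T z + z * ?J = - (u * ?T u)) \<longleftrightarrow>
      ?J * ?T z + ?s \<cdot>\<^sub>m (z * ?J) = - (u * ?T u)"
    if u: "u \<in> carrier_mat n (rdim T)" and z: "z \<in> carrier_mat n n" for u z :: "'a mat"
  proof -
    have 0: "- (u * ?T u) = 0\<^sub>m n n" if "T \<noteq> OddOrthogonal"
      using u that by (intro eq_matI) (auto simp: rdim_def scalar_prod_def)
    have 1: "?J * ?T z + (-1) \<cdot>\<^sub>m (z * ?J) = ?J * ?T z - z * ?J"
      using z J by (intro eq_matI) (auto simp del: index_mult_mat(1))
    have 2: "1 \<cdot>\<^sub>m (z * ?J) = z * ?J"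
      using z J by (intro eq_matI) (auto simp del: index_mult_mat(1))
    show ?thesis using 0 1 2 by (cases T) simp_all
  qed
  have inv_c: "inv\<^bsub>GL n\<^esub> x \<in> carrier_mat n n" "x * inv\<^bsub>GL n\<^esub> x = 1\<^sub>m n"
     "inv\<^bsub>GL n\<^esub> x \<in> unitriangular n" if "x \<in> unitriangular n" for x :: "'a mat"
  proof -
    have xG: "x \<in> carrier (GL n)" using that by (rule unitriangular_in_GL)
    show 1: "inv\<^bsub>GL n\<^esub> x \<in> carrier_mat n n" using GL.inv_closed[OF xG] by (auto simp: carrier_GL)
    show 2: "x * inv\<^bsub>GL n\<^esub> x = 1\<^sub>m n" using GL.r_inv[OF xG] by (simp add: GL_simps)
    show "inv\<^bsub>GL n\<^esub> x \<in> unitriangular n" by (rule unitriangular_inverse[OF that 1 2])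
  qed
  show ?thesis
  proof (intro equalityI subsetI)
    fix g assume "g \<in> ?R"
    then obtain x u z where g: "g = block3 n (rdim T) x (x * u) (x * z)
        (0\<^sub>m (rdim T) n) (1\<^sub>m (rdim T)) (- (?T u * ?J))
        (0\<^sub>m n n) (0\<^sub>m n (rdim T)) (?J * ?T (inv\<^bsub>GL n\<^esub> x) * ?J)"
      and x: "x \<in> unitriangular n" and u: "u \<in> carrier_mat n (rdim T)" and z: "z \<in> carrier_mat n n"
      and c: "?J * ?T z + ?s \<cdot>\<^sub>m (z * ?J) = - (u * ?T u)"
      using cond by auto
    let ?S = "?J * ?T (inv\<^bsub>GL n\<^esub> x) * ?J"
    have S: "?S \<in> unitriangular n" by (rule unitriangular_antidiag_conj[OF inv_c(3)[OF x]])
    have f: "- (?T u * ?J) \<in> carrier_mat (rdim T) n" using u J by simp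
    have iso: "?T g * gram T n * g = gram T n"
      using upper_block_in_U_iff[OF x u z f, of ?S] S c unfolding g Let_def
      by (auto simp: unitriangular_def)
    have "g \<in> unitriangular (mdim T n)"
      using x S unfolding g m r_def by (auto simp: unitriangular_def upper_triangular_def block3_def)
    then show "g \<in> carrier (U T n)"
      using iso unitriangular_in_GL by (auto simp: U_def classical_group_def)
  next
    fix g :: "'a mat" assume "g \<in> carrier (U T n)"
    then have iso: "?T g * gram T n * g = gram T n" and gu: "g \<in> unitriangular (n + r + n)"
      by (auto simp: U_def classical_group_def m)
    have gc: "g \<in> carrier_mat (n + r + n) (n + r + n)" using gu by (simp add: unitriangular_def)
    obtain x v w D E f G H S where bl:
      "x \<in> carrier_mat n n" "v \<in> carrier_mat n r" "w \<in> carrier_mat n n"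
      "D \<in> carrier_mat r n" "E \<in> carrier_mat r r" "f \<in> carrier_mat r n"
      "G \<in> carrier_mat n n" "H \<in> carrier_mat n r" "S \<in> carrier_mat n n"
      and g: "g = block3 n r x v w D E f G H S"
      by (rule block3_cases[OF gc])
    have low: "g $$ (i, j) = 0" if "j < i" "i < n + r + n" for i j
      using gu that by (auto simp: unitriangular_def)
    have dia: "g $$ (i, i) = 1" if "i < n + r + n" for i
      using gu that by (auto simp: unitriangular_def)
    have x: "x \<in> unitriangular n"
    proof -
      have "x $$ (i, j) = 0" if "j < i" "i < n" for i j
        using low[of j i] that by (simp add: g block3_index)
      moreover have "x $$ (i, i) = 1" if "i < n" for i
        using dia[of i] that by (simp add: g block3_index)
      ultimately show ?thesis using bl(1) by (auto simp: unitriangular_def)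
    qed
    have D0: "D = 0\<^sub>m r n"
    proof (rule eq_matI)
      fix i j assume "i < dim_row (0\<^sub>m r n :: 'a mat)" "j < dim_col (0\<^sub>m r n :: 'a mat)"
      then show "D $$ (i, j) = 0\<^sub>m r n $$ (i, j)" using low[of j "n + i"] by (simp add: g block3_index)
    qed (use bl in auto)
    have G0: "G = 0\<^sub>m n n"
    proof (rule eq_matI)
      fix i j assume "i < dim_row (0\<^sub>m n n :: 'a mat)" "j < dim_col (0\<^sub>m n n :: 'a mat)"
      then show "G $$ (i, j) = 0\<^sub>m n n $$ (i, j)" using low[of j "n + r + i"] by (simp add: g block3_index)
    qed (use bl in auto)
    have H0: "H = 0\<^sub>m n r"
    proof (rule eq_matI)
      fix i j assume "i < dim_row (0\<^sub>m n r :: 'a mat)" "j < dim_col (0\<^sub>m n r :: 'a mat)"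
      then show "H $$ (i, j) = 0\<^sub>m n r $$ (i, j)"
        using low[of "n + j" "n + r + i"] by (simp add: g block3_index)
    qed (use bl in auto)
    have E1: "E = 1\<^sub>m r"
    proof (rule eq_matI)
      fix i j assume "i < dim_row (1\<^sub>m r :: 'a mat)" "j < dim_col (1\<^sub>m r :: 'a mat)"
      moreover from this have "i = j" by (auto simp: r_def rdim_def split: if_splits)
      ultimately show "E $$ (i, j) = 1\<^sub>m r $$ (i, j)"
        using dia[of "n + i"] by (simp add: g block3_index)
    qed (use bl in auto)
    define u where "u = inv\<^bsub>GL n\<^esub> x * v" define z where "z = inv\<^bsub>GL n\<^esub> x * w"
    have uc: "u \<in> carrier_mat n (rdim T)" and zc: "z \<in> carrier_mat n n"
      using inv_c[OF x] bl by (simp_all add: u_def z_def r_def)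
    have v: "v = x * u" and w: "w = x * z"
      using assoc_mult_mat[OF bl(1) inv_c(1)[OF x] bl(2)] assoc_mult_mat[OF bl(1) inv_c(1)[OF x] bl(3)]
        inv_c(2)[OF x] bl by (simp_all add: u_def z_def)
    have "S = ?J * ?T (inv\<^bsub>GL n\<^esub> x) * ?J \<and> f = - (?T u * ?J) \<and>
       ?J * ?T z + ?s \<cdot>\<^sub>m (z * ?J) = - (u * ?T u)"
      using upper_block_in_U_iff[OF x uc zc, of f S] iso bl
      unfolding g D0 E1 G0 H0 v w Let_def r_def by blast
    then show "g \<in> ?R"
      using x uc zc cond[OF uc zc] unfolding g D0 E1 G0 H0 v w r_def by blast
  qed
qed

end

theory Submission
  imports Defs "Jordan_Normal_Form.Spectral_Radius" "HOL-Number_Theory.Residues"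
begin

text \<open>The Cayley transform identifies \<open>U\<close> with its Lie algebra, and multiplication by the Gram matrix
  turns the latter into the space of symmetric (symplectic case) or alternating (orthogonal case)
  \<open>m \<times> m\<close> forms \<open>S\<close> supported strictly above the antidiagonal, so that conjugation by \<open>z\<close> becomes
  \<open>S \<mapsto> z S z\<^sup>T\<close>. The full unitriangular group acts by the same formula, hence also on the dual space.
  Averaging over the relevant rows shows that the elementary character of a root is a multiple of
  the average of \<open>\<theta>\<close> over the dual orbit of one symmetrized matrix unit. For a basic \<open>D\<close> the roots
  involve disjoint sets of rows, so the averages multiply, and \<open>\<xi>\<^bsub>D,\<phi>\<^esub>\<close> is a multiple of the average over
  the orbit of a form with at most one nonzero entry in each row. By symmetric Gaussian elimination
  and a Bruhat type argument such forms represent every dual orbit exactly once. Fourier analysis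
  then shows that the supercharacters are pairwise orthogonal and that a positive combination of
  them is the regular character. Orthogonal positive definite class functions have convolution
  zero, so by Schur's lemma they share no irreducible constituent.\<close>

section \<open>Positive definite functions and irreducible characters\<close>

text \<open>The Cayley transform divides only by 2, so it serves every odd p, whereas a truncated
  logarithm would in general need large p. Being built from one inversion, it also carries zero
  patterns of single rows over to forms. The decisive observation is that \<open>U_root\<close> is
  the meet of U with a subgroup Q of the full unitriangular group, given by zeros in two rows.
  Averaging over Q reproduces \<open>lin_char\<close> extended by zero outside
  \<open>U_root\<close>, and every unitriangular matrix is a product of an element of Q and an
  element of U. Inducing to U therefore becomes averaging over the full group, which does not act on
  U but does act on forms. This enlargement pays twice: the rows of a unitriangular matrix can be
  chosen independently, unlike those of an element of U, and the larger orbits admit monomial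
  representatives. A factor 2 occurs both in reading a matrix entry from a form and in pairing two
  forms; the two agree. Positive definiteness replaces a decomposition of supercharacters into
  irreducibles: cancellation in a vanishing scalar product is impossible, so a single irreducible
  representation is all that has to be studied.\<close>

definition pos_def :: "('g, 'b) monoid_scheme \<Rightarrow> ('g \<Rightarrow> complex) \<Rightarrow> bool" where
  "pos_def G f \<longleftrightarrow> (\<exists>(N::nat) a. \<forall>x\<in>carrier G. \<forall>y\<in>carrier G.
     f (x \<otimes>\<^bsub>G\<^esub> inv\<^bsub>G\<^esub> y) = (\<Sum>k<N. a k x * cnj (a k y)))"

lemma pos_defI:
  assumes "finite I"
    and "\<And>x y. x \<in> carrier G \<Longrightarrow> y \<in> carrier G \<Longrightarrow>
      f (x \<otimes>\<^bsub>G\<^esub> inv\<^bsub>G\<^esub> y) = (\<Sum>k\<in>I. a k x * cnj (a k y))"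
  shows "pos_def G f"
proof -
  obtain h where h: "bij_betw h {..<card I} I"
    using ex_bij_betw_nat_finite[OF assms(1)] by (auto simp: atLeast0LessThan)
  show ?thesis
    unfolding pos_def_def
  proof (intro exI ballI)
    fix x y assume "x \<in> carrier G" "y \<in> carrier G"
    then show "f (x \<otimes>\<^bsub>G\<^esub> inv\<^bsub>G\<^esub> y) = (\<Sum>k<card I. a (h k) x * cnj (a (h k) y))"
      using assms(2) sum.reindex_bij_betw[OF h, of "\<lambda>k. a k x * cnj (a k y)"] by simp
  qed
qed

lemma pos_def_one: "pos_def G (\<lambda>x. 1)"
  by (rule pos_defI[of "{()}" _ _ "\<lambda>_ _. 1"]) auto

text \<open>Schur product of Gram kernels. This closure is why kernels are used instead of
  characters: a supercharacter is a product of induced characters, and no representation affording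
  it has to be built.\<close>

lemma pos_def_mult:
  assumes "pos_def G f" "pos_def G g"
  shows "pos_def G (\<lambda>x. f x * g x)"
proof -
  obtain N a where a: "\<And>x y. x \<in> carrier G \<Longrightarrow> y \<in> carrier G \<Longrightarrow>
      f (x \<otimes>\<^bsub>G\<^esub> inv\<^bsub>G\<^esub> y) = (\<Sum>k<N::nat. a k x * cnj (a k y))"
    using assms(1) unfolding pos_def_def by blast
  obtain M b where b: "\<And>x y. x \<in> carrier G \<Longrightarrow> y \<in> carrier G \<Longrightarrow>
      g (x \<otimes>\<^bsub>G\<^esub> inv\<^bsub>G\<^esub> y) = (\<Sum>k<M::nat. b k x * cnj (b k y))"
    using assms(2) unfolding pos_def_def by blast
  show ?thesis
  proof (rule pos_defI[of "{..<N} \<times> {..<M}" _ _ "\<lambda>(k, l) x. a k x * b l x"])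
    fix x y assume "x \<in> carrier G" "y \<in> carrier G"
    then show "f (x \<otimes>\<^bsub>G\<^esub> inv\<^bsub>G\<^esub> y) * g (x \<otimes>\<^bsub>G\<^esub> inv\<^bsub>G\<^esub> y) = (\<Sum>k\<in>{..<N} \<times> {..<M}.
        (case k of (k, l) \<Rightarrow> \<lambda>x. a k x * b l x) x * cnj ((case k of (k, l) \<Rightarrow> \<lambda>x. a k x * b l x) y))"
      by (simp add: a b sum_product sum.cartesian_product mult.assoc mult.left_commute case_prod_unfold)
  qed simp
qed

lemma pos_def_prod:
  assumes "\<And>i. i \<in> I \<Longrightarrow> pos_def G (f i)"
  shows "pos_def G (\<lambda>x. \<Prod>i\<in>I. f i x)"
  using assms
proof (induction I rule: infinite_finite_induct)
  case (insert i I)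
  then show ?case using pos_def_mult[of G "f i" "\<lambda>x. \<Prod>i\<in>I. f i x"] by simp
qed (simp_all add: pos_def_one)

lemma (in group) sum_mult_right_reindex:
  assumes "g \<in> carrier G"
  shows "(\<Sum>y\<in>carrier G. f (y \<otimes> g)) = (\<Sum>y\<in>carrier G. f y)"
  by (rule sum.reindex_bij_witness[of _ "\<lambda>y. y \<otimes> inv g" "\<lambda>y. y \<otimes> g"])
    (use assms in \<open>auto simp: m_assoc\<close>)

text \<open>Extended by zero to G, a unitary linear character of H is a convolution square up to the
  factor |H|, hence a Gram kernel. Inducing adds up conjugates of it, so the Gram vectors are
  indexed by pairs \<open>(z, w)\<close>.\<close>

lemma (in group) pos_def_induced:
  assumes fin: "finite (carrier G)" and H: "subgroup H G"
    and mult: "\<And>x y. x \<in> H \<Longrightarrow> y \<in> H \<Longrightarrow> l (x \<otimes> y) = l x * l y"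
    and unit: "\<And>x. x \<in> H \<Longrightarrow> l x * cnj (l x) = 1"
  shows "pos_def G (induced G H l)"
proof -
  interpret H: subgroup H G by (rule H)
  have finH: "finite H" using fin H.subset finite_subset by blast
  have cH: "card H \<noteq> 0" using finH H.one_closed by (metis card_eq_0_iff empty_iff)
  define L where "L x = (if x \<in> H then l x else 0)" for x
  have Hc: "x \<in> carrier G" if "x \<in> H" for x using that H.subset by blast
  have linv: "l (x \<otimes> inv y) = l x * cnj (l y)" if "x \<in> H" "y \<in> H" for x y
  proof -
    have "l x = l (x \<otimes> inv y) * l y"
      using mult[of "x \<otimes> inv y" y] that by (simp add: Hc m_assoc)
    then show ?thesis using unit[OF that(2)] by simp
  qed
  \<comment> \<open>Only the |H| elements w with yw in H contribute, and for them xw lies in H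
    exactly when x y^-1 does; multiplicativity then makes all these terms equal.\<close>
  have key: "L (x \<otimes> inv y) = (\<Sum>w\<in>carrier G. L (x \<otimes> w) * cnj (L (y \<otimes> w))) / of_nat (card H)"
    if x: "x \<in> carrier G" and y: "y \<in> carrier G" for x y
  proof -
    have mem: "x \<otimes> w \<in> H \<longleftrightarrow> x \<otimes> inv y \<in> H" if w: "w \<in> carrier G" "y \<otimes> w \<in> H" for w
    proof -
      have 1: "x \<otimes> w = (x \<otimes> inv y) \<otimes> (y \<otimes> w)" using x y w(1) by (simp add: m_assoc[symmetric] inv_solve_right')
          (simp add: m_assoc)
      have 2: "x \<otimes> inv y = (x \<otimes> w) \<otimes> inv (y \<otimes> w)" using x y w(1) by (simp add: inv_mult_group m_assoc)
           (simp add: m_assoc[symmetric])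
      show ?thesis using 1 2 w(2) H.m_closed H.m_inv_closed by metis
    qed
    have val: "L (x \<otimes> w) * cnj (L (y \<otimes> w)) = (if y \<otimes> w \<in> H then L (x \<otimes> inv y) else 0)"
      if w: "w \<in> carrier G" for w
    proof (cases "y \<otimes> w \<in> H \<and> x \<otimes> w \<in> H")
      case True
      have "x \<otimes> inv y = (x \<otimes> w) \<otimes> inv (y \<otimes> w)" using x y w by (simp add: inv_mult_group m_assoc)
           (simp add: m_assoc[symmetric])
      then show ?thesis using True mem[OF w] linv[of "x \<otimes> w" "y \<otimes> w"] by (simp add: L_def)
    qed (use mem[OF w] in \<open>auto simp: L_def\<close>)
    have "(\<Sum>w\<in>carrier G. L (x \<otimes> w) * cnj (L (y \<otimes> w))) =
      (\<Sum>w\<in>carrier G. if y \<otimes> w \<in> H then L (x \<otimes> inv y) else 0)"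
      by (rule sum.cong) (auto simp: val)
    also have "\<dots> = (\<Sum>w\<in>carrier G. if w \<in> H then L (x \<otimes> inv y) else 0)"
      by (rule sum.reindex_bij_witness[of _ "\<lambda>w. inv y \<otimes> w" "\<lambda>w. y \<otimes> w"])
        (use y in \<open>auto simp: m_assoc[symmetric]\<close>)
    also have "\<dots> = of_nat (card H) * L (x \<otimes> inv y)"
      using fin H.subset by (simp add: sum.If_cases Int_absorb1)
    finally show ?thesis using cH by simp
  qed
  have ind: "induced G H l x = (\<Sum>z\<in>carrier G. L (z \<otimes> x \<otimes> inv z)) / of_nat (card H)" for x
    unfolding induced_def L_def using fin
    by (simp add: sum.inter_filter[symmetric] Collect_conj_eq)
  show ?thesis
  proof (rule pos_defI[of "carrier G \<times> carrier G" _ _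
      "\<lambda>(z, w) x. L (z \<otimes> x \<otimes> w) / of_nat (card H)"])
    fix x y assume x: "x \<in> carrier G" and y: "y \<in> carrier G"
    have "L (z \<otimes> (x \<otimes> inv y) \<otimes> inv z) =
        (\<Sum>w\<in>carrier G. L (z \<otimes> x \<otimes> w) * cnj (L (z \<otimes> y \<otimes> w))) / of_nat (card H)" if z: "z \<in> carrier G" for z
      using key[of "z \<otimes> x" "z \<otimes> y"] x y z by (simp add: inv_mult_group m_assoc)
    then show "induced G H l (x \<otimes> inv y) = (\<Sum>k\<in>carrier G \<times> carrier G.
        (case k of (z, w) \<Rightarrow> \<lambda>x. L (z \<otimes> x \<otimes> w) / of_nat (card H)) x *
        cnj ((case k of (z, w) \<Rightarrow> \<lambda>x. L (z \<otimes> x \<otimes> w) / of_nat (card H)) y))"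
      by (simp add: ind sum.cartesian_product sum_divide_distrib case_prod_unfold)
  qed (use fin in simp)
qed

lemma (in group) induced_class_function:
  assumes x: "x \<in> carrier G" and g: "g \<in> carrier G"
  shows "induced G H l (g \<otimes> x \<otimes> inv g) = induced G H l x"
proof -
  have c: "y \<otimes> (g \<otimes> x \<otimes> inv g) \<otimes> inv y = (y \<otimes> g) \<otimes> x \<otimes> inv (y \<otimes> g)" if "y \<in> carrier G" for y
    using that x g by (simp add: inv_mult_group m_assoc)
  have c': "y \<otimes> inv g \<otimes> (g \<otimes> x \<otimes> inv g) \<otimes> inv (y \<otimes> inv g) = y \<otimes> x \<otimes> inv y" if "y \<in> carrier G" for y
    using that x g c[of "y \<otimes> inv g"] by (simp add: m_assoc)
  show ?thesis
    unfolding induced_def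
    by (rule arg_cong[of _ _ "\<lambda>u. u / _"],
        rule sum.reindex_bij_witness[of _ "\<lambda>y. y \<otimes> inv g" "\<lambda>y. y \<otimes> g"])
      (use x g c c' in \<open>auto simp: m_assoc\<close>)
qed

text \<open>With Gram vectors a_k of f and b_l of g, the squared moduli of all inner products c_kl
  add up to |G| times the sum of f times the conjugate of g. Orthogonality thus forces every c_kl to
  vanish, and the convolution is a combination of the c_kl. For arbitrary class functions the scalar
  product could vanish by cancellation.\<close>

lemma (in group) pos_def_orthogonal_conv:
  assumes fin: "finite (carrier G)" and f: "pos_def G f" and g: "pos_def G g"
    and orth: "(\<Sum>x\<in>carrier G. f x * cnj (g x)) = 0" and x: "x \<in> carrier G"
  shows "(\<Sum>y\<in>carrier G. f (x \<otimes> inv y) * g y) = 0"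
proof -
  obtain N a where a: "\<And>x y. x \<in> carrier G \<Longrightarrow> y \<in> carrier G \<Longrightarrow>
      f (x \<otimes> inv y) = (\<Sum>k<N::nat. a k x * cnj (a k y))"
    using f unfolding pos_def_def by blast
  obtain M b where b: "\<And>x y. x \<in> carrier G \<Longrightarrow> y \<in> carrier G \<Longrightarrow>
      g (x \<otimes> inv y) = (\<Sum>k<M::nat. b k x * cnj (b k y))"
    using g unfolding pos_def_def by blast
  have g_inv: "g (inv x) = cnj (g x)" if "x \<in> carrier G" for x
    using b[of \<one> x] b[of x \<one>] that by (simp add: mult.commute)
  define c where "c k l = (\<Sum>z\<in>carrier G. cnj (a k z) * b l z)" for k l
  have "(\<Sum>k<N. \<Sum>l<M. c k l * cnj (c k l)) =
    (\<Sum>k<N. \<Sum>l<M. \<Sum>z\<in>carrier G. \<Sum>w\<in>carrier G. (a k w * cnj (a k z)) * (b l z * cnj (b l w)))"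
    by (simp only: c_def cnj_sum sum_product complex_cnj_mult complex_cnj_cnj) (simp only: ac_simps)
  also have "\<dots> = (\<Sum>k<N. \<Sum>z\<in>carrier G. \<Sum>w\<in>carrier G. \<Sum>l<M. (a k w * cnj (a k z)) * (b l z * cnj (b l w)))"
    by (subst (2) sum.swap, subst (3) sum.swap) simp
  also have "\<dots> = (\<Sum>z\<in>carrier G. \<Sum>w\<in>carrier G. \<Sum>k<N. \<Sum>l<M. (a k w * cnj (a k z)) * (b l z * cnj (b l w)))"
    by (subst sum.swap, subst (2) sum.swap) simp
  also have "\<dots> = (\<Sum>z\<in>carrier G. \<Sum>w\<in>carrier G. f (w \<otimes> inv z) * g (z \<otimes> inv w))"
    by (simp add: a b sum_product)
  also have "\<dots> = (\<Sum>z\<in>carrier G. \<Sum>w\<in>carrier G. f (w \<otimes> inv z) * cnj (g (w \<otimes> inv z)))"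
  proof (intro sum.cong refl)
    fix z w assume zw: "z \<in> carrier G" "w \<in> carrier G"
    have "z \<otimes> inv w = inv (w \<otimes> inv z)" using zw by (simp add: inv_mult_group)
    then show "f (w \<otimes> inv z) * g (z \<otimes> inv w) = f (w \<otimes> inv z) * cnj (g (w \<otimes> inv z))"
      using zw g_inv[of "w \<otimes> inv z"] by simp
  qed
  also have "\<dots> = (\<Sum>z\<in>carrier G. \<Sum>w\<in>carrier G. f w * cnj (g w))"
  proof (rule sum.cong[OF refl])
    fix z assume "z \<in> carrier G"
    then show "(\<Sum>w\<in>carrier G. f (w \<otimes> inv z) * cnj (g (w \<otimes> inv z))) = (\<Sum>w\<in>carrier G. f w * cnj (g w))"
      using sum_mult_right_reindex[of "inv z" "\<lambda>w. f w * cnj (g w)"] by simp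
  qed
  also have "\<dots> = 0" by (simp add: orth)
  finally have "(\<Sum>k<N. \<Sum>l<M. c k l * cnj (c k l)) = 0" .
  then have "complex_of_real (\<Sum>k<N. \<Sum>l<M. (cmod (c k l))\<^sup>2) = 0"
    by (simp only: of_real_sum complex_norm_square)
  then have "(\<Sum>k<N. \<Sum>l<M. (cmod (c k l))\<^sup>2) = 0" using of_real_eq_0_iff by blast
  then have c0: "c k l = 0" if "k < N" "l < M" for k l
    using that by (auto simp: sum_nonneg_eq_0_iff sum_nonneg)
  have "(\<Sum>y\<in>carrier G. f (x \<otimes> inv y) * g y) =
     (\<Sum>y\<in>carrier G. \<Sum>k<N. \<Sum>l<M. (a k x * cnj (a k y)) * (b l y * cnj (b l \<one>)))"
    using a[OF x] b[of _ \<one>] by (simp add: sum_product)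
  also have "\<dots> = (\<Sum>k<N. \<Sum>l<M. \<Sum>y\<in>carrier G. (a k x * cnj (a k y)) * (b l y * cnj (b l \<one>)))"
    by (subst sum.swap, subst (2) sum.swap) simp
  also have "\<dots> = (\<Sum>k<N. \<Sum>l<M. a k x * cnj (b l \<one>) * c k l)"
    by (simp add: c_def sum_distrib_left ac_simps)
  also have "\<dots> = 0" by (simp add: c0)
  finally show ?thesis .
qed

text \<open>Schur's lemma: an eigenspace of M is nonzero and invariant, hence the whole space; an
  eigenvalue exists over the complex numbers because d > 0.\<close>

lemma irreducible_rep_scalar:
  assumes irr: "irreducible_rep G d \<rho>" and M: "M \<in> carrier_mat d d"
    and comm: "\<And>g. g \<in> carrier G \<Longrightarrow> \<rho> g * M = M * \<rho> g"
  shows "\<exists>c. M = c \<cdot>\<^sub>m 1\<^sub>m d"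
proof -
  have d: "d > 0" and hom: "\<rho> \<in> hom G (GL d)"
    and sub: "\<And>W. VectorSpace.subspace class_ring W (module_vec TYPE(complex) d) \<Longrightarrow>
          (\<forall>g\<in>carrier G. \<forall>w\<in>W. \<rho> g *\<^sub>v w \<in> W) \<Longrightarrow> W = {0\<^sub>v d} \<or> W = carrier_vec d"
    using irr unfolding irreducible_rep_def by blast+
  have rc: "\<rho> g \<in> carrier_mat d d" if "g \<in> carrier G" for g
    using hom that by (auto simp: hom_def carrier_GL)
  obtain c where "eigenvalue M c"
    using spectrum_non_empty[OF M] d by (auto simp: spectrum_def)
  then obtain v where v: "v \<in> carrier_vec d" "v \<noteq> 0\<^sub>v d" "M *\<^sub>v v = c \<cdot>\<^sub>v v"
    using M by (auto simp: eigenvalue_def eigenvector_def)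
  define W where "W = {w \<in> carrier_vec d. M *\<^sub>v w = c \<cdot>\<^sub>v w}"
  interpret vec_space "TYPE(complex)" d .
  have sp: "VectorSpace.subspace class_ring W (module_vec TYPE(complex) d)"
  proof (rule subspace.intro)
    show "vectorspace class_ring (module_vec TYPE(complex) d)" by (rule vectorspace_axioms)
    show "submodule class_ring W (module_vec TYPE(complex) d)"
      unfolding LinearCombinations.submodule_def using vec_module M
      by (auto simp: W_def module_vec_def mult_add_distrib_mat_vec smult_add_distrib_vec
           mult_mat_vec smult_smult_assoc mult.commute)
  qed
  have inv: "\<forall>g\<in>carrier G. \<forall>w\<in>W. \<rho> g *\<^sub>v w \<in> W"
  proof (intro ballI)
    fix g w assume g: "g \<in> carrier G" and w: "w \<in> W"
    have wc: "w \<in> carrier_vec d" and Mw: "M *\<^sub>v w = c \<cdot>\<^sub>v w" using w by (auto simp: W_def)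
    have "M *\<^sub>v (\<rho> g *\<^sub>v w) = (M * \<rho> g) *\<^sub>v w" using M rc[OF g] wc by simp
    also have "\<dots> = \<rho> g *\<^sub>v (M *\<^sub>v w)" using M rc[OF g] wc by (simp add: comm[OF g, symmetric])
    also have "\<dots> = c \<cdot>\<^sub>v (\<rho> g *\<^sub>v w)" using rc[OF g] wc by (simp add: Mw mult_mat_vec)
    finally show "\<rho> g *\<^sub>v w \<in> W" using rc[OF g] wc by (auto simp: W_def)
  qed
  have "W = {0\<^sub>v d} \<or> W = carrier_vec d" by (rule sub[OF sp inv])
  then have W: "W = carrier_vec d" using v by (auto simp: W_def)
  have "M = c \<cdot>\<^sub>m 1\<^sub>m d"
  proof (rule eq_matI)
    fix i j assume "i < dim_row (c \<cdot>\<^sub>m 1\<^sub>m d :: complex mat)" "j < dim_col (c \<cdot>\<^sub>m 1\<^sub>m d :: complex mat)"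
    then have ij: "i < d" "j < d" by auto
    have "unit_vec d j \<in> W" unfolding W by (rule unit_vec_carrier)
    then have "M *\<^sub>v unit_vec d j = c \<cdot>\<^sub>v unit_vec d j" unfolding W_def by blast
    then have "(M *\<^sub>v unit_vec d j) $ i = (c \<cdot>\<^sub>v unit_vec d j) $ i" by simp
    then show "M $$ (i, j) = (c \<cdot>\<^sub>m 1\<^sub>m d) $$ (i, j)"
      using ij M by (simp add: scalar_prod_right_unit[of _ d])
  qed (use M in auto)
  then show ?thesis by blast
qed

text \<open>Image of the group algebra element with coefficients f under the linear extension of
  \<rho>.\<close>

definition rep_sum :: "('g, 'b) monoid_scheme \<Rightarrow> nat \<Rightarrow> ('g \<Rightarrow> complex mat) \<Rightarrow> ('g \<Rightarrow> complex) \<Rightarrow> complex mat" where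
  "rep_sum G d \<rho> f = mat d d (\<lambda>(i, j). \<Sum>x\<in>carrier G. f x * \<rho> x $$ (i, j))"

text \<open>A class function is central in the group algebra, so its image commutes with the
  representation; the trace identifies the scalar.\<close>

lemma (in group) rep_sum_scalar:
  assumes fin: "finite (carrier G)" and irr: "irreducible_rep G d \<rho>"
    and cf: "\<And>x g. x \<in> carrier G \<Longrightarrow> g \<in> carrier G \<Longrightarrow> f (g \<otimes> x \<otimes> inv g) = f x"
  shows "\<exists>c. rep_sum G d \<rho> f = c \<cdot>\<^sub>m 1\<^sub>m d \<and> of_nat d * c = (\<Sum>x\<in>carrier G. f x * mat_trace (\<rho> x))"
proof -
  have hom: "\<rho> \<in> hom G (GL d)" using irr unfolding irreducible_rep_def by blast
  have rc: "\<rho> g \<in> carrier_mat d d" if "g \<in> carrier G" for g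
    using hom that by (auto simp: hom_def carrier_GL)
  have rm: "\<rho> (g \<otimes> h) = \<rho> g * \<rho> h" if "g \<in> carrier G" "h \<in> carrier G" for g h
    using hom that by (simp add: hom_def GL_simps)
  have "\<rho> g * rep_sum G d \<rho> f = rep_sum G d \<rho> f * \<rho> g" if g: "g \<in> carrier G" for g
  proof (rule eq_matI)
    fix i j assume "i < dim_row (rep_sum G d \<rho> f * \<rho> g)" "j < dim_col (rep_sum G d \<rho> f * \<rho> g)"
    then have ij: "i < d" "j < d" using rc[OF g] by (auto simp: rep_sum_def)
    have rx: "\<rho> (x \<otimes> y) $$ (i, j) = (\<Sum>k<d. \<rho> x $$ (i, k) * \<rho> y $$ (k, j))"
      if "x \<in> carrier G" "y \<in> carrier G" for x y
      using ij rc[of x] rc[of y] that by (simp add: rm scalar_prod_def lessThan_atLeast0)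
    have "(\<rho> g * rep_sum G d \<rho> f) $$ (i, j) = (\<Sum>k<d. \<Sum>x\<in>carrier G. f x * (\<rho> g $$ (i, k) * \<rho> x $$ (k, j)))"
      using ij rc[OF g] by (simp add: rep_sum_def scalar_prod_def sum_distrib_left ac_simps lessThan_atLeast0)
    also have "\<dots> = (\<Sum>x\<in>carrier G. f x * \<rho> (g \<otimes> x) $$ (i, j))"
      by (subst sum.swap) (simp add: sum_distrib_left rx g)
    also have "\<dots> = (\<Sum>x\<in>carrier G. f x * \<rho> (x \<otimes> g) $$ (i, j))"
    proof (rule sum.reindex_bij_witness[of _ "\<lambda>x. inv g \<otimes> x \<otimes> g" "\<lambda>x. g \<otimes> x \<otimes> inv g"])
      fix x assume "x \<in> carrier G"
      then show "f (g \<otimes> x \<otimes> inv g) * \<rho> (g \<otimes> x \<otimes> inv g \<otimes> g) $$ (i, j) = f x * \<rho> (g \<otimes> x) $$ (i, j)"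
        using g cf[of x g] by (simp add: m_assoc)
    qed (use g in \<open>auto simp: m_assoc[symmetric]\<close>, auto simp: m_assoc)
    also have "\<dots> = (\<Sum>k<d. \<Sum>x\<in>carrier G. f x * (\<rho> x $$ (i, k) * \<rho> g $$ (k, j)))"
      by (subst sum.swap) (simp add: sum_distrib_left rx g)
    also have "\<dots> = (rep_sum G d \<rho> f * \<rho> g) $$ (i, j)"
      using ij rc[OF g] by (simp add: rep_sum_def scalar_prod_def sum_distrib_right mult.assoc lessThan_atLeast0)
    finally show "(\<rho> g * rep_sum G d \<rho> f) $$ (i, j) = (rep_sum G d \<rho> f * \<rho> g) $$ (i, j)" .
  qed (use rc[OF g] in \<open>auto simp: rep_sum_def\<close>)
  then obtain c where c: "rep_sum G d \<rho> f = c \<cdot>\<^sub>m 1\<^sub>m d"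
    using irreducible_rep_scalar[OF irr, of "rep_sum G d \<rho> f"] by (auto simp: rep_sum_def)
  have "of_nat d * c = mat_trace (rep_sum G d \<rho> f)" unfolding c by (simp add: mat_trace_def)
  also have "\<dots> = (\<Sum>x\<in>carrier G. f x * mat_trace (\<rho> x))"
    unfolding mat_trace_def rep_sum_def sum_distrib_left
    using rc by (simp, subst sum.swap) (auto intro!: sum.cong)
  finally show ?thesis using c by blast
qed

text \<open>The conjugates of f and h act on the representation of \<chi> by scalars a and b, which
  are |G|/d times the two given scalar products. If f and h were orthogonal, their convolution would
  vanish and so would ab.\<close>

lemma (in group) irreducible_character_common_constituent:
  assumes fin: "finite (carrier G)" and irr: "irreducible_character G \<chi>"
    and cf: "\<And>x g. x \<in> carrier G \<Longrightarrow> g \<in> carrier G \<Longrightarrow> f (g \<otimes> x \<otimes> inv g) = f x"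
    and ch: "\<And>x g. x \<in> carrier G \<Longrightarrow> g \<in> carrier G \<Longrightarrow> h (g \<otimes> x \<otimes> inv g) = h x"
    and pf: "pos_def G f" and ph: "pos_def G h"
    and nf: "scalar_product G \<chi> f \<noteq> 0" and nh: "scalar_product G \<chi> h \<noteq> 0"
  shows "scalar_product G f h \<noteq> 0"
proof
  assume "scalar_product G f h = 0"
  then have orth: "(\<Sum>x\<in>carrier G. f x * cnj (h x)) = 0"
    using fin one_closed by (auto simp: scalar_product_def)
  obtain d \<rho> where irr: "irreducible_rep G d \<rho>" and chi: "\<And>g. g \<in> carrier G \<Longrightarrow> \<chi> g = mat_trace (\<rho> g)"
    using irr unfolding irreducible_character_def by blast
  have hom: "\<rho> \<in> hom G (GL d)" and d: "d > 0" using irr unfolding irreducible_rep_def by blast+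
  have rc: "\<rho> g \<in> carrier_mat d d" if "g \<in> carrier G" for g
    using hom that by (auto simp: hom_def carrier_GL)
  have rm: "\<rho> (g \<otimes> h) = \<rho> g * \<rho> h" if "g \<in> carrier G" "h \<in> carrier G" for g h
    using hom that by (simp add: hom_def GL_simps)
  obtain a where a: "rep_sum G d \<rho> (\<lambda>x. cnj (f x)) = a \<cdot>\<^sub>m 1\<^sub>m d"
    "of_nat d * a = (\<Sum>x\<in>carrier G. cnj (f x) * mat_trace (\<rho> x))"
    using rep_sum_scalar[OF fin irr, of "\<lambda>x. cnj (f x)"] cf by auto
  obtain b where b: "rep_sum G d \<rho> (\<lambda>x. cnj (h x)) = b \<cdot>\<^sub>m 1\<^sub>m d"
    "of_nat d * b = (\<Sum>x\<in>carrier G. cnj (h x) * mat_trace (\<rho> x))"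
    using rep_sum_scalar[OF fin irr, of "\<lambda>x. cnj (h x)"] ch by auto
  have ab: "a \<noteq> 0" "b \<noteq> 0"
    using a(2) b(2) nf nh by (auto simp: scalar_product_def chi mult.commute)
  \<comment> \<open>Since d > 0, one entry detects the scalar ab; the product is expanded as the
    image of a convolution.\<close>
  have "(rep_sum G d \<rho> (\<lambda>x. cnj (f x)) * rep_sum G d \<rho> (\<lambda>x. cnj (h x))) $$ (0, 0) =
    (\<Sum>k<d. \<Sum>x\<in>carrier G. \<Sum>y\<in>carrier G. cnj (f x) * cnj (h y) * (\<rho> x $$ (0, k) * \<rho> y $$ (k, 0)))"
    using d by (simp add: rep_sum_def scalar_prod_def sum_product ac_simps lessThan_atLeast0)
  also have "\<dots> = (\<Sum>x\<in>carrier G. \<Sum>y\<in>carrier G. \<Sum>k<d. cnj (f x) * cnj (h y) * (\<rho> x $$ (0, k) * \<rho> y $$ (k, 0)))"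
    by (subst sum.swap, subst (2) sum.swap) simp
  also have "\<dots> = (\<Sum>x\<in>carrier G. \<Sum>y\<in>carrier G. cnj (f x) * cnj (h y) * \<rho> (x \<otimes> y) $$ (0, 0))"
  proof (intro sum.cong refl)
    fix x y assume "x \<in> carrier G" "y \<in> carrier G"
    then show "(\<Sum>k<d. cnj (f x) * cnj (h y) * (\<rho> x $$ (0, k) * \<rho> y $$ (k, 0))) =
      cnj (f x) * cnj (h y) * \<rho> (x \<otimes> y) $$ (0, 0)"
      using d rc[of x] rc[of y] by (simp add: rm scalar_prod_def sum_distrib_left lessThan_atLeast0)
  qed
  also have "\<dots> = (\<Sum>y\<in>carrier G. \<Sum>x\<in>carrier G. cnj (f x) * cnj (h y) * \<rho> (x \<otimes> y) $$ (0, 0))"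
    by (rule sum.swap)
  also have "\<dots> = (\<Sum>y\<in>carrier G. \<Sum>x\<in>carrier G. cnj (f (x \<otimes> inv y)) * cnj (h y) * \<rho> x $$ (0, 0))"
  proof (rule sum.cong[OF refl])
    fix y assume y: "y \<in> carrier G"
    show "(\<Sum>x\<in>carrier G. cnj (f x) * cnj (h y) * \<rho> (x \<otimes> y) $$ (0, 0)) =
      (\<Sum>x\<in>carrier G. cnj (f (x \<otimes> inv y)) * cnj (h y) * \<rho> x $$ (0, 0))"
      by (rule sum.reindex_bij_witness[of _ "\<lambda>x. x \<otimes> inv y" "\<lambda>x. x \<otimes> y"])
        (use y in \<open>auto simp: m_assoc\<close>)
  qed
  also have "\<dots> = (\<Sum>x\<in>carrier G. cnj (\<Sum>y\<in>carrier G. f (x \<otimes> inv y) * h y) * \<rho> x $$ (0, 0))"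
    by (subst sum.swap) (simp add: sum_distrib_right)
  also have "\<dots> = 0"
    by (rule sum.neutral) (use pos_def_orthogonal_conv[OF fin pf ph orth] in auto)
  finally show False
  proof -
    assume "(rep_sum G d \<rho> (\<lambda>x. cnj (f x)) * rep_sum G d \<rho> (\<lambda>x. cnj (h x))) $$ (0, 0) = 0"
    moreover have "(\<Sum>i = 0..<d. a * (if i = 0 then 1 else 0) * (b * (if i = 0 then 1 else 0))) =
        (\<Sum>i = 0..<d. if i = 0 then a * b else 0)"
      by (rule sum.cong) auto
    ultimately show False
      unfolding a(1) b(1) using ab d by (simp add: scalar_prod_def)
  qed
qed

lemma (in group) irreducible_character_one:
  assumes "irreducible_character G \<chi>" shows "\<chi> \<one> \<noteq> 0"
proof -
  obtain d \<rho> where irr: "irreducible_rep G d \<rho>" and chi: "\<And>g. g \<in> carrier G \<Longrightarrow> \<chi> g = mat_trace (\<rho> g)"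
    using assms unfolding irreducible_character_def by blast
  have hom: "\<rho> \<in> hom G (GL d)" and d: "d > 0" using irr unfolding irreducible_rep_def by blast+
  have "\<rho> \<one> = 1\<^sub>m d" using hom_one[OF hom is_group group_GL] by (simp add: GL_simps)
  then show ?thesis using d by (simp add: chi mat_trace_def)
qed

section \<open>Matrices\<close>

lemma finite_carrier_mat: "finite (carrier_mat m n :: 'a::finite mat set)"
proof (rule finite_subset)
  let ?P = "({..<m} \<times> {..<n}) \<rightarrow>\<^sub>E (UNIV :: 'a set)"
  show "carrier_mat m n \<subseteq> mat m n ` ?P"
  proof
    fix A :: "'a mat" assume A: "A \<in> carrier_mat m n"
    have "A = mat m n (restrict (($$) A) ({..<m} \<times> {..<n}))"
    proof (rule eq_matI)
      fix i j assume "i < dim_row (mat m n (restrict (($$) A) ({..<m} \<times> {..<n})))"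
        "j < dim_col (mat m n (restrict (($$) A) ({..<m} \<times> {..<n})))"
      then show "A $$ (i, j) = mat m n (restrict (($$) A) ({..<m} \<times> {..<n})) $$ (i, j)" by simp
    qed (use A in simp_all)
    moreover have "restrict (($$) A) ({..<m} \<times> {..<n}) \<in> ?P" by simp
    ultimately show "A \<in> mat m n ` ?P" by (rule image_eqI)
  qed
  show "finite (mat m n ` ?P)" by (intro finite_imageI finite_PiE) auto
qed

lemma mult_index:
  assumes "A \<in> carrier_mat m m" "B \<in> carrier_mat m m" "i < m" "j < m"
  shows "(A * B) $$ (i, j) = (\<Sum>k<m. A $$ (i, k) * B $$ (k, j))"
  using assms by (simp add: scalar_prod_def lessThan_atLeast0)

lemma triple_index:
  assumes "A \<in> carrier_mat m m" "S \<in> carrier_mat m m" "B \<in> carrier_mat m m" "i < m" "j < m"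
  shows "(A * S * B) $$ (i, j) = (\<Sum>k<m. \<Sum>l<m. A $$ (i, k) * S $$ (k, l) * B $$ (l, j))"
proof -
  have "(A * S * B) $$ (i, j) = (\<Sum>l<m. (\<Sum>k<m. A $$ (i, k) * S $$ (k, l)) * B $$ (l, j))"
    using assms mult_index[of A m S] mult_index[of "A * S" m B] by simp
  also have "\<dots> = (\<Sum>k<m. \<Sum>l<m. A $$ (i, k) * S $$ (k, l) * B $$ (l, j))"
    by (subst sum.swap) (simp add: sum_distrib_right)
  finally show ?thesis .
qed

lemma congr_index:
  assumes "A \<in> carrier_mat m m" "S \<in> carrier_mat m m" "i < m" "j < m"
  shows "(A * S * A\<^sup>T) $$ (i, j) = (\<Sum>k<m. \<Sum>l<m. A $$ (i, k) * S $$ (k, l) * A $$ (j, l))"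
  using triple_index[of A m S "A\<^sup>T" i j] assms by simp

lemma congr_transpose_index:
  assumes "A \<in> carrier_mat m m" "S \<in> carrier_mat m m" "i < m" "j < m"
  shows "(A\<^sup>T * S * A) $$ (i, j) = (\<Sum>k<m. \<Sum>l<m. A $$ (k, i) * S $$ (k, l) * A $$ (l, j))"
  using triple_index[of "A\<^sup>T" m S A i j] assms by simp

lemma sum_swap4:
  "(\<Sum>i\<in>A. \<Sum>j\<in>B. \<Sum>k\<in>C. \<Sum>l\<in>D. f i j k l) = (\<Sum>k\<in>C. \<Sum>l\<in>D. \<Sum>i\<in>A. \<Sum>j\<in>B. f i j k l)"
  for f :: "_ \<Rightarrow> _ \<Rightarrow> _ \<Rightarrow> _ \<Rightarrow> 'a::comm_monoid_add"
proof -
  have pr: "(\<Sum>i\<in>X. \<Sum>j\<in>Y. h i j) = (\<Sum>p\<in>X \<times> Y. h (fst p) (snd p))"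
    for X :: "'x set" and Y :: "'y set" and h :: "'x \<Rightarrow> 'y \<Rightarrow> 'a"
    by (simp add: sum.cartesian_product case_prod_unfold)
  have "(\<Sum>i\<in>A. \<Sum>j\<in>B. \<Sum>k\<in>C. \<Sum>l\<in>D. f i j k l) =
      (\<Sum>p\<in>A \<times> B. \<Sum>k\<in>C. \<Sum>l\<in>D. f (fst p) (snd p) k l)" by (rule pr)
  also have "\<dots> = (\<Sum>k\<in>C. \<Sum>p\<in>A \<times> B. \<Sum>l\<in>D. f (fst p) (snd p) k l)" by (rule sum.swap)
  also have "\<dots> = (\<Sum>k\<in>C. \<Sum>l\<in>D. \<Sum>p\<in>A \<times> B. f (fst p) (snd p) k l)"
    by (rule sum.cong[OF refl], rule sum.swap)
  also have "\<dots> = (\<Sum>k\<in>C. \<Sum>l\<in>D. \<Sum>i\<in>A. \<Sum>j\<in>B. f i j k l)"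
    by (intro sum.cong refl pr[symmetric])
  finally show ?thesis .
qed

section \<open>Unitriangular matrices\<close>

lemma unitriangular_carrier: "g \<in> unitriangular m \<Longrightarrow> g \<in> carrier_mat m m"
  by (simp add: unitriangular_def)

lemma unitriangular_index:
  "g \<in> unitriangular m \<Longrightarrow> i < m \<Longrightarrow> j \<le> i \<Longrightarrow> g $$ (i, j) = (if i = j then 1 else 0)"
  by (auto simp: unitriangular_def)

lemma unitriangularI:
  assumes "g \<in> carrier_mat m m"
    and "\<And>i j. i < m \<Longrightarrow> j \<le> i \<Longrightarrow> g $$ (i, j) = (if i = j then 1 else 0)"
  shows "g \<in> unitriangular m"
  using assms by (auto simp: unitriangular_def)

lemma one_unitriangular: "1\<^sub>m m \<in> unitriangular m"
  by (rule unitriangularI) auto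

lemma finite_unitriangular: "finite (unitriangular m :: 'a::{field,finite} mat set)"
  by (rule finite_subset[OF _ finite_carrier_mat[of m m]]) (auto simp: unitriangular_def)

lemma card_unitriangular_pos: "card (unitriangular m :: 'a::{field,finite} mat set) > 0"
  using one_unitriangular[of m] finite_unitriangular[of m] by (auto simp: card_gt_0_iff)

lemma unitriangular_inv:
  fixes g :: "'a::field mat"
  assumes g: "g \<in> unitriangular m"
  shows "inv\<^bsub>GL m\<^esub> g \<in> unitriangular m" "g * inv\<^bsub>GL m\<^esub> g = 1\<^sub>m m" "inv\<^bsub>GL m\<^esub> g * g = 1\<^sub>m m"
proof -
  interpret GL: group "GL m :: 'a mat monoid" by (rule group_GL)
  have gG: "g \<in> carrier (GL m)" using g by (rule unitriangular_in_GL)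
  show 1: "g * inv\<^bsub>GL m\<^esub> g = 1\<^sub>m m" using GL.r_inv[OF gG] by (simp add: GL_simps)
  show "inv\<^bsub>GL m\<^esub> g * g = 1\<^sub>m m" using GL.l_inv[OF gG] by (simp add: GL_simps)
  have "inv\<^bsub>GL m\<^esub> g \<in> carrier_mat m m" using GL.inv_closed[OF gG] by (auto simp: carrier_GL)
  then show "inv\<^bsub>GL m\<^esub> g \<in> unitriangular m" using unitriangular_inverse[OF g _ 1] by blast
qed

lemma mult_left_cancel_mat:
  fixes g :: "'a::semiring_1 mat"
  assumes "g \<in> carrier_mat m m" "h \<in> carrier_mat m m" "x \<in> carrier_mat m m" "h * g = 1\<^sub>m m"
  shows "h * (g * x) = x"
  using assms by (simp add: assoc_mult_mat[symmetric, of h m m g m x m])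

lemma mult_right_cancel_mat:
  fixes g :: "'a::semiring_1 mat"
  assumes "g \<in> carrier_mat m m" "h \<in> carrier_mat m m" "x \<in> carrier_mat m m" "g * h = 1\<^sub>m m"
  shows "x * g * h = x"
  using assms by (simp add: assoc_mult_mat[of x m m g m h m])

lemma sum_unitriangular_mult_left:
  assumes h: "h \<in> unitriangular m"
  shows "(\<Sum>g\<in>unitriangular m. f (h * g)) = (\<Sum>g\<in>unitriangular m. f g)"
  by (rule sum.reindex_bij_witness[of _ "\<lambda>g. inv\<^bsub>GL m\<^esub> h * g" "\<lambda>g. h * g"])
    (use unitriangular_inv[OF h] h in
      \<open>auto simp: unitriangular_mult unitriangular_carrier mult_left_cancel_mat[of _ m]\<close>)

section \<open>Additive characters\<close>

lemma linear_character_add_zero: "linear_character_add \<theta> \<Longrightarrow> \<theta> 0 = 1"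
  unfolding linear_character_add_def by (metis add.right_neutral mult_cancel_left mult.right_neutral)

lemma linear_character_add_of_nat:
  "linear_character_add \<theta> \<Longrightarrow> \<theta> (of_nat k * a) = \<theta> a ^ k"
  by (induction k) (auto simp: linear_character_add_zero distrib_right linear_character_add_def)

lemma linear_character_add_sum:
  assumes "linear_character_add \<theta>"
  shows "\<theta> (sum f A) = (\<Prod>i\<in>A. \<theta> (f i))"
  using assms
  by (induction A rule: infinite_finite_induct)
    (auto simp: linear_character_add_zero linear_character_add_def)

text \<open>The additive group is finite, so two multiples of 1 coincide and \<theta> takes roots of
  unity as values.\<close>

lemma linear_character_add_unit:
  fixes \<theta> :: "'a::{field,finite} \<Rightarrow> complex"
  assumes \<theta>: "linear_character_add \<theta>"
  shows "\<theta> a * cnj (\<theta> a) = 1"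
proof -
  have "\<not> inj (of_nat :: nat \<Rightarrow> 'a)"
    using finite_imageD[of "of_nat :: nat \<Rightarrow> 'a" UNIV] infinite_UNIV_nat by auto
  then obtain i j where ij: "of_nat i = (of_nat j :: 'a)" "i < j"
    unfolding inj_def by (metis linorder_neqE_nat)
  have "\<theta> a ^ i * \<theta> a ^ (j - i) = \<theta> a ^ i"
    using ij linear_character_add_of_nat[OF \<theta>, of i a] linear_character_add_of_nat[OF \<theta>, of j a]
    by (simp add: power_add[symmetric])
  then have "\<theta> a ^ (j - i) = 1"
    using \<theta> by (simp add: linear_character_add_def)
  then have "cmod (\<theta> a) = 1"
    using ij(2) power_eq_1_iff by fastforce
  then show ?thesis by (simp add: complex_norm_square[symmetric])
qed

lemma linear_character_add_uminus:
  fixes \<theta> :: "'a::{field,finite} \<Rightarrow> complex"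
  assumes \<theta>: "linear_character_add \<theta>"
  shows "\<theta> (- a) = cnj (\<theta> a)"
proof -
  have "\<theta> a * \<theta> (- a) = \<theta> a * cnj (\<theta> a)"
    using \<theta> linear_character_add_unit[OF \<theta>, of a] linear_character_add_zero[OF \<theta>]
    by (metis add.right_inverse linear_character_add_def)
  then show ?thesis using \<theta> by (simp add: linear_character_add_def)
qed

lemma linear_character_add_scale:
  fixes \<theta> :: "'a::field \<Rightarrow> complex"
  assumes "\<exists>a. \<theta> a \<noteq> 1" "c \<noteq> 0"
  shows "\<exists>s. \<theta> (c * s) \<noteq> 1"
proof -
  obtain a where "\<theta> a \<noteq> 1" using assms by blast
  then have "\<theta> (c * (a / c)) \<noteq> 1" using assms by simp
  then show ?thesis by blast
qed

section \<open>Symmetric and alternating forms supported above the antidiagonal\<close>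

text \<open>With indices counted from 0 the antidiagonal is i + j + 1 = m, so the support lies
  strictly above it. \<sigma> is 1 for symmetric and -1 for alternating forms.\<close>

definition corner_forms :: "'a::field \<Rightarrow> nat \<Rightarrow> 'a mat set" where
  "corner_forms \<sigma> m = {S \<in> carrier_mat m m.
     (\<forall>i<m. \<forall>j<m. S $$ (j, i) = \<sigma> * S $$ (i, j)) \<and>
     (\<forall>i<m. \<forall>j<m. m \<le> i + j + 1 \<longrightarrow> S $$ (i, j) = 0)}"

text \<open>All positions are summed, so an off-diagonal coordinate of a corner form counts twice.
  As 2 is invertible in the application, this makes \<open>corner_forms\<close> its own dual
  space.\<close>

definition pairing :: "nat \<Rightarrow> 'a::field mat \<Rightarrow> 'a mat \<Rightarrow> 'a" where
  "pairing m T S = (\<Sum>i<m. \<Sum>j<m. T $$ (i, j) * S $$ (i, j))"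

text \<open>The coadjoint action on forms, in coordinates given by \<open>pairing\<close>: entries on and below the
  antidiagonal pair to zero and are discarded.\<close>

definition coact :: "nat \<Rightarrow> 'a::field mat \<Rightarrow> 'a mat \<Rightarrow> 'a mat" where
  "coact m T g = mat m m (\<lambda>(i, j). if i + j + 1 < m then (g\<^sup>T * T * g) $$ (i, j) else 0)"

lemma corner_forms_carrier: "S \<in> corner_forms \<sigma> m \<Longrightarrow> S \<in> carrier_mat m m"
  unfolding corner_forms_def by blast

lemma corner_forms_sym:
  "S \<in> corner_forms \<sigma> m \<Longrightarrow> i < m \<Longrightarrow> j < m \<Longrightarrow> S $$ (j, i) = \<sigma> * S $$ (i, j)"
  unfolding corner_forms_def by blast

lemma corner_forms_zero:
  "S \<in> corner_forms \<sigma> m \<Longrightarrow> i < m \<Longrightarrow> j < m \<Longrightarrow> m \<le> i + j + 1 \<Longrightarrow> S $$ (i, j) = 0"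
  unfolding corner_forms_def by blast

lemma corner_formsI:
  assumes "S \<in> carrier_mat m m"
    and "\<And>i j. i < m \<Longrightarrow> j < m \<Longrightarrow> S $$ (j, i) = \<sigma> * S $$ (i, j)"
    and "\<And>i j. i < m \<Longrightarrow> j < m \<Longrightarrow> m \<le> i + j + 1 \<Longrightarrow> S $$ (i, j) = 0"
  shows "S \<in> corner_forms \<sigma> m"
  using assms unfolding corner_forms_def by blast

lemma finite_corner_forms: "finite (corner_forms \<sigma> m :: 'a::{field,finite} mat set)"
  by (rule finite_subset[OF _ finite_carrier_mat[of m m]]) (auto simp: corner_forms_def)

lemma corner_forms_add:
  assumes S: "S \<in> corner_forms \<sigma> m" and T: "T \<in> corner_forms \<sigma> m"
  shows "S + T \<in> corner_forms \<sigma> m"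
proof (rule corner_formsI)
  note c = corner_forms_carrier[OF S] corner_forms_carrier[OF T]
  show "S + T \<in> carrier_mat m m" using c by simp
  fix i j assume ij: "i < m" "j < m"
  show "(S + T) $$ (j, i) = \<sigma> * (S + T) $$ (i, j)"
    using corner_forms_sym[OF S ij] corner_forms_sym[OF T ij] ij c
    by (simp add: distrib_left)
  assume "m \<le> i + j + 1"
  then show "(S + T) $$ (i, j) = 0"
    using corner_forms_zero[OF S ij] corner_forms_zero[OF T ij] ij c by simp
qed

lemma corner_forms_diff:
  assumes S: "S \<in> corner_forms \<sigma> m" and T: "T \<in> corner_forms \<sigma> m"
  shows "S - T \<in> corner_forms \<sigma> m"
proof (rule corner_formsI)
  note c = corner_forms_carrier[OF S] corner_forms_carrier[OF T]
  show "S - T \<in> carrier_mat m m" using c(2) by (rule minus_carrier_mat)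
  fix i j assume ij: "i < m" "j < m"
  show "(S - T) $$ (j, i) = \<sigma> * (S - T) $$ (i, j)"
    using corner_forms_sym[OF S ij] corner_forms_sym[OF T ij] ij c
    by (simp add: right_diff_distrib)
  assume "m \<le> i + j + 1"
  then show "(S - T) $$ (i, j) = 0"
    using corner_forms_zero[OF S ij] corner_forms_zero[OF T ij] ij c by simp
qed

lemma zero_corner_forms: "0\<^sub>m m m \<in> corner_forms \<sigma> m"
  by (rule corner_formsI) auto

text \<open>Entry (i, j) of the congruent form only sees entries (k, l) of S with k \<ge> i and l
  \<ge> j, so the support cannot move towards the antidiagonal.\<close>

lemma corner_forms_congr:
  assumes g: "g \<in> unitriangular m" and S: "S \<in> corner_forms \<sigma> m"
  shows "g * S * g\<^sup>T \<in> corner_forms \<sigma> m"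
proof (rule corner_formsI)
  note gc = unitriangular_carrier[OF g] and Sc = corner_forms_carrier[OF S]
  show "g * S * g\<^sup>T \<in> carrier_mat m m" using gc Sc by simp
  fix i j assume ij: "i < m" "j < m"
  have "(\<Sum>k<m. \<Sum>l<m. g $$ (j, k) * S $$ (k, l) * g $$ (i, l)) =
      (\<Sum>k<m. \<Sum>l<m. g $$ (j, l) * S $$ (l, k) * g $$ (i, k))" by (rule sum.swap)
  also have "\<dots> = (\<Sum>k<m. \<Sum>l<m. \<sigma> * (g $$ (i, k) * S $$ (k, l) * g $$ (j, l)))"
  proof (intro sum.cong refl)
    fix k l assume "k \<in> {..<m}" "l \<in> {..<m}"
    then show "g $$ (j, l) * S $$ (l, k) * g $$ (i, k) = \<sigma> * (g $$ (i, k) * S $$ (k, l) * g $$ (j, l))"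
      using corner_forms_sym[OF S, of k l] by simp
  qed
  finally show "(g * S * g\<^sup>T) $$ (j, i) = \<sigma> * (g * S * g\<^sup>T) $$ (i, j)"
    using congr_index[OF gc Sc] ij by (simp add: sum_distrib_left)
  assume m: "m \<le> i + j + 1"
  have "g $$ (i, k) * S $$ (k, l) * g $$ (j, l) = 0" if "k < m" "l < m" for k l
  proof (cases "k < i \<or> l < j")
    case True
    then show ?thesis using unitriangular_index[OF g] ij by auto
  next
    case False
    then show ?thesis using corner_forms_zero[OF S, of k l] that m by simp
  qed
  then show "(g * S * g\<^sup>T) $$ (i, j) = 0"
    unfolding congr_index[OF gc Sc ij] by (intro sum.neutral ballI) simp
qed

lemma coact_corner_forms:
  assumes g: "g \<in> carrier_mat m m" and T: "T \<in> corner_forms \<sigma> m"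
  shows "coact m T g \<in> corner_forms \<sigma> m"
proof (rule corner_formsI)
  note Tc = corner_forms_carrier[OF T]
  show "coact m T g \<in> carrier_mat m m" by (simp add: coact_def)
  fix i j assume ij: "i < m" "j < m"
  have "(\<Sum>k<m. \<Sum>l<m. g $$ (k, j) * T $$ (k, l) * g $$ (l, i)) =
      (\<Sum>k<m. \<Sum>l<m. g $$ (l, j) * T $$ (l, k) * g $$ (k, i))" by (rule sum.swap)
  also have "\<dots> = (\<Sum>k<m. \<Sum>l<m. \<sigma> * (g $$ (k, i) * T $$ (k, l) * g $$ (l, j)))"
  proof (intro sum.cong refl)
    fix k l assume "k \<in> {..<m}" "l \<in> {..<m}"
    then show "g $$ (l, j) * T $$ (l, k) * g $$ (k, i) = \<sigma> * (g $$ (k, i) * T $$ (k, l) * g $$ (l, j))"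
      using corner_forms_sym[OF T, of k l] by simp
  qed
  finally have "(g\<^sup>T * T * g) $$ (j, i) = \<sigma> * (g\<^sup>T * T * g) $$ (i, j)"
    using congr_transpose_index[OF g Tc] ij by (simp add: sum_distrib_left)
  then show "coact m T g $$ (j, i) = \<sigma> * coact m T g $$ (i, j)"
    using ij by (simp add: coact_def add.commute)
qed (simp add: coact_def)

lemma pairing_congr:
  assumes g: "g \<in> carrier_mat m m" and T: "T \<in> carrier_mat m m" and S: "S \<in> carrier_mat m m"
  shows "pairing m T (g * S * g\<^sup>T) = pairing m (g\<^sup>T * T * g) S"
proof -
  have "pairing m T (g * S * g\<^sup>T) =
      (\<Sum>i<m. \<Sum>j<m. \<Sum>k<m. \<Sum>l<m. g $$ (i, k) * T $$ (i, j) * g $$ (j, l) * S $$ (k, l))"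
    by (simp add: pairing_def congr_index[OF g S] sum_distrib_left ac_simps)
  also have "\<dots> = (\<Sum>k<m. \<Sum>l<m. \<Sum>i<m. \<Sum>j<m. g $$ (i, k) * T $$ (i, j) * g $$ (j, l) * S $$ (k, l))"
    by (rule sum_swap4)
  also have "\<dots> = pairing m (g\<^sup>T * T * g) S"
    by (simp add: pairing_def congr_transpose_index[OF g T] sum_distrib_right)
  finally show ?thesis .
qed

lemma pairing_coact:
  assumes S: "S \<in> corner_forms \<sigma> m"
  shows "pairing m (coact m T g) S = pairing m (g\<^sup>T * T * g) S"
  unfolding pairing_def
  by (intro sum.cong refl) (use corner_forms_zero[OF S] in \<open>auto simp: coact_def not_less\<close>)

lemma pairing_coact_congr:
  assumes "g \<in> unitriangular m" "T \<in> corner_forms \<sigma> m" "S \<in> corner_forms \<sigma> m"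
  shows "pairing m (coact m T g) S = pairing m T (g * S * g\<^sup>T)"
  using assms pairing_coact pairing_congr unitriangular_carrier corner_forms_carrier by metis

lemma pairing_add:
  assumes "T \<in> carrier_mat m m" "T' \<in> carrier_mat m m"
  shows "pairing m (T + T') S = pairing m T S + pairing m T' S"
  using assms by (simp add: pairing_def distrib_right sum.distrib)

lemma pairing_diff:
  assumes "T \<in> carrier_mat m m" "T' \<in> carrier_mat m m"
  shows "pairing m (T - T') S = pairing m T S - pairing m T' S"
  using assms by (simp add: pairing_def left_diff_distrib sum_subtractf)

lemma pairing_commute: "pairing m T S = pairing m S T"
  by (simp add: pairing_def mult.commute)

text \<open>The symmetrized matrix unit. For a = b the two terms add up to 1 + \<sigma>, hence to 2
  for symmetric and to 0 for alternating forms.\<close>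

definition sym_unit :: "'a::field \<Rightarrow> nat \<Rightarrow> nat \<Rightarrow> nat \<Rightarrow> 'a mat" where
  "sym_unit \<sigma> m a b = mat m m (\<lambda>(i, j). of_bool (i = a \<and> j = b) + \<sigma> * of_bool (i = b \<and> j = a))"

lemma sym_unit_corner_forms:
  fixes \<sigma> :: "'a::field"
  assumes "\<sigma> * \<sigma> = 1" "a + b + 1 < m"
  shows "c \<cdot>\<^sub>m sym_unit \<sigma> m a b \<in> corner_forms \<sigma> m"
proof (rule corner_formsI)
  fix i j assume "i < m" "j < m"
  moreover have "c * (y + \<sigma> * x) = \<sigma> * (c * (x + \<sigma> * y))" for x y :: 'a
  proof -
    have "\<sigma> * (c * (x + \<sigma> * y)) = c * ((\<sigma> * \<sigma>) * y + \<sigma> * x)" by (simp only: algebra_simps)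
    then show ?thesis using assms(1) by (metis mult_1)
  qed
  ultimately show "(c \<cdot>\<^sub>m sym_unit \<sigma> m a b) $$ (j, i) = \<sigma> * (c \<cdot>\<^sub>m sym_unit \<sigma> m a b) $$ (i, j)"
    by (simp add: sym_unit_def conj_commute)
qed (use assms in \<open>auto simp: sym_unit_def\<close>)

lemma pairing_sym_unit:
  assumes "a < m" "b < m"
  shows "pairing m (c \<cdot>\<^sub>m sym_unit \<sigma> m a b) S = c * (S $$ (a, b) + \<sigma> * S $$ (b, a))"
proof -
  have "pairing m (c \<cdot>\<^sub>m sym_unit \<sigma> m a b) S =
    (\<Sum>i<m. \<Sum>j<m. (if i = a then if j = b then c * S $$ (i, j) else 0 else 0) +
       (if i = b then if j = a then c * \<sigma> * S $$ (i, j) else 0 else 0))"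
    unfolding pairing_def by (intro sum.cong refl) (auto simp: sym_unit_def algebra_simps)
  also have "\<dots> = (\<Sum>i<m. (if i = a then c * S $$ (i, b) else 0) + (if i = b then c * \<sigma> * S $$ (i, a) else 0))"
    by (intro sum.cong refl) (use assms in \<open>auto simp: sum.distrib\<close>)
  also have "\<dots> = c * (S $$ (a, b) + \<sigma> * S $$ (b, a))"
    using assms by (simp add: sum.distrib algebra_simps)
  finally show ?thesis .
qed

section \<open>Fourier analysis on the space of corner forms\<close>

lemma diff_add_cancel_mat:
  fixes A :: "'a::group_add mat"
  assumes "A \<in> carrier_mat m n" "B \<in> carrier_mat m n"
  shows "A - B + B = A" "A + B - B = A"
  using assms by (intro eq_matI; simp)+

lemma sum_character_corner_forms:
  fixes \<theta> :: "'a::{field,finite} \<Rightarrow> complex"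
  assumes \<theta>: "linear_character_add \<theta>" "\<exists>a. \<theta> a \<noteq> 1" and two: "(2::'a) \<noteq> 0" and \<sigma>: "\<sigma> * \<sigma> = 1"
    and S: "S \<in> corner_forms \<sigma> m"
  shows "(\<Sum>T\<in>corner_forms \<sigma> m. \<theta> (pairing m T S)) =
    (if S = 0\<^sub>m m m then of_nat (card (corner_forms \<sigma> m)) else 0)"
proof (cases "S = 0\<^sub>m m m")
  case True
  then show ?thesis using linear_character_add_zero[OF \<theta>(1)] by (simp add: pairing_def)
next
  case False
  have Sc: "S \<in> carrier_mat m m" using S by (rule corner_forms_carrier)
  obtain a b where ab: "a < m" "b < m" "S $$ (a, b) \<noteq> 0"
    using False Sc by (metis eq_matI carrier_matD index_zero_mat)
  have r: "a + b + 1 < m" using corner_forms_zero[OF S, of a b] ab by linarith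
  \<comment> \<open>The pairing of S with a symmetrized unit is 2 times an entry of S; a nonzero
    entry is therefore detected by translating the sum by a suitable multiple of that unit.\<close>
  have "S $$ (a, b) + \<sigma> * S $$ (b, a) = (1 + \<sigma> * \<sigma>) * S $$ (a, b)"
    using corner_forms_sym[OF S ab(1,2)] by (simp add: distrib_right)
  then have nz: "S $$ (a, b) + \<sigma> * S $$ (b, a) \<noteq> 0" using \<sigma> ab(3) two by simp
  obtain s where s: "\<theta> ((S $$ (a, b) + \<sigma> * S $$ (b, a)) * s) \<noteq> 1"
    using linear_character_add_scale[OF \<theta>(2) nz] by blast
  define T0 where "T0 = s \<cdot>\<^sub>m sym_unit \<sigma> m a b"
  have T0: "T0 \<in> corner_forms \<sigma> m" unfolding T0_def by (rule sym_unit_corner_forms[OF \<sigma> r])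
  note T0c = corner_forms_carrier[OF T0]
  have p: "\<theta> (pairing m T0 S) \<noteq> 1" using s by (simp add: T0_def pairing_sym_unit ab mult.commute)
  let ?X = "\<Sum>T\<in>corner_forms \<sigma> m. \<theta> (pairing m T S)"
  have "?X = (\<Sum>T\<in>corner_forms \<sigma> m. \<theta> (pairing m (T + T0) S))"
    by (rule sum.reindex_bij_witness[of _ "\<lambda>T. T + T0" "\<lambda>T. T - T0"])
      (use T0 T0c in \<open>simp_all add: corner_forms_add corner_forms_diff
        diff_add_cancel_mat[of _ m m] corner_forms_carrier\<close>)
  also have "\<dots> = ?X * \<theta> (pairing m T0 S)"
    unfolding sum_distrib_right
    by (rule sum.cong[OF refl])
      (use \<theta>(1) T0c in \<open>auto simp: pairing_add corner_forms_carrier linear_character_add_def\<close>)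
  finally have "?X * (1 - \<theta> (pairing m T0 S)) = 0" by (simp add: right_diff_distrib)
  then show ?thesis using p False by simp
qed

text \<open>Averaging over the group weights all points of the coadjoint orbit of T equally, since
  their stabilizers have the same order, and avoids handling orbits as sets.\<close>

definition orbit_avg :: "('a::{field,finite} \<Rightarrow> complex) \<Rightarrow> nat \<Rightarrow> 'a mat \<Rightarrow> 'a mat \<Rightarrow> complex" where
  "orbit_avg \<theta> m T S =
     (\<Sum>g\<in>unitriangular m. \<theta> (pairing m T (g * S * g\<^sup>T))) / of_nat (card (unitriangular m :: 'a mat set))"

lemma congr_mult:
  fixes g :: "'a::field mat"
  assumes "g \<in> carrier_mat m m" "h \<in> carrier_mat m m" "S \<in> carrier_mat m m"
  shows "g * (h * S * h\<^sup>T) * g\<^sup>T = (g * h) * S * (g * h)\<^sup>T"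
  unfolding transpose_mult[OF assms(1,2)] using assms by (simp add: assoc_mult_mat[of _ m m _ m _ m])

lemma orbit_avg_coact:
  assumes g: "g \<in> unitriangular m" and T: "T \<in> corner_forms \<sigma> m" and S: "S \<in> corner_forms \<sigma> m"
  shows "orbit_avg \<theta> m (coact m T g) S = orbit_avg \<theta> m T S"
proof -
  have "pairing m (coact m T g) (h * S * h\<^sup>T) = pairing m T ((g * h) * S * (g * h)\<^sup>T)"
    if h: "h \<in> unitriangular m" for h
    using pairing_coact_congr[OF g T corner_forms_congr[OF h S]]
      congr_mult[of g m h S] g h S unitriangular_carrier corner_forms_carrier by metis
  then have "(\<Sum>h\<in>unitriangular m. \<theta> (pairing m (coact m T g) (h * S * h\<^sup>T))) =
    (\<Sum>h\<in>unitriangular m. \<theta> (pairing m T ((g * h) * S * (g * h)\<^sup>T)))"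
    by simp
  also have "\<dots> = (\<Sum>h\<in>unitriangular m. \<theta> (pairing m T (h * S * h\<^sup>T)))"
    by (rule sum_unitriangular_mult_left[OF g])
  finally show ?thesis by (simp add: orbit_avg_def)
qed

lemma congr_eq_zero:
  fixes g :: "'a::field mat"
  assumes g: "g \<in> unitriangular m" and S: "S \<in> carrier_mat m m"
  shows "g * S * g\<^sup>T = 0\<^sub>m m m \<longleftrightarrow> S = 0\<^sub>m m m"
proof
  let ?h = "inv\<^bsub>GL m\<^esub> g"
  note gc = unitriangular_carrier[OF g]
  have hc: "?h \<in> carrier_mat m m" using unitriangular_inv(1)[OF g] by (rule unitriangular_carrier)
  assume "g * S * g\<^sup>T = 0\<^sub>m m m"
  then have "?h * (g * S * g\<^sup>T) * ?h\<^sup>T = 0\<^sub>m m m" using hc by simp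
  then show "S = 0\<^sub>m m m" using congr_mult[OF hc gc S] unitriangular_inv(3)[OF g] S by simp
qed (use unitriangular_carrier[OF g] in simp)

text \<open>The sum runs over all forms and not over orbit representatives, so each orbit counts
  with its size. Congruence by g is invertible, so orthogonality of characters leaves a point mass
  at 0, which the Cayley transform pulls back to a multiple of the regular character.\<close>

lemma sum_orbit_avg:
  fixes \<theta> :: "'a::{field,finite} \<Rightarrow> complex"
  assumes \<theta>: "linear_character_add \<theta>" "\<exists>a. \<theta> a \<noteq> 1" and two: "(2::'a) \<noteq> 0" and \<sigma>: "\<sigma> * \<sigma> = 1"
    and S: "S \<in> corner_forms \<sigma> m"
  shows "(\<Sum>T\<in>corner_forms \<sigma> m. orbit_avg \<theta> m T S) =
    (if S = 0\<^sub>m m m then of_nat (card (corner_forms \<sigma> m)) else 0)"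
proof -
  let ?N = "of_nat (card (unitriangular m :: 'a mat set)) :: complex"
  have "(\<Sum>T\<in>corner_forms \<sigma> m. orbit_avg \<theta> m T S) =
    (\<Sum>g\<in>unitriangular m. \<Sum>T\<in>corner_forms \<sigma> m. \<theta> (pairing m T (g * S * g\<^sup>T))) / ?N"
    unfolding orbit_avg_def sum_divide_distrib[symmetric] by (subst sum.swap) simp
  also have "\<dots> = (\<Sum>g\<in>(unitriangular m :: 'a mat set). if S = 0\<^sub>m m m then of_nat (card (corner_forms \<sigma> m)) else 0) / ?N"
    by (intro arg_cong[of _ _ "\<lambda>x. x / _"] sum.cong refl)
      (simp add: sum_character_corner_forms[OF \<theta> two \<sigma>] corner_forms_congr S congr_eq_zero
        corner_forms_carrier[OF S])
  also have "\<dots> = (if S = 0\<^sub>m m m then of_nat (card (corner_forms \<sigma> m)) else 0)"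
    using card_unitriangular_pos[of m, where 'a='a] by simp
  finally show ?thesis .
qed

text \<open>Each average is a mean of additive characters of the space of forms, indexed by a
  coadjoint orbit; disjoint orbits have no character in common.\<close>

lemma orbit_avg_orthogonal:
  fixes \<theta> :: "'a::{field,finite} \<Rightarrow> complex"
  assumes \<theta>: "linear_character_add \<theta>" "\<exists>a. \<theta> a \<noteq> 1" and two: "(2::'a) \<noteq> 0" and \<sigma>: "\<sigma> * \<sigma> = 1"
    and T: "T \<in> corner_forms \<sigma> m" and T': "T' \<in> corner_forms \<sigma> m"
    and orb: "\<And>g g'. g \<in> unitriangular m \<Longrightarrow> g' \<in> unitriangular m \<Longrightarrow> coact m T g \<noteq> coact m T' g'"
  shows "(\<Sum>S\<in>corner_forms \<sigma> m. orbit_avg \<theta> m T S * cnj (orbit_avg \<theta> m T' S)) = 0"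
proof -
  let ?G = "unitriangular m :: 'a mat set"
  let ?N = "of_nat (card ?G) :: complex"
  have eq: "orbit_avg \<theta> m T S * cnj (orbit_avg \<theta> m T' S) =
     (\<Sum>g\<in>?G. \<Sum>g'\<in>?G. \<theta> (pairing m (coact m T g - coact m T' g') S)) / (?N * ?N)"
    if S: "S \<in> corner_forms \<sigma> m" for S
  proof -
    have "\<theta> (pairing m T (g * S * g\<^sup>T)) * cnj (\<theta> (pairing m T' (g' * S * g'\<^sup>T))) =
        \<theta> (pairing m (coact m T g - coact m T' g') S)" if g: "g \<in> ?G" "g' \<in> ?G" for g g'
    proof -
      have "pairing m (coact m T g - coact m T' g') S =
          pairing m T (g * S * g\<^sup>T) + - pairing m T' (g' * S * g'\<^sup>T)"
        using pairing_coact_congr[OF g(1) T S] pairing_coact_congr[OF g(2) T' S]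
        by (subst pairing_diff) (simp_all add: coact_def)
      then show ?thesis using \<theta>(1) linear_character_add_uminus[OF \<theta>(1)]
        by (metis linear_character_add_def)
    qed
    then show ?thesis by (simp add: orbit_avg_def sum_product)
  qed
  have "(\<Sum>S\<in>corner_forms \<sigma> m. orbit_avg \<theta> m T S * cnj (orbit_avg \<theta> m T' S)) =
     (\<Sum>S\<in>corner_forms \<sigma> m. \<Sum>g\<in>?G. \<Sum>g'\<in>?G. \<theta> (pairing m (coact m T g - coact m T' g') S)) / (?N * ?N)"
    unfolding sum_divide_distrib[symmetric] by (simp add: eq sum_divide_distrib)
  also have "\<dots> = (\<Sum>g\<in>?G. \<Sum>g'\<in>?G. \<Sum>S\<in>corner_forms \<sigma> m. \<theta> (pairing m (coact m T g - coact m T' g') S)) / (?N * ?N)"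
    by (subst sum.swap, subst (2) sum.swap) simp
  also have "\<dots> = 0"
  proof -
    have "(\<Sum>S\<in>corner_forms \<sigma> m. \<theta> (pairing m (coact m T g - coact m T' g') S)) = 0"
      if g: "g \<in> ?G" "g' \<in> ?G" for g g'
    proof -
      let ?D = "coact m T g - coact m T' g'"
      have D: "?D \<in> corner_forms \<sigma> m"
        using g T T' by (intro corner_forms_diff coact_corner_forms unitriangular_carrier)
      have "?D \<noteq> 0\<^sub>m m m"
      proof
        assume 0: "?D = 0\<^sub>m m m"
        have "coact m T g = coact m T' g'"
        proof (rule eq_matI)
          fix i j assume "i < dim_row (coact m T' g')" "j < dim_col (coact m T' g')"
          then show "coact m T g $$ (i, j) = coact m T' g' $$ (i, j)"
            using arg_cong[OF 0, of "\<lambda>A. A $$ (i, j)"] by (simp add: coact_def)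
        qed (simp_all add: coact_def)
        then show False using orb[OF g] by simp
      qed
      then show ?thesis
        using sum_character_corner_forms[OF \<theta> two \<sigma> D] by (simp add: pairing_commute)
    qed
    then show ?thesis by simp
  qed
  finally show ?thesis .
qed

section \<open>Orbit representatives of the coadjoint action\<close>

text \<open>Entry (a, b) of the product only sees entries (c, d) with c \<le> a and d \<le> b. Hence
  discarding everything on and below the antidiagonal is compatible with repeated action.\<close>

lemma unitriangular_triple_cong:
  assumes h: "h \<in> unitriangular m" and k: "k \<in> unitriangular m"
    and X: "X \<in> carrier_mat m m" and Y: "Y \<in> carrier_mat m m"
    and XY: "\<And>i j. i + j + 1 < m \<Longrightarrow> X $$ (i, j) = Y $$ (i, j)"
    and ab: "a + b + 1 < m"
  shows "(h\<^sup>T * X * k) $$ (a, b) = (h\<^sup>T * Y * k) $$ (a, b)"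
proof -
  note hc = unitriangular_carrier[OF h] and kc = unitriangular_carrier[OF k]
  have "h $$ (c, a) * X $$ (c, d) * k $$ (d, b) = h $$ (c, a) * Y $$ (c, d) * k $$ (d, b)"
    if cd: "c < m" "d < m" for c d
  proof (cases "a < c \<or> b < d")
    case True
    then show ?thesis using unitriangular_index[OF h cd(1), of a] unitriangular_index[OF k cd(2), of b] by auto
  next
    case False
    then have "c + d + 1 < m" using ab by linarith
    then show ?thesis using XY by simp
  qed
  then have *: "(\<Sum>c<m. \<Sum>d<m. h $$ (c, a) * X $$ (c, d) * k $$ (d, b)) =
      (\<Sum>c<m. \<Sum>d<m. h $$ (c, a) * Y $$ (c, d) * k $$ (d, b))"
    by (intro sum.cong refl) blast
  have "(h\<^sup>T * Z * k) $$ (a, b) = (\<Sum>c<m. \<Sum>d<m. h $$ (c, a) * Z $$ (c, d) * k $$ (d, b))"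
    if "Z \<in> carrier_mat m m" for Z
    using triple_index[of "h\<^sup>T" m Z k a b] hc kc that ab by simp
  then show ?thesis using X Y * by simp
qed

lemma coact_coact:
  fixes T :: "'a::field mat"
  assumes g: "g \<in> unitriangular m" and h: "h \<in> unitriangular m" and T: "T \<in> carrier_mat m m"
  shows "coact m (coact m T g) h = coact m T (g * h)"
proof (rule eq_matI)
  fix i j assume "i < dim_row (coact m T (g * h))" "j < dim_col (coact m T (g * h))"
  then have ij: "i < m" "j < m" by (simp_all add: coact_def)
  note gc = unitriangular_carrier[OF g] and hc = unitriangular_carrier[OF h]
  show "coact m (coact m T g) h $$ (i, j) = coact m T (g * h) $$ (i, j)"
  proof (cases "i + j + 1 < m")
    case True
    have "(h\<^sup>T * coact m T g * h) $$ (i, j) =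
        (h\<^sup>T * (g\<^sup>T * T * g) * h) $$ (i, j)"
      by (rule unitriangular_triple_cong[OF h h _ _ _ True]) (use gc T in \<open>auto simp: coact_def\<close>)
    also have "h\<^sup>T * (g\<^sup>T * T * g) * h = (g * h)\<^sup>T * T * (g * h)"
      unfolding transpose_mult[OF gc hc] using gc hc T by (simp add: assoc_mult_mat[of _ m m _ m _ m])
    finally show ?thesis using ij True by (simp add: coact_def)
  qed (use ij in \<open>simp add: coact_def\<close>)
qed (simp_all add: coact_def)

lemma coact_one:
  assumes T: "T \<in> corner_forms \<sigma> m"
  shows "coact m T (1\<^sub>m m) = T"
proof (rule eq_matI)
  note Tc = corner_forms_carrier[OF T]
  fix i j assume "i < dim_row T" "j < dim_col T"
  then show "coact m T (1\<^sub>m m) $$ (i, j) = T $$ (i, j)"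
    using Tc corner_forms_zero[OF T, of i j] by (auto simp: coact_def)
qed (use corner_forms_carrier[OF T] in \<open>auto simp: coact_def\<close>)

section \<open>Symmetric Gaussian elimination\<close>

lemma transvection:
  fixes T :: "'a::field mat"
  assumes T: "T \<in> carrier_mat m m" and b: "b < m" and s: "\<And>j. j \<le> b \<Longrightarrow> s j = 0"
  obtains g where "g \<in> unitriangular m"
    and "\<And>i j. i + j + 1 < m \<Longrightarrow> coact m T g $$ (i, j) =
      T $$ (i, j) + s j * T $$ (i, b) + s i * T $$ (b, j) + s i * s j * T $$ (b, b)"
proof
  \<comment> \<open>The identity with s added to row b: congruence adds s j times column b to column
    j, and likewise for rows. As s vanishes up to b, the matrix is unitriangular.\<close>
  define g where "g = mat m m (\<lambda>(i, j). of_bool (i = j) + of_bool (i = b) * s j)"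
  show g: "g \<in> unitriangular m"
    by (rule unitriangularI) (use s in \<open>auto simp: g_def\<close>)
  note gc = unitriangular_carrier[OF g]
  have row: "(\<Sum>k<m. g $$ (k, i) * x k) = x i + s i * x b" if "i < m" for i and x :: "nat \<Rightarrow> 'a"
  proof -
    have "(\<Sum>k<m. g $$ (k, i) * x k) = (\<Sum>k<m. (if k = i then x k else 0) + (if k = b then s i * x k else 0))"
      by (rule sum.cong) (use that in \<open>auto simp: g_def distrib_right\<close>)
    then show ?thesis using that b by (simp add: sum.distrib)
  qed
  fix i j assume ij: "i + j + 1 < m"
  have "(g\<^sup>T * T * g) $$ (i, j) = (\<Sum>k<m. g $$ (k, i) * (\<Sum>l<m. g $$ (l, j) * T $$ (k, l)))"
  proof -
    have "i < m" "j < m" using ij by simp_all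
    show ?thesis
      unfolding congr_transpose_index[OF gc T \<open>i < m\<close> \<open>j < m\<close>] by (simp add: sum_distrib_left ac_simps)
  qed
  also have "\<dots> = (\<Sum>k<m. g $$ (k, i) * (T $$ (k, j) + s j * T $$ (k, b)))"
    using ij by (simp add: row)
  also have "\<dots> = T $$ (i, j) + s j * T $$ (i, b) + s i * T $$ (b, j) + s i * s j * T $$ (b, b)"
    using ij row[of i "\<lambda>k. T $$ (k, j) + s j * T $$ (k, b)"] by (simp add: distrib_left mult.assoc add.assoc)
  finally show "coact m T g $$ (i, j) =
      T $$ (i, j) + s j * T $$ (i, b) + s i * T $$ (b, j) + s i * s j * T $$ (b, b)"
    using ij by (simp add: coact_def)
qed

definition matching :: "nat \<Rightarrow> 'a::zero mat \<Rightarrow> bool" where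
  "matching m T \<longleftrightarrow> (\<forall>i<m. \<forall>j<m. \<forall>l<m. T $$ (i, j) \<noteq> 0 \<and> T $$ (i, l) \<noteq> 0 \<longrightarrow> j = l)"

text \<open>Invariant of the elimination: each nonzero row i < k and its partner row j, which may
  lie beyond k, are decoupled from all other rows.\<close>

definition matched :: "nat \<Rightarrow> nat \<Rightarrow> 'a::zero mat \<Rightarrow> bool" where
  "matched m k T \<longleftrightarrow> (\<forall>i<k. \<forall>j<m. T $$ (i, j) \<noteq> 0 \<longrightarrow>
     (\<forall>l<m. T $$ (i, l) \<noteq> 0 \<longrightarrow> l = j) \<and> (\<forall>l<m. T $$ (j, l) \<noteq> 0 \<longrightarrow> l = i))"

lemma matchedD:
  assumes "matched m k T" "i < k" "j < m" "T $$ (i, j) \<noteq> 0" "l < m"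
  shows "T $$ (i, l) \<noteq> 0 \<Longrightarrow> l = j" "T $$ (j, l) \<noteq> 0 \<Longrightarrow> l = i"
  using assms unfolding matched_def by blast+

lemma matched_cong:
  assumes "matched m k T"
    and "\<And>i j. i < k \<Longrightarrow> j < m \<Longrightarrow> T' $$ (i, j) = T $$ (i, j)"
    and "\<And>i j l. i < k \<Longrightarrow> j < m \<Longrightarrow> l < m \<Longrightarrow> T $$ (i, j) \<noteq> 0 \<Longrightarrow> T' $$ (j, l) = T $$ (j, l)"
  shows "matched m k T'"
  using assms unfolding matched_def by metis

lemma matched_SucI:
  assumes "matched m k T" "b < m"
    and "\<And>l. l < m \<Longrightarrow> T $$ (k, l) \<noteq> 0 \<Longrightarrow> l = b"
    and "\<And>l. l < m \<Longrightarrow> T $$ (b, l) \<noteq> 0 \<Longrightarrow> l = k"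
  shows "matched m (Suc k) T"
  using assms unfolding matched_def less_Suc_eq by metis

lemma corner_forms_nonzero_sym:
  fixes T :: "'a::field mat"
  assumes "T \<in> corner_forms \<sigma> m" "\<sigma> * \<sigma> = 1" "i < m" "j < m"
  shows "T $$ (j, i) \<noteq> 0 \<longleftrightarrow> T $$ (i, j) \<noteq> 0"
proof -
  have "\<sigma> \<noteq> 0" using assms(2) by auto
  then show ?thesis using corner_forms_sym[OF assms(1,3,4)] by simp
qed

text \<open>The pivot b is the first nonzero column of row k, so multiples of column b clear
  everything to its right. Rows already matched survive because column b vanishes in them and in
  their partners, while row k vanishes at the partner columns. The last conclusion prepares
  \<open>clear_column\<close>.\<close>

lemma clear_row:
  fixes T :: "'a::field mat"
  assumes \<sigma>: "\<sigma> * \<sigma> = 1" and T: "T \<in> corner_forms \<sigma> m" and k: "k < m" and mk: "matched m k T"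
    and b: "k \<le> b" "b < m" "T $$ (k, b) \<noteq> 0" and before: "\<And>j. j < b \<Longrightarrow> T $$ (k, j) = 0"
  obtains g where "g \<in> unitriangular m" "matched m k (coact m T g)"
    "coact m T g $$ (k, b) \<noteq> 0" "\<And>j. j < m \<Longrightarrow> coact m T g $$ (k, j) \<noteq> 0 \<Longrightarrow> j = b"
    "\<And>i. i < k \<Longrightarrow> coact m T g $$ (b, i) = 0"
proof -
  note Tc = corner_forms_carrier[OF T]
  note nz = corner_forms_nonzero_sym[OF T \<sigma>]
  have kb: "k + b + 1 < m" using corner_forms_zero[OF T k b(2)] b(3) by linarith
  define s where "s j = (if b < j \<and> j < m then - T $$ (k, j) / T $$ (k, b) else 0)" for j
  obtain g where g: "g \<in> unitriangular m"
    and gij: "\<And>i j. i + j + 1 < m \<Longrightarrow> coact m T g $$ (i, j) =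
      T $$ (i, j) + s j * T $$ (i, b) + s i * T $$ (b, j) + s i * s j * T $$ (b, b)"
    using transvection[OF Tc b(2), of s] by (auto simp: s_def)
  define T1 where "T1 = coact m T g"
  have T1: "T1 \<in> corner_forms \<sigma> m"
    unfolding T1_def by (rule coact_corner_forms[OF unitriangular_carrier[OF g] T])
  have out: "T1 $$ (i, j) = T $$ (i, j)" if "i < m" "j < m" "\<not> i + j + 1 < m" for i j
    using corner_forms_zero[OF T, of i j] corner_forms_zero[OF T1, of i j] that by simp
  \<comment> \<open>A nonzero entry would make b the partner of the earlier row i, but row b also
    meets column k.\<close>
  have ib: "T $$ (i, b) = 0" if "i < k" for i
  proof (rule ccontr)
    assume "T $$ (i, b) \<noteq> 0"
    then have "k = i" using matchedD(2)[OF mk that b(2) _ k] nz[OF k b(2)] b(3) by blast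
    then show False using that by simp
  qed
  have T1k: "T1 $$ (k, j) = (if j = b then T $$ (k, b) else 0)" if j: "j < m" for j
  proof (cases "k + j + 1 < m")
    case True
    have "s k = 0" using b(1) by (simp add: s_def)
    then have "T1 $$ (k, j) = T $$ (k, j) + s j * T $$ (k, b)" using gij[OF True] by (simp add: T1_def)
    then show ?thesis using before[of j] j b(3) by (auto simp: s_def)
  next
    case False
    then show ?thesis using corner_forms_zero[OF T1 k j] kb by auto
  qed
  have upper: "T1 $$ (i, j) = T $$ (i, j)" if i: "i < k" and j: "j < m" for i j
  proof (cases "i + j + 1 < m")
    case True
    have "s i = 0" using i b(1) by (simp add: s_def)
    then show ?thesis using gij[OF True] ib[OF i] by (simp add: T1_def)
  qed (use out[of i j] i j k in simp)
  have "matched m k T1"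
  proof (rule matched_cong[OF mk upper])
    fix i j l assume ijl: "i < k" "j < m" "l < m" "T $$ (i, j) \<noteq> 0"
    have i: "i < m" using ijl(1) k by simp
    have jb: "T $$ (j, b) = 0"
      using matchedD(2)[OF mk ijl(1,2,4) b(2)] ijl(1) b(1) by (metis not_less)
    have "T $$ (k, j) = 0"
      using matchedD(2)[OF mk ijl(1,2,4) k] ijl(1) nz[OF k ijl(2)] by blast
    then have sj: "s j = 0" by (simp add: s_def)
    show "T1 $$ (j, l) = T $$ (j, l)"
    proof (cases "j + l + 1 < m")
      case True
      then show ?thesis using gij[OF True] jb sj by (simp add: T1_def)
    qed (use out ijl in simp)
  qed
  moreover have "T1 $$ (b, i) = 0" if "i < k" for i
    using upper[OF that b(2)] ib[OF that] corner_forms_nonzero_sym[OF T1 \<sigma>, of i b] that k b(2) by force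
  ultimately show thesis
    using g T1k[OF b(2)] T1k b(3) unfolding T1_def
    by (intro that[of g]) (auto split: if_splits)
qed

text \<open>Row k and column k have a single nonzero entry each, at b, so adding multiples of them
  alters only row b and column b; the multiples are chosen to clear row b except at k.\<close>

lemma clear_column:
  fixes T :: "'a::field mat"
  assumes \<sigma>: "\<sigma> * \<sigma> = 1" and two: "(2::'a) \<noteq> 0" and T: "T \<in> corner_forms \<sigma> m"
    and mk: "matched m k T" and b: "k < b" "b < m" "T $$ (k, b) \<noteq> 0"
    and row: "\<And>j. j < m \<Longrightarrow> T $$ (k, j) \<noteq> 0 \<Longrightarrow> j = b"
    and bi: "\<And>i. i < k \<Longrightarrow> T $$ (b, i) = 0"
  obtains g where "g \<in> unitriangular m" "matched m (Suc k) (coact m T g)"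
proof -
  note Tc = corner_forms_carrier[OF T]
  note nz = corner_forms_nonzero_sym[OF T \<sigma>]
  have k: "k < m" using b by simp
  have bk: "T $$ (b, k) \<noteq> 0" using nz[OF k b(2)] b(3) by simp
  have kk: "T $$ (k, k) = 0" using row[OF k] b(1) by auto
  \<comment> \<open>At j = b the correction reaches the entry (b, b) twice, once from the row and
    once from the column, whence the factor 2.\<close>
  define s where "s j = (if k < j \<and> j < m then
    (if j = b then - T $$ (b, b) / (2 * T $$ (b, k)) else - T $$ (b, j) / T $$ (b, k)) else 0)" for j
  have sk: "s k = 0" by (simp add: s_def)
  obtain g where g: "g \<in> unitriangular m"
    and gij: "\<And>i j. i + j + 1 < m \<Longrightarrow> coact m T g $$ (i, j) =
      T $$ (i, j) + s j * T $$ (i, k) + s i * T $$ (k, j) + s i * s j * T $$ (k, k)"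
    using transvection[OF Tc k, of s] by (auto simp: s_def)
  define T1 where "T1 = coact m T g"
  have T1: "T1 \<in> corner_forms \<sigma> m"
    unfolding T1_def by (rule coact_corner_forms[OF unitriangular_carrier[OF g] T])
  have out: "T1 $$ (i, j) = T $$ (i, j)" if "i < m" "j < m" "\<not> i + j + 1 < m" for i j
    using corner_forms_zero[OF T, of i j] corner_forms_zero[OF T1, of i j] that by simp
  have T1ij: "T1 $$ (i, j) = T $$ (i, j) + s j * T $$ (i, k) + s i * T $$ (k, j)" if "i + j + 1 < m" for i j
    using gij[OF that] kk by (simp add: T1_def)
  have ki: "T $$ (i, k) = 0" if "i < m" "i \<noteq> b" for i
    using row[OF that(1)] that nz[OF k that(1)] by blast
  have upper: "T1 $$ (i, j) = T $$ (i, j)" if i: "i < k" and j: "j < m" for i j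
  proof (cases "i + j + 1 < m")
    case True
    have "s i = 0" using i by (simp add: s_def)
    then show ?thesis using T1ij[OF True] ki[of i] i b by simp
  qed (use out[of i j] i j k in simp)
  have m1: "matched m k T1"
  proof (rule matched_cong[OF mk upper])
    fix i j l assume ijl: "i < k" "j < m" "l < m" "T $$ (i, j) \<noteq> 0"
    have i: "i < m" using ijl(1) k by simp
    have jb: "j \<noteq> b" using bi[OF ijl(1)] ijl(4) nz[OF i b(2)] by blast
    have "T $$ (j, b) = 0" using matchedD(2)[OF mk ijl(1,2,4) b(2)] ijl(1) b(1) by force
    then have "T $$ (b, j) = 0" using nz[OF ijl(2) b(2)] by blast
    then have sj: "s j = 0" using jb by (simp add: s_def)
    show "T1 $$ (j, l) = T $$ (j, l)"
    proof (cases "j + l + 1 < m")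
      case True
      then show ?thesis using T1ij[OF True] ki[OF ijl(2) jb] sj by simp
    qed (use out ijl in simp)
  qed
  moreover have "l = b" if "l < m" "T1 $$ (k, l) \<noteq> 0" for l
  proof (cases "k + l + 1 < m")
    case True
    then show ?thesis using T1ij[OF True] that kk sk row[OF that(1)] by simp
  next
    case False
    then show ?thesis using out[OF k that(1)] that(2) row[OF that(1)] by simp
  qed
  moreover have "l = k" if l: "l < m" "T1 $$ (b, l) \<noteq> 0" for l
  proof (rule ccontr)
    assume lk: "l \<noteq> k"
    have r: "b + l + 1 < m" using corner_forms_zero[OF T1 b(2) l(1)] l(2) by linarith
    consider "l < k" | "l = b" | "k < l" "l \<noteq> b" using lk by linarith
    then have "T1 $$ (b, l) = 0"
    proof cases
      case 1
      then have "T $$ (k, l) = 0" using row[of l] k b by force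
      then show ?thesis using T1ij[OF r] bi[OF 1] 1 by (simp add: s_def)
    next
      case 2
      \<comment> \<open>This identity treats both signs at once: the second correction is \<sigma>
        times the first, hence again minus half of the entry (b, b).\<close>
      have "T $$ (b, b) = \<sigma> * T $$ (b, b)" by (rule corner_forms_sym[OF T b(2) b(2)])
      moreover have "T $$ (k, b) = \<sigma> * T $$ (b, k)" by (rule corner_forms_sym[OF T b(2) k])
      moreover have "s b * T $$ (b, k) = - T $$ (b, b) / 2" using b bk two by (simp add: s_def)
      ultimately have "T1 $$ (b, b) = T $$ (b, b) - T $$ (b, b) / 2 - T $$ (b, b) / 2"
        using T1ij[OF r] 2
        by (metis (no_types, lifting) ab_semigroup_mult_class.mult_ac(1) add_uminus_conv_diff
            minus_divide_left mult.left_commute mult_minus_right times_divide_eq_right)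
      then show ?thesis using 2 two by (simp add: field_simps)
    next
      case 3
      then have "T $$ (k, l) = 0" using row[OF l(1)] by blast
      then show ?thesis using T1ij[OF r] 3 l bk by (simp add: s_def)
    qed
    then show False using l by simp
  qed
  ultimately have "matched m (Suc k) T1" using matched_SucI b(2) by blast
  then show thesis using that g by (simp add: T1_def)
qed

text \<open>Row k is zero, or the partner of an earlier row, or needs a new pivot. In the last case
  everything left of the diagonal vanishes, so the pivot has b \<ge> k; for b = k clearing the row
  already clears the column.\<close>

lemma matched_step:
  fixes T :: "'a::field mat"
  assumes \<sigma>: "\<sigma> * \<sigma> = 1" and two: "(2::'a) \<noteq> 0" and T: "T \<in> corner_forms \<sigma> m"
    and k: "k < m" and mk: "matched m k T"
  obtains g where "g \<in> unitriangular m" "matched m (Suc k) (coact m T g)"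
proof -
  note nz = corner_forms_nonzero_sym[OF T \<sigma>]
  consider (zero) "\<forall>j<m. T $$ (k, j) = 0" | (old) i where "i < k" "T $$ (k, i) \<noteq> 0"
    | (new) "\<exists>j<m. T $$ (k, j) \<noteq> 0" "\<forall>i<k. T $$ (k, i) = 0"
    by blast
  then show thesis
  proof cases
    case zero
    then have "matched m (Suc k) T" using mk unfolding matched_def less_Suc_eq by blast
    then show thesis using that[OF one_unitriangular] coact_one[OF T] by simp
  next
    case old
    have i: "i < m" using old(1) k by simp
    have ik: "T $$ (i, k) \<noteq> 0" using old nz[OF i k] by simp
    have "matched m (Suc k) T"
      by (rule matched_SucI[OF mk i]) (use matchedD[OF mk old(1) k ik] in blast)+
    then show thesis using that[OF one_unitriangular] coact_one[OF T] by simp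
  next
    case new
    define b where "b = (LEAST j. j < m \<and> T $$ (k, j) \<noteq> 0)"
    have b: "b < m" "T $$ (k, b) \<noteq> 0" using LeastI_ex[OF new(1)] by (simp_all add: b_def)
    have before: "T $$ (k, j) = 0" if "j < b" for j
      using not_less_Least[of j "\<lambda>j. j < m \<and> T $$ (k, j) \<noteq> 0"] that b(1) by (auto simp: b_def)
    have kb: "k \<le> b" using new(2) b(2) not_less by blast
    obtain g where g: "g \<in> unitriangular m" "matched m k (coact m T g)"
      "coact m T g $$ (k, b) \<noteq> 0" "\<And>j. j < m \<Longrightarrow> coact m T g $$ (k, j) \<noteq> 0 \<Longrightarrow> j = b"
      "\<And>i. i < k \<Longrightarrow> coact m T g $$ (b, i) = 0"
      using clear_row[OF \<sigma> T k mk kb b before] by blast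
    have T1: "coact m T g \<in> corner_forms \<sigma> m"
      by (rule coact_corner_forms[OF unitriangular_carrier[OF g(1)] T])
    show thesis
    proof (cases "b = k")
      case True
      have "matched m (Suc k) (coact m T g)"
        by (rule matched_SucI[OF g(2) k]) (use g(4) True in blast)+
      then show thesis using that g(1) by blast
    next
      case False
      then have "k < b" using kb by simp
      obtain h where h: "h \<in> unitriangular m" "matched m (Suc k) (coact m (coact m T g) h)"
        using clear_column[OF \<sigma> two T1 g(2) \<open>k < b\<close> b(1) g(3,4,5)] by blast
      then show thesis
        using that[of "g * h"] coact_coact[OF g(1) h(1) corner_forms_carrier[OF T]]
          unitriangular_mult[OF g(1) h(1)] by simp
    qed
  qed
qed

lemma coact_matching:
  fixes T :: "'a::field mat"
  assumes \<sigma>: "\<sigma> * \<sigma> = 1" and two: "(2::'a) \<noteq> 0" and T: "T \<in> corner_forms \<sigma> m"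
  obtains g where "g \<in> unitriangular m" "matching m (coact m T g)"
proof -
  have "\<exists>g\<in>unitriangular m. matched m k (coact m T g)" if "k \<le> m" for k
    using that
  proof (induction k)
    case 0
    show ?case using one_unitriangular[of m] by (auto simp: matched_def)
  next
    case (Suc k)
    then obtain g where g: "g \<in> unitriangular m" "matched m k (coact m T g)" by auto
    have T1: "coact m T g \<in> corner_forms \<sigma> m"
      by (rule coact_corner_forms[OF unitriangular_carrier[OF g(1)] T])
    obtain h where h: "h \<in> unitriangular m" "matched m (Suc k) (coact m (coact m T g) h)"
      using matched_step[OF \<sigma> two T1 _ g(2)] Suc.prems by auto
    then show ?case
      using coact_coact[OF g(1) h(1) corner_forms_carrier[OF T]] unitriangular_mult[OF g(1) h(1)] by auto
  qed
  then obtain g where "g \<in> unitriangular m" "matched m m (coact m T g)" by blast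
  then show thesis using that unfolding matching_def matched_def by metis
qed

text \<open>Column b of \<open>T'\<close> has its nonzero entry in some row a' \<le> a. If a' < a,
  comparing the two sides at (a', b) produces a nonzero entry (a', b') of T with b' < b. By
  induction on a + b it is also an entry of \<open>T'\<close>, whose row a' would then have two
  nonzero entries. So a' = a, and the unit diagonals make the values equal.\<close>

lemma matching_entry:
  fixes T T' :: "'a::field mat"
  assumes \<sigma>: "\<sigma> * \<sigma> = 1"
    and T: "T \<in> corner_forms \<sigma> m" "matching m T" and T': "T' \<in> corner_forms \<sigma> m" "matching m T'"
    and u: "u \<in> unitriangular m" and w: "w \<in> unitriangular m"
    and eq: "\<And>a b. a + b + 1 < m \<Longrightarrow> (\<Sum>c<m. T $$ (a, c) * u $$ (c, b)) = (\<Sum>c<m. w $$ (c, a) * T' $$ (c, b))"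
    and ab: "a < m" "b < m" "T $$ (a, b) \<noteq> 0"
  shows "T' $$ (a, b) = T $$ (a, b)"
  using ab
proof (induction "a + b" arbitrary: a b rule: less_induct)
  case less
  note ab = less.prems
  have r: "a + b + 1 < m" using corner_forms_zero[OF T(1) ab(1,2)] ab(3) by linarith
  have row: "c = d" if "e < m" "c < m" "d < m" "T $$ (e, c) \<noteq> 0" "T $$ (e, d) \<noteq> 0" for c d e
    using T(2) that unfolding matching_def by blast
  have col: "c = d" if "e < m" "c < m" "d < m" "T $$ (c, e) \<noteq> 0" "T $$ (d, e) \<noteq> 0" for c d e
    using row[OF that(1-3)] that corner_forms_nonzero_sym[OF T(1) \<sigma>] by blast
  have row': "c = d" if "e < m" "c < m" "d < m" "T' $$ (e, c) \<noteq> 0" "T' $$ (e, d) \<noteq> 0" for c d e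
    using T'(2) that unfolding matching_def by blast
  have col': "c = d" if "e < m" "c < m" "d < m" "T' $$ (c, e) \<noteq> 0" "T' $$ (d, e) \<noteq> 0" for c d e
    using row'[OF that(1-3)] that corner_forms_nonzero_sym[OF T'(1) \<sigma>] by blast
  have lhs: "(\<Sum>c<m. T $$ (x, c) * u $$ (c, z)) = T $$ (x, y) * u $$ (y, z)"
    if "x < m" "y < m" "T $$ (x, y) \<noteq> 0" for x y z
  proof -
    have "(\<Sum>c<m. T $$ (x, c) * u $$ (c, z)) = (\<Sum>c<m. if c = y then T $$ (x, y) * u $$ (y, z) else 0)"
    proof (rule sum.cong[OF refl])
      fix c assume "c \<in> {..<m}"
      then show "T $$ (x, c) * u $$ (c, z) = (if c = y then T $$ (x, y) * u $$ (y, z) else 0)"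
        using row[of x c y] that by (cases "c = y") auto
    qed
    then show ?thesis using that by simp
  qed
  have rhs: "(\<Sum>c<m. w $$ (c, z) * T' $$ (c, y)) = w $$ (x, z) * T' $$ (x, y)"
    if "x < m" "y < m" "T' $$ (x, y) \<noteq> 0" for x y z
  proof -
    have "(\<Sum>c<m. w $$ (c, z) * T' $$ (c, y)) = (\<Sum>c<m. if c = x then w $$ (x, z) * T' $$ (x, y) else 0)"
    proof (rule sum.cong[OF refl])
      fix c assume "c \<in> {..<m}"
      then show "w $$ (c, z) * T' $$ (c, y) = (if c = x then w $$ (x, z) * T' $$ (x, y) else 0)"
        using col'[of y c x] that by (cases "c = x") auto
    qed
    then show ?thesis using that by simp
  qed
  have eq1: "T $$ (a, b) = (\<Sum>c<m. w $$ (c, a) * T' $$ (c, b))"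
    using eq[OF r] lhs[OF ab, of b] unitriangular_index[OF u ab(2), of b] by simp
  then obtain a' where a': "a' < m" "w $$ (a', a) * T' $$ (a', b) \<noteq> 0"
    using ab(3) sum.neutral[of "{..<m}" "\<lambda>c. w $$ (c, a) * T' $$ (c, b)"] by force
  then have a'b: "T' $$ (a', b) \<noteq> 0" and a'a: "a' \<le> a"
    using unitriangular_index[OF w a'(1), of a] by (auto simp: not_less[symmetric])
  have eq1': "T $$ (a, b) = w $$ (a', a) * T' $$ (a', b)"
    using eq1 rhs[OF a'(1) ab(2) a'b, of a] by simp
  show ?case
  proof (cases "a' = a")
    case True
    then show ?thesis using eq1' unitriangular_index[OF w ab(1), of a] by simp
  next
    case False
    have r': "a' + b + 1 < m" using r a'a by linarith
    have eq2: "(\<Sum>c<m. T $$ (a', c) * u $$ (c, b)) = T' $$ (a', b)"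
      using eq[OF r'] rhs[OF a'(1) ab(2) a'b, of a'] unitriangular_index[OF w a'(1), of a'] by simp
    then obtain b' where b': "b' < m" "T $$ (a', b') * u $$ (b', b) \<noteq> 0"
      using a'b sum.neutral[of "{..<m}" "\<lambda>c. T $$ (a', c) * u $$ (c, b)"] by force
    then have a'b': "T $$ (a', b') \<noteq> 0" and b'b: "b' \<le> b"
      using unitriangular_index[OF u b'(1), of b] by (auto simp: not_less[symmetric])
    have "b' \<noteq> b" using col[OF ab(2) a'(1) ab(1)] a'b' ab(3) False by blast
    then have "T' $$ (a', b') = T $$ (a', b')"
      using less.hyps[OF _ a'(1) b'(1) a'b'] a'a b'b False by simp
    then have "b' = b" using row'[OF a'(1) b'(1) ab(2)] a'b a'b' by simp
    then show ?thesis using \<open>b' \<noteq> b\<close> by simp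
  qed
qed

lemma matching_coact_entry:
  fixes T T' :: "'a::field mat"
  assumes \<sigma>: "\<sigma> * \<sigma> = 1"
    and T: "T \<in> corner_forms \<sigma> m" "matching m T" and T': "T' \<in> corner_forms \<sigma> m" "matching m T'"
    and g: "g \<in> unitriangular m" and g': "g' \<in> unitriangular m"
    and eq: "coact m T g = coact m T' g'"
    and ab: "a < m" "b < m" "T $$ (a, b) \<noteq> 0"
  shows "T' $$ (a, b) = T $$ (a, b)"
proof -
  let ?h = "inv\<^bsub>GL m\<^esub> g" and ?k = "inv\<^bsub>GL m\<^esub> g'"
  note h = unitriangular_inv[OF g] and k = unitriangular_inv[OF g']
  note c = unitriangular_carrier[OF g] unitriangular_carrier[OF g'] unitriangular_carrier[OF h(1)]
    unitriangular_carrier[OF k(1)] corner_forms_carrier[OF T(1)] corner_forms_carrier[OF T'(1)]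
  note assoc = assoc_mult_mat[of _ m m _ m _ m]
  \<comment> \<open>Multiplying by the inverse of g on the left and of \<open>g'\<close> on the
    right leaves a unitriangular factor only to the right of T and only to the left of
    \<open>T'\<close>, the shape treated by \<open>matching_entry\<close>.\<close>
  have e1: "?h\<^sup>T * (g\<^sup>T * T * g) * ?k = T * (g * ?k)"
  proof -
    have "?h\<^sup>T * (g\<^sup>T * T * g) * ?k = (g * ?h)\<^sup>T * (T * (g * ?k))"
      unfolding transpose_mult[OF c(1,3)] using c by (simp add: assoc)
    then show ?thesis unfolding h(2) using c by simp
  qed
  have e2: "?h\<^sup>T * (g'\<^sup>T * T' * g') * ?k = (g' * ?h)\<^sup>T * T'"
  proof -
    have "?h\<^sup>T * (g'\<^sup>T * T' * g') * ?k = (g' * ?h)\<^sup>T * (T' * (g' * ?k))"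
      unfolding transpose_mult[OF c(2,3)] using c by (simp add: assoc)
    then show ?thesis unfolding k(2) using c by simp
  qed
  show ?thesis
  proof (rule matching_entry[OF \<sigma> T T' _ _ _ ab])
    show "g * ?k \<in> unitriangular m" "g' * ?h \<in> unitriangular m"
      using g g' h(1) k(1) by (auto intro: unitriangular_mult)
    fix a b assume r: "a + b + 1 < m"
    have "(T * (g * ?k)) $$ (a, b) = ((g' * ?h)\<^sup>T * T') $$ (a, b)"
      unfolding e1[symmetric] e2[symmetric]
    proof (rule unitriangular_triple_cong[OF h(1) k(1) _ _ _ r])
      fix i j assume "i + j + 1 < m"
      then show "(g\<^sup>T * T * g) $$ (i, j) = (g'\<^sup>T * T' * g') $$ (i, j)"
        using arg_cong[OF eq, of "\<lambda>A. A $$ (i, j)"] by (simp add: coact_def)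
    qed (use c in auto)
    moreover have "(T * (g * ?k)) $$ (a, b) = (\<Sum>c<m. T $$ (a, c) * (g * ?k) $$ (c, b))"
      using c r by (intro mult_index) auto
    moreover have "((g' * ?h)\<^sup>T * T') $$ (a, b) = (\<Sum>x<m. (g' * ?h)\<^sup>T $$ (a, x) * T' $$ (x, b))"
      using c r by (intro mult_index) auto
    moreover have "\<dots> = (\<Sum>x<m. (g' * ?h) $$ (x, a) * T' $$ (x, b))"
      using c r by (intro sum.cong refl) simp
    ultimately show "(\<Sum>c<m. T $$ (a, c) * (g * ?k) $$ (c, b)) = (\<Sum>c<m. (g' * ?h) $$ (c, a) * T' $$ (c, b))"
      by simp
  qed
qed

lemma matching_coact_unique:
  fixes T T' :: "'a::field mat"
  assumes \<sigma>: "\<sigma> * \<sigma> = 1"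
    and T: "T \<in> corner_forms \<sigma> m" "matching m T" and T': "T' \<in> corner_forms \<sigma> m" "matching m T'"
    and g: "g \<in> unitriangular m" and g': "g' \<in> unitriangular m"
    and eq: "coact m T g = coact m T' g'"
  shows "T = T'"
proof (rule eq_matI)
  fix i j assume "i < dim_row T'" "j < dim_col T'"
  then have "i < m" "j < m" using corner_forms_carrier[OF T'(1)] by auto
  then show "T $$ (i, j) = T' $$ (i, j)"
    using matching_coact_entry[OF \<sigma> T T' g g' eq] matching_coact_entry[OF \<sigma> T' T g' g eq[symmetric]]
    by metis
qed (use corner_forms_carrier[OF T(1)] corner_forms_carrier[OF T'(1)] in auto)

section \<open>The Cayley transform of \<open>U\<close>\<close>

text \<open>Opposite to the type of the Gram matrix: the symplectic Lie algebra corresponds to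
  symmetric forms, an orthogonal one to alternating forms.\<close>

definition form_sign :: "gtype \<Rightarrow> 'a::field" where
  "form_sign T = (if T = Symplectic then 1 else - 1)"

text \<open>The nonzero entry in row i of the Gram matrix, which is a signed permutation matrix
  supported on the antidiagonal.\<close>

definition gram_sign :: "gtype \<Rightarrow> nat \<Rightarrow> nat \<Rightarrow> 'a::field" where
  "gram_sign T n i = (if T = Symplectic \<and> n \<le> i then - 1 else 1)"

lemma form_sign_square: "form_sign T * form_sign T = (1::'a::field)"
  by (simp add: form_sign_def)

lemma gram_sign_square: "gram_sign T n i * gram_sign T n i = (1::'a::field)"
  by (simp add: gram_sign_def)

lemma gram_sign_opposite:
  "i < mdim T n \<Longrightarrow> gram_sign T n (mdim T n - 1 - i) = - form_sign T * (gram_sign T n i :: 'a::field)"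
  by (auto simp: gram_sign_def form_sign_def mdim_def rdim_def)

section \<open>Multiplication by the Gram matrix\<close>

lemma gram_index:
  assumes "i < mdim T n" "j < mdim T n"
  shows "gram T n $$ (i, j) = (if i + j + 1 = mdim T n then gram_sign T n i else (0::'a::field))"
  using assms by (auto simp: gram_def gram_sign_def antidiag_def mdim_def rdim_def)

lemma mult_gram_transpose_index:
  fixes X :: "'a::field mat"
  assumes X: "X \<in> carrier_mat (mdim T n) (mdim T n)" and ij: "i < mdim T n" "j < mdim T n"
  shows "(X * (gram T n)\<^sup>T) $$ (i, j) = gram_sign T n j * X $$ (i, mdim T n - 1 - j)"
proof -
  let ?m = "mdim T n"
  have "(X * (gram T n)\<^sup>T) $$ (i, j) = (\<Sum>k<?m. X $$ (i, k) * gram T n $$ (j, k))"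
    using mult_index[of X ?m "(gram T n)\<^sup>T" i j] X ij gram_carrier[of T n, where 'a='a] by simp
  also have "\<dots> = (\<Sum>k<?m. if k = ?m - 1 - j then X $$ (i, ?m - 1 - j) * gram_sign T n j else 0)"
    by (rule sum.cong) (use ij in \<open>auto simp: gram_index\<close>)
  finally show ?thesis using ij by (simp add: mult.commute)
qed

lemma gram_mult_index:
  fixes X :: "'a::field mat"
  assumes X: "X \<in> carrier_mat (mdim T n) (mdim T n)" and ij: "i < mdim T n" "j < mdim T n"
  shows "(gram T n * X) $$ (i, j) = gram_sign T n i * X $$ (mdim T n - 1 - i, j)"
proof -
  let ?m = "mdim T n"
  have "(gram T n * X) $$ (i, j) = (\<Sum>k<?m. gram T n $$ (i, k) * X $$ (k, j))"
    using mult_index[of "gram T n" ?m X i j] X ij gram_carrier[of T n, where 'a='a] by simp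
  also have "\<dots> = (\<Sum>k<?m. if k = ?m - 1 - i then gram_sign T n i * X $$ (?m - 1 - i, j) else 0)"
    by (rule sum.cong) (use ij in \<open>auto simp: gram_index\<close>)
  finally show ?thesis using ij by simp
qed

lemma transpose_mult_gram_index:
  fixes X :: "'a::field mat"
  assumes X: "X \<in> carrier_mat (mdim T n) (mdim T n)" and ij: "i < mdim T n" "j < mdim T n"
  shows "(X\<^sup>T * gram T n) $$ (i, j) =
    gram_sign T n (mdim T n - 1 - j) * X $$ (mdim T n - 1 - j, i)"
proof -
  let ?m = "mdim T n"
  have "(X\<^sup>T * gram T n) $$ (i, j) = (\<Sum>k<?m. X $$ (k, i) * gram T n $$ (k, j))"
    using mult_index[of "X\<^sup>T" ?m "gram T n" i j] X ij gram_carrier[of T n, where 'a='a] by simp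
  also have "\<dots> = (\<Sum>k<?m. if k = ?m - 1 - j then X $$ (?m - 1 - j, i) * gram_sign T n (?m - 1 - j) else 0)"
    by (rule sum.cong) (use ij in \<open>auto simp: gram_index\<close>)
  finally show ?thesis using ij by (simp add: mult.commute)
qed

lemma gram_orthogonal:
  "gram T n * (gram T n)\<^sup>T = (1\<^sub>m (mdim T n) :: 'a::field mat)" (is ?A)
  "(gram T n)\<^sup>T * gram T n = (1\<^sub>m (mdim T n) :: 'a::field mat)" (is ?C)
proof -
  let ?m = "mdim T n" and ?B = "gram T n :: 'a mat"
  note Bc = gram_carrier[of T n, where 'a='a]
  show A: ?A
  proof (rule eq_matI)
    fix i j assume "i < dim_row (1\<^sub>m ?m :: 'a mat)" "j < dim_col (1\<^sub>m ?m :: 'a mat)"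
    then have ij: "i < ?m" "j < ?m" by auto
    show "(?B * ?B\<^sup>T) $$ (i, j) = 1\<^sub>m ?m $$ (i, j)"
      unfolding mult_gram_transpose_index[OF Bc ij]
      using ij by (auto simp: gram_index gram_sign_square)
  qed (use Bc in auto)
  show ?C using mat_mult_left_right_inverse[OF Bc _ A] Bc by simp
qed

lemma U_iff:
  fixes u :: "'a::field mat"
  shows "u \<in> carrier (U T n) \<longleftrightarrow>
    u \<in> unitriangular (mdim T n) \<and> u\<^sup>T * gram T n * u = gram T n"
  using unitriangular_in_GL by (auto simp: U_def classical_group_def)

lemma U_unitriangular: "u \<in> carrier (U T n) \<Longrightarrow> u \<in> unitriangular (mdim T n)"
  by (simp add: U_iff)

lemma finite_U: "finite (carrier (U T n :: 'a::{field,finite} mat monoid))"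
  by (rule finite_subset[OF _ finite_unitriangular]) (auto simp: U_iff)

lemma U_simps: "x \<otimes>\<^bsub>U T n\<^esub> y = x * y" "\<one>\<^bsub>U T n\<^esub> = 1\<^sub>m (mdim T n)"
  by (simp_all add: U_def GL_simps)

lemma U_inv:
  fixes z :: "'a::field mat"
  assumes "z \<in> carrier (U T n)"
  shows "inv\<^bsub>U T n\<^esub> z = inv\<^bsub>GL (mdim T n)\<^esub> z"
proof -
  have "U T n = (GL (mdim T n) :: 'a mat monoid)\<lparr>carrier := carrier (U T n)\<rparr>" by (simp add: U_def)
  then show ?thesis using group.m_inv_consistent[OF group_GL subgroup_U assms] by metis
qed

text \<open>The isometry condition, solved for the inverse. It is the identity that turns
  conjugation by z into congruence.\<close>

lemma U_inverse_gram:
  fixes z :: "'a::field mat"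
  assumes z: "z \<in> carrier (U T n)"
  shows "inv\<^bsub>GL (mdim T n)\<^esub> z * (gram T n)\<^sup>T = (gram T n)\<^sup>T * z\<^sup>T"
proof -
  let ?m = "mdim T n" and ?B = "gram T n :: 'a mat" and ?i = "inv\<^bsub>GL (mdim T n)\<^esub> z"
  have zu: "z \<in> unitriangular ?m" and zB: "z\<^sup>T * ?B * z = ?B" using z by (auto simp: U_iff)
  note zi = unitriangular_inv[OF zu]
  note c = unitriangular_carrier[OF zu] unitriangular_carrier[OF zi(1)] gram_carrier[of T n, where 'a='a]
  note assoc = assoc_mult_mat[of _ ?m ?m _ ?m _ ?m]
  have e: "?B * ?i = z\<^sup>T * ?B"
  proof -
    have "?B * ?i = z\<^sup>T * ?B * z * ?i" by (simp add: zB)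
    also have "\<dots> = z\<^sup>T * ?B" using c zi(2) by (simp add: assoc)
    finally show ?thesis .
  qed
  have "?i * ?B\<^sup>T = ?B\<^sup>T * ?B * ?i * ?B\<^sup>T"
    using c by (simp add: gram_orthogonal)
  also have "\<dots> = ?B\<^sup>T * (?B * ?i) * ?B\<^sup>T" using c by (simp add: assoc)
  also have "\<dots> = ?B\<^sup>T * z\<^sup>T * (?B * ?B\<^sup>T)"
    unfolding e using c by (simp add: assoc)
  also have "\<dots> = ?B\<^sup>T * z\<^sup>T" using c by (simp add: gram_orthogonal)
  finally show ?thesis .
qed

section \<open>The transform, its bijectivity and equivariance\<close>

definition half_sum :: "nat \<Rightarrow> 'a::field mat \<Rightarrow> 'a mat" where
  "half_sum m u = mat m m (\<lambda>(i, j). (of_bool (i = j) + u $$ (i, j)) / 2)"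

text \<open>The first factor equals (u - 1)(u + 1)^-1. Writing it through \<open>half_sum\<close>,
  whose diagonal is 1 for unitriangular u, keeps the inverse inside the unitriangular group.\<close>

definition cayley :: "gtype \<Rightarrow> nat \<Rightarrow> 'a::field mat \<Rightarrow> 'a mat" where
  "cayley T n u = (1\<^sub>m (mdim T n) - inv\<^bsub>GL (mdim T n)\<^esub> (half_sum (mdim T n) u)) * (gram T n)\<^sup>T"

lemma half_sum_unitriangular:
  assumes "(2::'a::field) \<noteq> 0" "(u::'a mat) \<in> unitriangular m"
  shows "half_sum m u \<in> unitriangular m"
  using assms by (auto intro!: unitriangularI simp: half_sum_def unitriangular_index)

lemma half_sum_double:
  fixes u :: "'a::field mat"
  assumes two: "(2::'a) \<noteq> 0" and u: "u \<in> carrier_mat m m"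
  shows "u = half_sum m u + half_sum m u - 1\<^sub>m m"
proof -
  have half: "x / 2 + x / 2 = x" for x :: 'a
    using two by (metis mult_2 nonzero_mult_div_cancel_left times_divide_eq_right)
  show ?thesis
    using u by (intro eq_matI) (auto simp: half_sum_def half)
qed

lemma half_sum_of_double:
  fixes h :: "'a::field mat"
  assumes "(2::'a) \<noteq> 0" "h \<in> carrier_mat m m"
  shows "half_sum m (h + h - 1\<^sub>m m) = h"
  using assms by (intro eq_matI) (auto simp: half_sum_def)

text \<open>Up to signs, multiplication by the transposed Gram matrix reverses the columns: strictly
  upper triangular becomes strictly above the antidiagonal, and skewness for the Gram matrix becomes
  the symmetry type \<open>form_sign T\<close>.\<close>

lemma corner_forms_gram_iff:
  fixes y :: "'a::field mat"
  assumes y: "y \<in> carrier_mat (mdim T n) (mdim T n)"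
  shows "y * (gram T n)\<^sup>T \<in> corner_forms (form_sign T) (mdim T n) \<longleftrightarrow>
     (\<forall>i<mdim T n. \<forall>j\<le>i. y $$ (i, j) = 0) \<and>
     y\<^sup>T * gram T n + gram T n * y = 0\<^sub>m (mdim T n) (mdim T n)"
proof -
  let ?m = "mdim T n" and ?B = "gram T n :: 'a mat" and ?g = "gram_sign T n :: nat \<Rightarrow> 'a"
  let ?S = "y * ?B\<^sup>T"
  note Bc = gram_carrier[of T n, where 'a='a]
  note S = mult_gram_transpose_index[OF y]
  have gnz: "?g i \<noteq> 0" for i by (simp add: gram_sign_def)
  have zero: "(\<forall>i<?m. \<forall>j<?m. ?m \<le> i + j + 1 \<longrightarrow> ?S $$ (i, j) = 0) \<longleftrightarrow> (\<forall>i<?m. \<forall>j\<le>i. y $$ (i, j) = 0)"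
  proof (intro iffI allI impI)
    fix i j assume *: "\<forall>i<?m. \<forall>j<?m. ?m \<le> i + j + 1 \<longrightarrow> ?S $$ (i, j) = 0" and ij: "i < ?m" "j \<le> i"
    then have "?S $$ (i, ?m - 1 - j) = 0" by auto
    then show "y $$ (i, j) = 0" using S[of i "?m - 1 - j"] ij gnz by simp
  next
    fix i j assume *: "\<forall>i<?m. \<forall>j\<le>i. y $$ (i, j) = 0" and ij: "i < ?m" "j < ?m" "?m \<le> i + j + 1"
    then have "y $$ (i, ?m - 1 - j) = 0" by auto
    then show "?S $$ (i, j) = 0" using S[OF ij(1,2)] by simp
  qed
  have entry: "(y\<^sup>T * ?B + ?B * y) $$ (?m - 1 - i, ?m - 1 - j) = 0 \<longleftrightarrow>
      ?S $$ (j, i) = form_sign T * ?S $$ (i, j)" if ij: "i < ?m" "j < ?m" for i j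
  proof -
    have lt: "?m - 1 - i < ?m" "?m - 1 - j < ?m" using ij by auto
    have "(y\<^sup>T * ?B + ?B * y) $$ (?m - 1 - i, ?m - 1 - j) =
       ?g j * y $$ (j, ?m - 1 - i) + ?g (?m - 1 - i) * y $$ (i, ?m - 1 - j)"
      using transpose_mult_gram_index[OF y lt] gram_mult_index[OF y lt] lt ij y Bc by simp
    also have "\<dots> = ?g j * ?g i * (?g i * y $$ (j, ?m - 1 - i) - form_sign T * (?g j * y $$ (i, ?m - 1 - j)))"
    proof -
      have "?g j * ?g i * (?g i * Y - form_sign T * (?g j * Z)) =
          (?g i * ?g i) * (?g j * Y) - form_sign T * (?g j * ?g j) * (?g i * Z)" for Y Z
        by (simp only: algebra_simps)
      then show ?thesis using gram_sign_opposite[OF ij(1), where 'a='a] by (simp add: gram_sign_square mult.assoc)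
    qed
    finally show ?thesis using gnz S[OF ij] S[OF ij(2,1)] by simp
  qed
  have sym: "(\<forall>i<?m. \<forall>j<?m. ?S $$ (j, i) = form_sign T * ?S $$ (i, j)) \<longleftrightarrow>
      y\<^sup>T * ?B + ?B * y = 0\<^sub>m ?m ?m"
  proof
    assume *: "\<forall>i<?m. \<forall>j<?m. ?S $$ (j, i) = form_sign T * ?S $$ (i, j)"
    show "y\<^sup>T * ?B + ?B * y = 0\<^sub>m ?m ?m"
    proof (rule eq_matI)
      fix i j assume "i < dim_row (0\<^sub>m ?m ?m :: 'a mat)" "j < dim_col (0\<^sub>m ?m ?m :: 'a mat)"
      then have ij: "i < ?m" "j < ?m" by auto
      have "?m - 1 - i < ?m" "?m - 1 - j < ?m" using ij by auto
      then have "(y\<^sup>T * ?B + ?B * y) $$ (?m - 1 - (?m - 1 - i), ?m - 1 - (?m - 1 - j)) = 0"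
        using entry * by blast
      then show "(y\<^sup>T * ?B + ?B * y) $$ (i, j) = 0\<^sub>m ?m ?m $$ (i, j)"
        using ij by simp
    qed (use y Bc in auto)
  next
    assume *: "y\<^sup>T * ?B + ?B * y = 0\<^sub>m ?m ?m"
    show "\<forall>i<?m. \<forall>j<?m. ?S $$ (j, i) = form_sign T * ?S $$ (i, j)"
    proof (intro allI impI)
      fix i j assume ij: "i < ?m" "j < ?m"
      then have "?m - 1 - i < ?m" "?m - 1 - j < ?m" by auto
      then show "?S $$ (j, i) = form_sign T * ?S $$ (i, j)"
        using entry[OF ij] unfolding * by simp
    qed
  qed
  have "?S \<in> carrier_mat ?m ?m" using y Bc by simp
  then show ?thesis unfolding corner_forms_def using zero sym by blast
qed

lemma mat_sum_eq_diff_iff: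
  fixes A B C D :: "'a::field mat"
  assumes two: "(2::'a) \<noteq> 0" and c: "A \<in> carrier_mat m m" "B \<in> carrier_mat m m"
    "C \<in> carrier_mat m m" "D \<in> carrier_mat m m"
  shows "A + B + (C + D) = A - B - (C - D) \<longleftrightarrow> B + C = 0\<^sub>m m m"
proof -
  have el: "b + x + (z + e) = b - x - (z - e) \<longleftrightarrow> x + z = 0" for b x z e :: 'a
  proof -
    have "b + x + (z + e) = b - x - (z - e) \<longleftrightarrow> 2 * (x + z) = 0" by (simp add: algebra_simps)
    then show ?thesis using two by (simp del: distrib_left_numeral)
  qed
  have "A + B + (C + D) = A - B - (C - D) \<longleftrightarrow> (\<forall>i<m. \<forall>j<m. A $$ (i, j) + B $$ (i, j) + (C $$ (i, j) + D $$ (i, j)) =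
      A $$ (i, j) - B $$ (i, j) - (C $$ (i, j) - D $$ (i, j)))"
    using c by (auto simp: mat_eq_iff)
  also have "\<dots> \<longleftrightarrow> B + C = 0\<^sub>m m m"
    unfolding el using c by (auto simp: mat_eq_iff)
  finally show ?thesis .
qed

text \<open>With v the inverse of \<open>half_sum\<close> and y = 1 - v one has u v = 1 + y and v =
  1 - y. So u is an isometry iff 1 + y and 1 - y transform the Gram matrix B equally; the terms of
  even degree in y cancel and 2(y^T B + B y) = 0 remains.\<close>

lemma U_iff_half_sum:
  fixes u :: "'a::field mat"
  assumes two: "(2::'a) \<noteq> 0" and u: "u \<in> unitriangular (mdim T n)"
  shows "u \<in> carrier (U T n) \<longleftrightarrow> cayley T n u \<in> corner_forms (form_sign T) (mdim T n)"
proof -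
  let ?m = "mdim T n" and ?B = "gram T n :: 'a mat"
  define h where "h = half_sum ?m u"
  have h: "h \<in> unitriangular ?m" unfolding h_def by (rule half_sum_unitriangular[OF two u])
  define v where "v = inv\<^bsub>GL ?m\<^esub> h"
  have v: "v \<in> unitriangular ?m" "h * v = 1\<^sub>m ?m" "v * h = 1\<^sub>m ?m"
    using unitriangular_inv[OF h] by (simp_all add: v_def)
  define y where "y = 1\<^sub>m ?m - v"
  define w where "w = 1\<^sub>m ?m + y"
  note c = unitriangular_carrier[OF h] unitriangular_carrier[OF v(1)] gram_carrier[of T n, where 'a='a]
    unitriangular_carrier[OF u]
  have yc: "y \<in> carrier_mat ?m ?m" unfolding y_def using c(2) by (rule minus_carrier_mat)
  have wc: "w \<in> carrier_mat ?m ?m" unfolding w_def using yc by simp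
  note assoc = assoc_mult_mat[of _ ?m ?m _ ?m _ ?m]
  have v_eq: "v = 1\<^sub>m ?m - y" unfolding y_def using c(2) by (intro eq_matI) auto
  have uh: "u = h + h - 1\<^sub>m ?m"
    unfolding h_def by (rule half_sum_double[OF two c(4)])
  have uv: "u * v = w"
  proof -
    have "u * v = h * v + h * v - v"
      unfolding uh using c by (simp add: minus_mult_distrib_mat[of _ ?m ?m] add_mult_distrib_mat[of _ ?m ?m])
    then show ?thesis unfolding v(2) w_def y_def using c by (intro eq_matI) auto
  qed
  have uB: "u\<^sup>T * ?B * u \<in> carrier_mat ?m ?m" using c by simp
  have low: "\<forall>i<?m. \<forall>j\<le>i. y $$ (i, j) = 0"
    using c(2) by (auto simp: y_def unitriangular_index[OF v(1)])
  have "u\<^sup>T * ?B * u = ?B \<longleftrightarrow> w\<^sup>T * ?B * w = v\<^sup>T * ?B * v"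
  proof
    assume *: "u\<^sup>T * ?B * u = ?B"
    have "w\<^sup>T * ?B * w = v\<^sup>T * (u\<^sup>T * ?B * u) * v"
      unfolding uv[symmetric] transpose_mult[OF c(4,2)] using c by (simp add: assoc)
    then show "w\<^sup>T * ?B * w = v\<^sup>T * ?B * v" by (simp add: *)
  next
    assume *: "w\<^sup>T * ?B * w = v\<^sup>T * ?B * v"
    have wh: "w * h = u" unfolding uv[symmetric] using c v(3) by (simp add: assoc)
    have "u\<^sup>T * ?B * u = h\<^sup>T * (w\<^sup>T * ?B * w) * h"
      unfolding wh[symmetric] transpose_mult[OF wc c(1)] using c wc by (simp add: assoc)
    also have "\<dots> = (v * h)\<^sup>T * ?B * (v * h)"
      unfolding * transpose_mult[OF c(2,1)] using c by (simp add: assoc)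
    also have "\<dots> = ?B" unfolding v(3) using c by simp
    finally show "u\<^sup>T * ?B * u = ?B" .
  qed
  also have "\<dots> \<longleftrightarrow> y\<^sup>T * ?B + ?B * y = 0\<^sub>m ?m ?m"
  proof -
    have tw: "w\<^sup>T = 1\<^sub>m ?m + y\<^sup>T"
      unfolding w_def using yc by (intro eq_matI) auto
    have tv: "v\<^sup>T = 1\<^sub>m ?m - y\<^sup>T"
      unfolding v_eq using yc by (intro eq_matI) auto
    let ?C = "y\<^sup>T * ?B" and ?D = "?B * y" and ?E = "y\<^sup>T * ?B * y"
    have cc: "?C \<in> carrier_mat ?m ?m" "?D \<in> carrier_mat ?m ?m" "?E \<in> carrier_mat ?m ?m"
      using yc c by auto
    have l: "w\<^sup>T * ?B * w = ?B + ?C + (?D + ?E)"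
    proof -
      have "w\<^sup>T * ?B = ?B + ?C"
        unfolding tw using yc c by (simp add: add_mult_distrib_mat[of _ ?m ?m])
      then have "w\<^sup>T * ?B * w = (?B + ?C) * 1\<^sub>m ?m + (?B + ?C) * y"
        unfolding w_def using yc c cc by (simp add: mult_add_distrib_mat[of _ ?m ?m _ ?m])
      then show ?thesis using yc c cc by (simp add: add_mult_distrib_mat[of _ ?m ?m])
    qed
    have r: "v\<^sup>T * ?B * v = ?B - ?C - (?D - ?E)"
    proof -
      have "v\<^sup>T * ?B = ?B - ?C"
        unfolding tv using yc c by (simp add: minus_mult_distrib_mat[of _ ?m ?m])
      then have "v\<^sup>T * ?B * v = (?B - ?C) * 1\<^sub>m ?m - (?B - ?C) * y"
        unfolding v_eq using yc minus_carrier_mat[OF cc(1), of ?B]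
        by (simp add: mult_minus_distrib_mat[of _ ?m ?m _ ?m])
      then show ?thesis using yc c cc by (simp add: minus_mult_distrib_mat[of _ ?m ?m])
    qed
    show ?thesis unfolding l r by (rule mat_sum_eq_diff_iff[OF two c(3) cc])
  qed
  finally show ?thesis
    using corner_forms_gram_iff[OF yc] low u unfolding U_iff cayley_def y_def v_def h_def by blast
qed

lemma cayley_bij:
  assumes two: "(2::'a::field) \<noteq> 0"
  shows "bij_betw (cayley T n) (carrier (U T n :: 'a mat monoid)) (corner_forms (form_sign T) (mdim T n))"
proof -
  let ?m = "mdim T n" and ?B = "gram T n :: 'a mat"
  note Bc = gram_carrier[of T n, where 'a='a]
  interpret GL: group "GL ?m :: 'a mat monoid" by (rule group_GL)
  have inj: "inj_on (cayley T n) (carrier (U T n :: 'a mat monoid))"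
  proof
    fix u u' :: "'a mat" assume u: "u \<in> carrier (U T n)" "u' \<in> carrier (U T n)"
      and eq: "cayley T n u = cayley T n u'"
    note uu = u[THEN U_unitriangular]
    define h h' where "h = half_sum ?m u" and "h' = half_sum ?m u'"
    have h: "h \<in> unitriangular ?m" "h' \<in> unitriangular ?m"
      unfolding h_def h'_def using half_sum_unitriangular[OF two] uu by auto
    let ?v = "inv\<^bsub>GL ?m\<^esub> h" and ?v' = "inv\<^bsub>GL ?m\<^esub> h'"
    have vc: "?v \<in> carrier_mat ?m ?m" "?v' \<in> carrier_mat ?m ?m"
      using unitriangular_inv(1)[OF h(1)] unitriangular_inv(1)[OF h(2)] by (auto intro: unitriangular_carrier)
    have yc: "1\<^sub>m ?m - ?v \<in> carrier_mat ?m ?m" "1\<^sub>m ?m - ?v' \<in> carrier_mat ?m ?m"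
      using vc by (auto intro: minus_carrier_mat)
    have "(1\<^sub>m ?m - ?v) * ?B\<^sup>T * ?B = (1\<^sub>m ?m - ?v') * ?B\<^sup>T * ?B"
      using eq by (simp add: cayley_def h_def h'_def)
    then have y: "1\<^sub>m ?m - ?v = 1\<^sub>m ?m - ?v'"
      using mult_right_cancel_mat[OF _ Bc _ gram_orthogonal(2)] yc Bc by simp
    have "?v = ?v'"
    proof (rule eq_matI)
      fix i j assume "i < dim_row ?v'" "j < dim_col ?v'"
      then show "?v $$ (i, j) = ?v' $$ (i, j)" using arg_cong[OF y, of "\<lambda>A. A $$ (i, j)"] vc by auto
    qed (use vc in auto)
    then have "h = h'"
      using h[THEN unitriangular_in_GL] by (metis GL.inv_inv)
    show "u = u'"
    proof (rule eq_matI)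
      fix i j assume "i < dim_row u'" "j < dim_col u'"
      then have ij: "i < ?m" "j < ?m" using uu by (auto simp: unitriangular_def)
      have "h $$ (i, j) = h' $$ (i, j)" using \<open>h = h'\<close> by simp
      then show "u $$ (i, j) = u' $$ (i, j)" using ij two by (simp add: h_def h'_def half_sum_def)
    qed (use uu in \<open>auto simp: unitriangular_def\<close>)
  qed
  have surj: "S \<in> cayley T n ` carrier (U T n)" if S: "S \<in> corner_forms (form_sign T) ?m" for S :: "'a mat"
  proof -
    note Sc = corner_forms_carrier[OF S]
    \<comment> \<open>The Gram matrix is orthogonal, so this undoes the last factor of
      \<open>cayley\<close>; solving the fraction for u then gives 2 (1 - y)^-1 - 1.\<close>
    define y where "y = S * ?B"
    have yc: "y \<in> carrier_mat ?m ?m" using Sc Bc by (simp add: y_def)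
    have yB: "y * ?B\<^sup>T = S"
      unfolding y_def using mult_right_cancel_mat[OF Bc _ Sc gram_orthogonal(1)] Bc by simp
    have low: "\<forall>i<?m. \<forall>j\<le>i. y $$ (i, j) = 0"
      using corner_forms_gram_iff[OF yc] S unfolding yB by blast
    define v where "v = 1\<^sub>m ?m - y"
    have v: "v \<in> unitriangular ?m"
    proof (rule unitriangularI)
      show "v \<in> carrier_mat ?m ?m" unfolding v_def using yc by (rule minus_carrier_mat)
      fix i j assume "i < ?m" "j \<le> i"
      then show "v $$ (i, j) = (if i = j then 1 else 0)" using low yc by (auto simp: v_def)
    qed
    define h where "h = inv\<^bsub>GL ?m\<^esub> v"
    have h: "h \<in> unitriangular ?m" unfolding h_def by (rule unitriangular_inv(1)[OF v])
    have hv: "inv\<^bsub>GL ?m\<^esub> h = v"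
      unfolding h_def using unitriangular_in_GL[OF v] by (rule GL.inv_inv)
    define u where "u = h + h - 1\<^sub>m ?m"
    have u: "u \<in> unitriangular ?m"
      using unitriangular_carrier[OF h]
      by (auto intro!: unitriangularI minus_carrier_mat simp: u_def unitriangular_index[OF h])
    have hs: "half_sum ?m u = h"
      unfolding u_def by (rule half_sum_of_double[OF two unitriangular_carrier[OF h]])
    have "1\<^sub>m ?m - v = y" unfolding v_def using yc by (intro eq_matI) auto
    then have "cayley T n u = S" by (simp add: cayley_def hs hv yB)
    then show ?thesis using U_iff_half_sum[OF two u] S by blast
  qed
  show ?thesis
    unfolding bij_betw_def using inj surj U_iff_half_sum[OF two] U_unitriangular by blast
qed

lemma cayley_corner_forms:
  assumes "(2::'a::field) \<noteq> 0" "(u::'a mat) \<in> carrier (U T n)"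
  shows "cayley T n u \<in> corner_forms (form_sign T) (mdim T n)"
  using U_iff_half_sum[OF assms(1) U_unitriangular[OF assms(2)]] assms(2) by simp

lemma cayley_one:
  assumes "(2::'a::field) \<noteq> 0"
  shows "cayley T n (1\<^sub>m (mdim T n) :: 'a mat) = 0\<^sub>m (mdim T n) (mdim T n)"
proof -
  let ?m = "mdim T n"
  interpret GL: group "GL ?m :: 'a mat monoid" by (rule group_GL)
  have "half_sum ?m (1\<^sub>m ?m :: 'a mat) = 1\<^sub>m ?m"
    using assms by (intro eq_matI) (auto simp: half_sum_def)
  moreover have "inv\<^bsub>GL ?m\<^esub> (1\<^sub>m ?m :: 'a mat) = 1\<^sub>m ?m" using GL.inv_one by (simp add: GL_simps)
  moreover have "(1\<^sub>m ?m - 1\<^sub>m ?m) * (gram T n)\<^sup>T = (0\<^sub>m ?m ?m :: 'a mat)"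
    using gram_carrier[of T n, where 'a='a] by (simp add: minus_r_inv_mat[of _ ?m ?m])
  ultimately show ?thesis by (simp add: cayley_def)
qed

text \<open>Conjugation commutes with \<open>half_sum\<close> and with inversion;
  \<open>U_inverse_gram\<close> then moves the inverse of z across the Gram matrix, where it becomes
  the transpose of z.\<close>

lemma cayley_conj:
  fixes u :: "'a::field mat"
  assumes two: "(2::'a) \<noteq> 0" and u: "u \<in> carrier (U T n)" and z: "z \<in> carrier (U T n)"
  shows "cayley T n (z * u * inv\<^bsub>GL (mdim T n)\<^esub> z) = z * cayley T n u * z\<^sup>T"
proof -
  let ?m = "mdim T n" and ?B = "gram T n :: 'a mat"
  interpret GL: group "GL ?m :: 'a mat monoid" by (rule group_GL)
  let ?i = "inv\<^bsub>GL ?m\<^esub> z"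
  note uu = U_unitriangular[OF u] and zu = U_unitriangular[OF z]
  note zi = unitriangular_inv[OF zu]
  define h where "h = half_sum ?m u"
  have h: "h \<in> unitriangular ?m" unfolding h_def by (rule half_sum_unitriangular[OF two uu])
  define v where "v = inv\<^bsub>GL ?m\<^esub> h"
  have v: "v \<in> unitriangular ?m" unfolding v_def by (rule unitriangular_inv(1)[OF h])
  note c = unitriangular_carrier[OF uu] unitriangular_carrier[OF zu] unitriangular_carrier[OF zi(1)]
    unitriangular_carrier[OF h] unitriangular_carrier[OF v] gram_carrier[of T n, where 'a='a]
  note assoc = assoc_mult_mat[of _ ?m ?m _ ?m _ ?m]
  have uh: "u = h + h - 1\<^sub>m ?m"
    unfolding h_def by (rule half_sum_double[OF two c(1)])
  have "z * u = z * h + z * h - z"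
    unfolding uh using c by (simp add: mult_minus_distrib_mat[of _ ?m ?m _ ?m] mult_add_distrib_mat[of _ ?m ?m _ ?m])
  then have e: "z * u * ?i = z * h * ?i + z * h * ?i - 1\<^sub>m ?m"
    using c zi(2) by (simp add: minus_mult_distrib_mat[of _ ?m ?m] add_mult_distrib_mat[of _ ?m ?m])
  have zhc: "z * h * ?i \<in> carrier_mat ?m ?m" using c by simp
  have hs: "half_sum ?m (z * u * ?i) = z * h * ?i"
    unfolding e by (rule half_sum_of_double[OF two zhc])
  have iv: "inv\<^bsub>GL ?m\<^esub> (z * h * ?i) = z * v * ?i"
    using GL.inv_mult_group[of "z * h" ?i] GL.inv_mult_group[of z h] GL.inv_inv[of z]
      GL.m_closed[of z h] GL.inv_closed[of z] unitriangular_in_GL[OF zu] unitriangular_in_GL[OF h] c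
    by (simp add: GL_simps v_def assoc)
  have "(1\<^sub>m ?m - z * v * ?i) = z * (1\<^sub>m ?m - v) * ?i"
    using c zi(2) by (simp add: minus_mult_distrib_mat[of _ ?m ?m] mult_minus_distrib_mat[of _ ?m ?m _ ?m])
  then have "cayley T n (z * u * ?i) = z * (1\<^sub>m ?m - v) * ?i * ?B\<^sup>T"
    by (simp add: cayley_def hs iv)
  also have "\<dots> = z * (1\<^sub>m ?m - v) * (?i * ?B\<^sup>T)"
    using c minus_carrier_mat[OF c(5), of "1\<^sub>m ?m"] by (simp add: assoc)
  also have "\<dots> = z * ((1\<^sub>m ?m - v) * ?B\<^sup>T) * z\<^sup>T"
    unfolding U_inverse_gram[OF z] using c minus_carrier_mat[OF c(5), of "1\<^sub>m ?m"] by (simp add: assoc)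
  finally show ?thesis by (simp add: cayley_def v_def h_def)
qed

section \<open>Elementary characters\<close>

lemma unitriangular_mult_row_zero:
  assumes g: "g \<in> unitriangular m" and h: "h \<in> unitriangular m" and a: "a < m" and K: "K \<le> m"
    and g0: "\<And>k. a < k \<Longrightarrow> k < K \<Longrightarrow> g $$ (a, k) = 0" and k: "a < k" "k < K"
  shows "(g * h) $$ (a, k) = h $$ (a, k)"
proof -
  have km: "k < m" using k K by simp
  have "(g * h) $$ (a, k) = (\<Sum>l<m. g $$ (a, l) * h $$ (l, k))"
    using mult_index[OF unitriangular_carrier[OF g] unitriangular_carrier[OF h] a km] .
  also have "\<dots> = (\<Sum>l<m. if l = a then h $$ (a, k) else 0)"
  proof (rule sum.cong[OF refl])
    fix l assume "l \<in> {..<m}"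
    then show "g $$ (a, l) * h $$ (l, k) = (if l = a then h $$ (a, k) else 0)"
      using unitriangular_index[OF g a, of l] unitriangular_index[OF h, of l k] g0[of l] k
      by (cases l a rule: linorder_cases; cases "l < K") auto
  qed
  finally show ?thesis using a by simp
qed

lemma unitriangular_inv_row_zero:
  fixes g :: "'a::field mat"
  assumes g: "g \<in> unitriangular m" and a: "a < m" and K: "K \<le> m"
    and g0: "\<And>k. a < k \<Longrightarrow> k < K \<Longrightarrow> g $$ (a, k) = 0" and k: "a < k" "k < K"
  shows "(inv\<^bsub>GL m\<^esub> g) $$ (a, k) = 0"
  using unitriangular_mult_row_zero[OF g unitriangular_inv(1)[OF g] a K g0 k] unitriangular_inv(2)[OF g] k K
  by simp

text \<open>Subgroups of the full unitriangular group, not of \<open>U\<close>; with the parameters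
  \<open>root_fst\<close>, \<open>root_snd\<close> and \<open>root_cut\<close> of a root, the meet
  with \<open>U\<close> is \<open>U_root\<close>. The bounds K and m - K are complementary because a
  zero of u in column k corresponds to one of its form in column m - 1 - k.\<close>

definition row_subgroup :: "nat \<Rightarrow> nat \<Rightarrow> nat \<Rightarrow> nat \<Rightarrow> 'a::field mat set" where
  "row_subgroup m a b K = {g \<in> unitriangular m.
     (\<forall>k. a < k \<and> k < K \<longrightarrow> g $$ (a, k) = 0) \<and> (\<forall>k. b < k \<and> k < m - K \<longrightarrow> g $$ (b, k) = 0)}"

lemma row_subgroup_unitriangular: "g \<in> row_subgroup m a b K \<Longrightarrow> g \<in> unitriangular m"
  by (simp add: row_subgroup_def)

lemma row_subgroup_swap: "K \<le> m \<Longrightarrow> row_subgroup m b a (m - K) = row_subgroup m a b K"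
  by (auto simp: row_subgroup_def)

lemma row_subgroup_mult:
  assumes "a < m" "b < m" "K \<le> m" "g \<in> row_subgroup m a b K" "h \<in> row_subgroup m a b K"
  shows "g * h \<in> row_subgroup m a b K"
  using assms unitriangular_mult_row_zero[of g m h a K] unitriangular_mult_row_zero[of g m h b "m - K"]
    unitriangular_mult[of g m h]
  by (simp add: row_subgroup_def)

lemma row_subgroup_inv:
  assumes "a < m" "b < m" "K \<le> m" "g \<in> row_subgroup m a b K"
  shows "inv\<^bsub>GL m\<^esub> g \<in> row_subgroup m a b K"
  using assms unitriangular_inv_row_zero[of g m a K] unitriangular_inv_row_zero[of g m b "m - K"]
    unitriangular_inv(1)[of g m]
  by (simp add: row_subgroup_def)

lemma row_subgroup_subgroup:
  assumes "a < m" "b < m" "K \<le> m"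
  shows "subgroup (row_subgroup m a b K) (GL m :: 'a::field mat monoid)"
proof (rule subgroup.intro)
  show "row_subgroup m a b K \<subseteq> carrier (GL m :: 'a mat monoid)"
    using row_subgroup_unitriangular unitriangular_in_GL by blast
  show "\<one>\<^bsub>GL m\<^esub> \<in> (row_subgroup m a b K :: 'a mat set)"
    using assms by (auto simp: row_subgroup_def GL_simps one_unitriangular)
qed (use row_subgroup_mult[OF assms] row_subgroup_inv[OF assms] in \<open>auto simp: GL_simps\<close>)

lemma finite_row_subgroup: "finite (row_subgroup m a b K :: 'a::{field,finite} mat set)"
  by (rule finite_subset[OF _ finite_unitriangular[of m]]) (auto simp: row_subgroup_def)

text \<open>If row a of S ends at column d, this entry is the same for all q in the subgroup: every
  other contribution is killed by triangularity, by the zeros in row a of q, by the support of S, or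
  by the choice of d.\<close>

lemma row_subgroup_congr_index:
  fixes q :: "'a::field mat"
  assumes S: "S \<in> corner_forms \<sigma> m" and K: "a < K" "K \<le> m"
    and q: "q \<in> row_subgroup m a b K" and d: "d < m" "m - K \<le> d"
    and dmax: "\<And>l. d < l \<Longrightarrow> l < m \<Longrightarrow> S $$ (a, l) = 0"
  shows "(q * S * q\<^sup>T) $$ (a, d) = S $$ (a, d)"
proof -
  have qu: "q \<in> unitriangular m" using q by (rule row_subgroup_unitriangular)
  have a: "a < m" using K by simp
  have q0: "q $$ (a, k) = 0" if "a < k" "k < K" for k using q that by (simp add: row_subgroup_def)
  have entry: "q $$ (a, k) * S $$ (k, l) * q $$ (d, l) = (if l = d then if k = a then S $$ (a, d) else 0 else 0)"
    if kl: "k < m" "l < m" for k l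
  proof -
    consider "l < d" | "k < a" | "a < k" "k < K" | "K \<le> k" "d \<le> l" | "k = a" "l = d" | "k = a" "d < l"
      by linarith
    then show ?thesis
    proof cases
      case 1 then show ?thesis using unitriangular_index[OF qu d(1), of l] by simp
    next
      case 2 then show ?thesis using unitriangular_index[OF qu a, of k] by simp
    next
      case 3 then show ?thesis using q0 by simp
    next
      case 4
      then have "m \<le> k + l + 1" using d by linarith
      then show ?thesis using corner_forms_zero[OF S kl] 4 K by auto
    next
      case 5
      then show ?thesis using unitriangular_index[OF qu d(1), of d] unitriangular_index[OF qu a, of a] by simp
    next
      case 6 then show ?thesis using dmax[of l] kl by simp
    qed
  qed
  have "(q * S * q\<^sup>T) $$ (a, d) = (\<Sum>k<m. \<Sum>l<m. q $$ (a, k) * S $$ (k, l) * q $$ (d, l))"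
    by (rule congr_index[OF unitriangular_carrier[OF qu] corner_forms_carrier[OF S] a d(1)])
  also have "\<dots> = (\<Sum>k<m. \<Sum>l<m. if l = d then if k = a then S $$ (a, d) else 0 else 0)"
    by (intro sum.cong refl) (use entry in auto)
  also have "\<dots> = S $$ (a, d)" using a d by simp
  finally show ?thesis .
qed

section \<open>Character sums over the row subgroups\<close>

definition transvec :: "nat \<Rightarrow> nat \<Rightarrow> nat \<Rightarrow> 'a::field \<Rightarrow> 'a mat" where
  "transvec m b d s = mat m m (\<lambda>(i, j). of_bool (i = j) + (if i = b \<and> j = d then s else 0))"

lemma transvec_carrier: "transvec m b d s \<in> carrier_mat m m"
  by (simp add: transvec_def)

lemma transvec_mult_index:
  assumes X: "X \<in> carrier_mat m m" and d: "d < m" and ij: "i < m" "j < m"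
  shows "(transvec m b d s * X) $$ (i, j) = X $$ (i, j) + (if i = b then s * X $$ (d, j) else 0)"
proof -
  have "(transvec m b d s * X) $$ (i, j) = (\<Sum>k<m. transvec m b d s $$ (i, k) * X $$ (k, j))"
    by (rule mult_index[OF transvec_carrier X ij])
  also have "\<dots> = (\<Sum>k<m. (if k = i then X $$ (i, j) else 0) + (if k = d then if i = b then s * X $$ (d, j) else 0 else 0))"
    by (rule sum.cong) (use ij in \<open>auto simp: transvec_def distrib_right\<close>)
  finally show ?thesis using ij d by (simp add: sum.distrib)
qed

lemma transvec_congr_index:
  fixes P :: "'a::field mat"
  assumes P: "P \<in> carrier_mat m m" and d: "d < m" and ij: "i < m" "j < m"
  shows "(transvec m b d s * P * (transvec m b d s)\<^sup>T) $$ (i, j) =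
    P $$ (i, j) + (if i = b then s * P $$ (d, j) else 0)
      + (if j = b then s * (P $$ (i, d) + (if i = b then s * P $$ (d, d) else 0)) else 0)"
proof -
  let ?E = "transvec m b d s"
  let ?X = "?E * P"
  have Xc: "?X \<in> carrier_mat m m" using P transvec_carrier[of m b d s] by simp
  have "(?X * ?E\<^sup>T) $$ (i, j) = (\<Sum>k<m. ?X $$ (i, k) * ?E $$ (j, k))"
    using mult_index[OF Xc, of "?E\<^sup>T" i j] transvec_carrier[of m b d s] ij
    by (simp del: index_mult_mat(1))
  also have "\<dots> = (\<Sum>k<m. (if k = j then ?X $$ (i, j) else 0) + (if k = d then if j = b then s * ?X $$ (i, d) else 0 else 0))"
    by (rule sum.cong) (use ij in \<open>auto simp: transvec_def distrib_left simp del: index_mult_mat(1)\<close>)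
  also have "\<dots> = ?X $$ (i, j) + (if j = b then s * ?X $$ (i, d) else 0)"
    using ij d by (simp add: sum.distrib del: index_mult_mat(1))
  finally show ?thesis
    using transvec_mult_index[OF P d ij, of b s] transvec_mult_index[OF P d ij(1) d, of b s] by simp
qed

lemma transvec_row_subgroup:
  assumes "a < m" "b < m" "K \<le> m" "b < d" "m - K \<le> d" "a = b \<longrightarrow> K \<le> d"
  shows "transvec m b d s \<in> row_subgroup m a b K"
  using assms
  by (auto simp: row_subgroup_def transvec_def intro!: unitriangularI)

text \<open>Let d be the last nonzero column of row a of S. Left multiplication by 1 + s E_bd
  preserves the subgroup and shifts the entry (a, b) by a multiple of s which, by the choice of d,
  does not depend on q. For suitable s the sum is thus multiplied by a number other than 1.\<close>

lemma sum_row_subgroup_zero: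
  fixes \<theta> :: "'a::{field,finite} \<Rightarrow> complex"
  assumes \<theta>: "linear_character_add \<theta>" "\<exists>a. \<theta> a \<noteq> 1" and two: "(2::'a) \<noteq> 0"
    and S: "S \<in> corner_forms \<sigma> m" and K: "a < K" "K \<le> m" "b < m - K"
    and ab: "a = b \<Longrightarrow> 2 * K = m \<and> \<sigma> = 1" and t: "t \<noteq> 0"
    and e: "e < m" "m - K \<le> e" "S $$ (a, e) \<noteq> 0"
  shows "(\<Sum>q\<in>row_subgroup m a b K. \<theta> (t * (q * S * q\<^sup>T) $$ (a, b))) = 0"
proof -
  let ?Q = "row_subgroup m a b K :: 'a mat set"
  define D where "D = {d. d < m \<and> m - K \<le> d \<and> S $$ (a, d) \<noteq> 0}"
  have finD: "finite D" by (simp add: D_def)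
  have "e \<in> D" using e by (simp add: D_def)
  define d where "d = Max D"
  have "d \<in> D" unfolding d_def using finD \<open>e \<in> D\<close> by (intro Max_in) auto
  then have d: "d < m" "m - K \<le> d" "S $$ (a, d) \<noteq> 0" by (simp_all add: D_def)
  have dmax: "S $$ (a, l) = 0" if "d < l" "l < m" for l
  proof (rule ccontr)
    assume "S $$ (a, l) \<noteq> 0"
    then have "l \<in> D" using that d by (simp add: D_def)
    then show False using Max_ge[OF finD, of l] that by (simp add: d_def)
  qed
  have am: "a < m" "b < m" using K by auto
  \<comment> \<open>For a = b the row and the column operation both hit the entry (a, a), so the
    shift doubles.\<close>
  define \<kappa> :: 'a where "\<kappa> = (if a = b then 2 else 1)"
  have "t * \<kappa> * S $$ (a, d) \<noteq> 0" using t two d by (simp add: \<kappa>_def)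
  then obtain s where s: "\<theta> (t * \<kappa> * S $$ (a, d) * s) \<noteq> 1"
    using linear_character_add_scale[OF \<theta>(2)] by blast
  let ?F = "\<lambda>q. \<theta> (t * (q * S * q\<^sup>T) $$ (a, b))"
  have E: "transvec m b d s \<in> ?Q" for s :: 'a
    using K d ab by (intro transvec_row_subgroup) auto
  have Sc: "S \<in> carrier_mat m m" by (rule corner_forms_carrier[OF S])
  have cancel: "transvec m b d x * (transvec m b d y * q) = q"
    if "q \<in> carrier_mat m m" "x + y = 0" for x y :: 'a and q
  proof (rule eq_matI)
    have bd: "b \<noteq> d" using K d by auto
    have c: "transvec m b d y * q \<in> carrier_mat m m" using transvec_carrier[of m b d y] that by simp
    fix i j assume "i < dim_row q" "j < dim_col q"
    then have ij: "i < m" "j < m" using that by auto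
    have "x * z = - (y * z)" for z using that(2) by (metis add_eq_0_iff2 minus_mult_left)
    then show "(transvec m b d x * (transvec m b d y * q)) $$ (i, j) = q $$ (i, j)"
      using transvec_mult_index[OF c d(1) ij, of b x] transvec_mult_index[OF that(1) d(1) ij, of b y]
        transvec_mult_index[OF that(1) d(1) d(1) ij(2), of b y] bd by simp
  qed (use that transvec_carrier[of m b d] in auto)
  have inverse: "transvec m b d (- s) * (transvec m b d s * q) = q"
    "transvec m b d s * (transvec m b d (- s) * q) = q" if "q \<in> ?Q" for q
    using cancel[OF unitriangular_carrier[OF row_subgroup_unitriangular[OF that]]] by simp_all
  have "(\<Sum>q\<in>?Q. ?F q) = (\<Sum>q\<in>?Q. ?F (transvec m b d s * q))"
    by (rule sum.reindex_bij_witness[of _ "\<lambda>q. transvec m b d s * q" "\<lambda>q. transvec m b d (- s) * q"])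
      (use row_subgroup_mult[OF am K(2) E] in \<open>simp_all only: inverse\<close>)
  also have "\<dots> = (\<Sum>q\<in>?Q. ?F q * \<theta> (t * \<kappa> * S $$ (a, d) * s))"
  proof (rule sum.cong[OF refl])
    fix q assume q: "q \<in> ?Q"
    let ?P = "q * S * q\<^sup>T"
    have qu: "q \<in> unitriangular m" using q by (rule row_subgroup_unitriangular)
    have P: "?P \<in> corner_forms \<sigma> m" by (rule corner_forms_congr[OF qu S])
    have Pad: "?P $$ (a, d) = S $$ (a, d)"
      by (rule row_subgroup_congr_index[OF S K(1,2) q d(1,2) dmax])
    have "(transvec m b d s * q) * S * (transvec m b d s * q)\<^sup>T =
      transvec m b d s * ?P * (transvec m b d s)\<^sup>T"
      by (rule congr_mult[symmetric, OF transvec_carrier unitriangular_carrier[OF qu] Sc])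
    moreover have "(transvec m b d s * ?P * (transvec m b d s)\<^sup>T) $$ (a, b) =
        ?P $$ (a, b) + \<kappa> * S $$ (a, d) * s"
    proof (cases "a = b")
      case True
      have "m \<le> d + d + 1" using d(2) ab[OF True] by linarith
      then have "?P $$ (d, d) = 0" by (rule corner_forms_zero[OF P d(1) d(1)])
      moreover have "?P $$ (d, a) = ?P $$ (a, d)" using corner_forms_sym[OF P am(1) d(1)] ab[OF True] by simp
      ultimately show ?thesis
        using transvec_congr_index[OF corner_forms_carrier[OF P] d(1) am, of b s] True Pad
        by (simp add: \<kappa>_def algebra_simps del: index_mult_mat(1))
    next
      case False
      then show ?thesis
        using transvec_congr_index[OF corner_forms_carrier[OF P] d(1) am, of b s] Pad
        by (simp add: \<kappa>_def mult.commute del: index_mult_mat(1))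
    qed
    ultimately have "t * ((transvec m b d s * q) * S * (transvec m b d s * q)\<^sup>T) $$ (a, b) =
        t * ?P $$ (a, b) + t * \<kappa> * S $$ (a, d) * s"
      by (simp only: distrib_left mult.assoc)
    then show "?F (transvec m b d s * q) = ?F q * \<theta> (t * \<kappa> * S $$ (a, d) * s)"
      using \<theta>(1) unfolding linear_character_add_def by metis
  qed
  also have "\<dots> = (\<Sum>q\<in>?Q. ?F q) * \<theta> (t * \<kappa> * S $$ (a, d) * s)"
    by (rule sum_distrib_right[symmetric])
  finally show ?thesis using s by simp
qed

text \<open>The average acts as a switch. Its linear conditions on S are those that
  \<open>row_subgroup_cayley_iff\<close> identifies, for Cayley images, with membership in the
  subgroup, so a linear character extended by zero is obtained as an average.\<close>

lemma sum_row_subgroup: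
  fixes \<theta> :: "'a::{field,finite} \<Rightarrow> complex"
  assumes \<theta>: "linear_character_add \<theta>" "\<exists>a. \<theta> a \<noteq> 1" and two: "(2::'a) \<noteq> 0" and \<sigma>: "\<sigma> * \<sigma> = 1"
    and S: "S \<in> corner_forms \<sigma> m" and K: "a < K" "K \<le> m" "b < m - K"
    and ab: "a = b \<Longrightarrow> 2 * K = m \<and> \<sigma> = 1" and t: "t \<noteq> 0"
  shows "(\<Sum>q\<in>row_subgroup m a b K. \<theta> (t * (q * S * q\<^sup>T) $$ (a, b))) =
    (if (\<forall>d<m. m - K \<le> d \<longrightarrow> S $$ (a, d) = 0) \<and> (\<forall>c<m. K \<le> c \<longrightarrow> S $$ (b, c) = 0)
     then of_nat (card (row_subgroup m a b K :: 'a mat set)) * \<theta> (t * S $$ (a, b)) else 0)"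
proof -
  let ?Q = "row_subgroup m a b K :: 'a mat set"
  have am: "a < m" "b < m" using K by auto
  have Sc: "S \<in> carrier_mat m m" by (rule corner_forms_carrier[OF S])
  consider (ad) e where "e < m" "m - K \<le> e" "S $$ (a, e) \<noteq> 0"
    | (bc) e where "e < m" "K \<le> e" "S $$ (b, e) \<noteq> 0"
    | (zero) "\<forall>d<m. m - K \<le> d \<longrightarrow> S $$ (a, d) = 0" "\<forall>c<m. K \<le> c \<longrightarrow> S $$ (b, c) = 0" by blast
  then show ?thesis
  proof cases
    case ad
    then show ?thesis using sum_row_subgroup_zero[OF \<theta> two S K ab t] by auto
  next
    case bc
    \<comment> \<open>Reduced to the previous case by exchanging a with b and K with m - K, at the
      cost of a factor \<sigma>.\<close>
    have mK: "m - (m - K) = K" using K by simp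
    have "\<sigma> \<noteq> 0" using \<sigma> by auto
    then have t': "t * \<sigma> \<noteq> 0" using t by simp
    have "(\<Sum>q\<in>?Q. \<theta> (t * (q * S * q\<^sup>T) $$ (a, b))) =
      (\<Sum>q\<in>row_subgroup m b a (m - K). \<theta> (t * \<sigma> * (q * S * q\<^sup>T) $$ (b, a)))"
      unfolding row_subgroup_swap[OF K(2)]
    proof (rule sum.cong[OF refl])
      fix q assume "q \<in> ?Q"
      then have P: "q * S * q\<^sup>T \<in> corner_forms \<sigma> m"
        by (intro corner_forms_congr[OF _ S] row_subgroup_unitriangular)
      show "\<theta> (t * (q * S * q\<^sup>T) $$ (a, b)) = \<theta> (t * \<sigma> * (q * S * q\<^sup>T) $$ (b, a))"
        using corner_forms_sym[OF P am(2,1)] by (simp only: mult.assoc)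
    qed
    also have "\<dots> = 0"
      using bc K mK ab by (intro sum_row_subgroup_zero[OF \<theta> two S _ _ _ _ t']) auto
    finally show ?thesis using bc by auto
  next
    case zero
    have "(q * S * q\<^sup>T) $$ (a, b) = S $$ (a, b)" if q: "q \<in> ?Q" for q
    proof -
      have qu: "q \<in> unitriangular m" using q by (rule row_subgroup_unitriangular)
      have entry: "q $$ (a, k) * S $$ (k, l) * q $$ (b, l) = (if l = b then if k = a then S $$ (a, b) else 0 else 0)"
        if kl: "k < m" "l < m" for k l
      proof -
        consider "k < a \<or> l < b" | "a < k" "k < K" | "b < l" "l < m - K" | "K \<le> k" "m - K \<le> l"
          | "k = a" "l = b" | "k = a" "m - K \<le> l" | "K \<le> k" "l = b"
          by linarith
        then show ?thesis
        proof cases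
          case 1
          then show ?thesis
            using unitriangular_index[OF qu am(2), of l] unitriangular_index[OF qu am(1), of k] by auto
        next
          case 2 then show ?thesis using q by (simp add: row_subgroup_def)
        next
          case 3 then show ?thesis using q by (simp add: row_subgroup_def)
        next
          case 4
          then have "m \<le> k + l + 1" using K by linarith
          then show ?thesis using corner_forms_zero[OF S kl] 4 K by auto
        next
          case 5
          then show ?thesis
            using unitriangular_index[OF qu am(2), of b] unitriangular_index[OF qu am(1), of a] by simp
        next
          case 6 then show ?thesis using zero(1) kl K by auto
        next
          case 7 then show ?thesis using zero(2) kl K corner_forms_sym[OF S kl(2,1)] by auto
        qed
      qed
      have "(q * S * q\<^sup>T) $$ (a, b) = (\<Sum>k<m. \<Sum>l<m. q $$ (a, k) * S $$ (k, l) * q $$ (b, l))"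
        by (rule congr_index[OF unitriangular_carrier[OF qu] Sc am])
      also have "\<dots> = (\<Sum>k<m. \<Sum>l<m. if l = b then if k = a then S $$ (a, b) else 0 else 0)"
        by (intro sum.cong refl) (use entry in auto)
      also have "\<dots> = S $$ (a, b)" using am by simp
      finally show ?thesis .
    qed
    then show ?thesis using zero by simp
  qed
qed

text \<open>The fibre of the multiplication map over q0 z0 consists of the pairs (q0 x^-1, x z0)
  with x in the intersection of Q and H.\<close>

lemma (in group) sum_subgroup_product:
  fixes f :: "'a \<Rightarrow> 'c::semiring_1"
  assumes Q: "subgroup Q G" and H: "subgroup H G" and fin: "finite Q" "finite H"
  shows "(\<Sum>q\<in>Q. \<Sum>z\<in>H. f (q \<otimes> z)) = of_nat (card (Q \<inter> H)) * (\<Sum>g\<in>Q <#> H. f g)"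
proof -
  interpret Q: subgroup Q G by (rule Q)
  interpret H: subgroup H G by (rule H)
  have QH: "Q <#> H = (\<lambda>p. fst p \<otimes> snd p) ` (Q \<times> H)" unfolding set_mult_def by force
  have card_fib: "card {p \<in> Q \<times> H. fst p \<otimes> snd p = g} = card (Q \<inter> H)" if gQ: "g \<in> Q <#> H" for g
  proof -
    obtain q0 z0 where qz: "q0 \<in> Q" "z0 \<in> H" "g = q0 \<otimes> z0" using gQ unfolding set_mult_def by blast
    note c = Q.mem_carrier H.mem_carrier
    have "bij_betw (\<lambda>x. (q0 \<otimes> inv x, x \<otimes> z0)) (Q \<inter> H) {p \<in> Q \<times> H. fst p \<otimes> snd p = g}"
    proof (rule bij_betw_byWitness[where f' = "\<lambda>p. snd p \<otimes> inv z0"])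
      show "\<forall>x\<in>Q \<inter> H. snd (q0 \<otimes> inv x, x \<otimes> z0) \<otimes> inv z0 = x"
        using qz c by (auto simp: m_assoc)
      have q: "snd p \<otimes> inv z0 = inv (fst p) \<otimes> q0" "snd p \<otimes> inv z0 \<in> Q \<inter> H"
        if p: "p \<in> {p \<in> Q \<times> H. fst p \<otimes> snd p = g}" for p
      proof -
        have pc: "fst p \<in> Q" "snd p \<in> H" "fst p \<otimes> snd p = q0 \<otimes> z0" using p qz(3) by auto
        have "snd p = inv (fst p) \<otimes> (fst p \<otimes> snd p)" using pc(1,2) c by (simp add: m_assoc[symmetric])
        then have "snd p \<otimes> inv z0 = inv (fst p) \<otimes> (q0 \<otimes> z0) \<otimes> inv z0" by (simp only: pc(3))
        also have "\<dots> = inv (fst p) \<otimes> q0" using pc(1) qz c by (simp add: m_assoc)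
        finally show e: "snd p \<otimes> inv z0 = inv (fst p) \<otimes> q0" .
        have "inv (fst p) \<otimes> q0 \<in> Q" using pc(1) qz(1) by simp
        moreover have "snd p \<otimes> inv z0 \<in> H" using pc(2) qz(2) by simp
        ultimately show "snd p \<otimes> inv z0 \<in> Q \<inter> H" using e by simp
      qed
      show "\<forall>p\<in>{p \<in> Q \<times> H. fst p \<otimes> snd p = g}. (q0 \<otimes> inv (snd p \<otimes> inv z0), (snd p \<otimes> inv z0) \<otimes> z0) = p"
      proof
        fix p assume p: "p \<in> {p \<in> Q \<times> H. fst p \<otimes> snd p = g}"
        then have pc: "fst p \<in> Q" "snd p \<in> H" by auto
        have "q0 \<otimes> inv (snd p \<otimes> inv z0) = fst p"
          unfolding q(1)[OF p] using pc qz c by (simp add: inv_mult_group m_assoc[symmetric])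
        moreover have "(snd p \<otimes> inv z0) \<otimes> z0 = snd p" using pc qz c by (simp add: m_assoc)
        ultimately show "(q0 \<otimes> inv (snd p \<otimes> inv z0), (snd p \<otimes> inv z0) \<otimes> z0) = p" by simp
      qed
      show "(\<lambda>x. (q0 \<otimes> inv x, x \<otimes> z0)) ` (Q \<inter> H) \<subseteq> {p \<in> Q \<times> H. fst p \<otimes> snd p = g}"
      proof
        fix p assume "p \<in> (\<lambda>x. (q0 \<otimes> inv x, x \<otimes> z0)) ` (Q \<inter> H)"
        then obtain x where x: "x \<in> Q" "x \<in> H" "p = (q0 \<otimes> inv x, x \<otimes> z0)" by auto
        have "(q0 \<otimes> inv x) \<otimes> (x \<otimes> z0) = q0 \<otimes> (inv x \<otimes> x) \<otimes> z0"
          using qz(1,2) x(1) c by (simp only: m_assoc inv_closed m_closed)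
        then show "p \<in> {p \<in> Q \<times> H. fst p \<otimes> snd p = g}"
          using qz x c by simp
      qed
      show "(\<lambda>p. snd p \<otimes> inv z0) ` {p \<in> Q \<times> H. fst p \<otimes> snd p = g} \<subseteq> Q \<inter> H"
        using q(2) by blast
    qed
    then show ?thesis by (simp add: bij_betw_same_card)
  qed
  have "(\<Sum>q\<in>Q. \<Sum>z\<in>H. f (q \<otimes> z)) = (\<Sum>p\<in>Q \<times> H. f (fst p \<otimes> snd p))"
    by (simp add: sum.cartesian_product case_prod_unfold)
  also have "\<dots> = (\<Sum>g\<in>Q <#> H. \<Sum>p\<in>{p \<in> Q \<times> H. fst p \<otimes> snd p = g}. f (fst p \<otimes> snd p))"
    by (rule sum.group[symmetric]) (use fin in \<open>auto simp: QH\<close>)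
  also have "\<dots> = (\<Sum>g\<in>Q <#> H. of_nat (card (Q \<inter> H)) * f g)"
  proof (rule sum.cong[OF refl])
    fix g assume g: "g \<in> Q <#> H"
    have "(\<Sum>p\<in>{p \<in> Q \<times> H. fst p \<otimes> snd p = g}. f (fst p \<otimes> snd p)) =
      (\<Sum>p\<in>{p \<in> Q \<times> H. fst p \<otimes> snd p = g}. f g)" by (rule sum.cong) auto
    then show "(\<Sum>p\<in>{p \<in> Q \<times> H. fst p \<otimes> snd p = g}. f (fst p \<otimes> snd p)) = of_nat (card (Q \<inter> H)) * f g"
      by (simp add: card_fib[OF g])
  qed
  finally show ?thesis by (simp add: sum_distrib_left)
qed

text \<open>In the block description of \<open>U\<close>, the blocks \<open>x\<close> and \<open>u\<close> are arbitrary: \<open>- (1/2) u u\<^sup>T J\<close> is always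
  admissible as the block \<open>z\<close>.\<close>

lemma U_clear_rows:
  fixes g :: "'a::field mat"
  assumes two: "(2::'a) \<noteq> 0" and g: "g \<in> unitriangular (mdim T n)"
  obtains z where "z \<in> carrier (U T n)"
    and "\<And>i k. i < n \<Longrightarrow> i < k \<Longrightarrow> k < n + rdim T \<Longrightarrow> (g * z) $$ (i, k) = 0"
proof -
  let ?r = "rdim T" and ?J = "antidiag n :: 'a mat"
  interpret GL: group "GL n :: 'a mat monoid" by (rule group_GL)
  have m: "mdim T n = n + ?r + n" by (simp add: mdim_def)
  have J: "?J \<in> carrier_mat n n" by (rule antidiag_carrier)
  obtain A B C D E F G H K where bl: "A \<in> carrier_mat n n" "B \<in> carrier_mat n ?r" "C \<in> carrier_mat n n"
    "D \<in> carrier_mat ?r n" "E \<in> carrier_mat ?r ?r" "F \<in> carrier_mat ?r n"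
    "G \<in> carrier_mat n n" "H \<in> carrier_mat n ?r" "K \<in> carrier_mat n n"
    and gb: "g = block3 n ?r A B C D E F G H K"
    using block3_cases[of g n ?r] unitriangular_carrier[OF g] unfolding m by metis
  have A: "A \<in> unitriangular n"
  proof (rule unitriangularI[OF bl(1)])
    fix i j assume "i < n" "j \<le> i"
    then show "A $$ (i, j) = (if i = j then 1 else 0)"
      using unitriangular_index[OF g, of i j] block3_index(1)[of i n j ?r A B C D E F G H K]
      by (simp add: gb m)
  qed
  \<comment> \<open>The first block row of g z begins with A x and A x u + B, so these choices give
    an identity block and a zero block.\<close>
  let ?x = "inv\<^bsub>GL n\<^esub> A" and ?u = "- B"
  have x: "?x \<in> unitriangular n" "A * ?x = 1\<^sub>m n" using unitriangular_inv[OF A] by auto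
  have xc: "?x \<in> carrier_mat n n" using x(1) by (rule unitriangular_carrier)
  have u: "?u \<in> carrier_mat n ?r" using bl by simp
  have uu: "?u * ?u\<^sup>T \<in> carrier_mat n n" using u by simp
  define c :: 'a where "c = - (1 / 2)"
  define w where "w = c \<cdot>\<^sub>m (?u * ?u\<^sup>T * ?J)"
  have w: "w \<in> carrier_mat n n" unfolding w_def using uu J by simp
  have tw: "?J * w\<^sup>T = c \<cdot>\<^sub>m (?u * ?u\<^sup>T)"
  proof -
    have "w\<^sup>T = c \<cdot>\<^sub>m (?u * ?u\<^sup>T * ?J)\<^sup>T"
      unfolding w_def using uu J by (intro eq_matI) (auto simp del: index_mult_mat(1))
    also have "(?u * ?u\<^sup>T * ?J)\<^sup>T = ?J * (?u * ?u\<^sup>T)"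
      using transpose_mult[OF uu J] transpose_mult[of ?u n ?r "?u\<^sup>T" n] u
      by (simp add: antidiag_transpose)
    finally have "?J * w\<^sup>T = c \<cdot>\<^sub>m (?J * (?J * (?u * ?u\<^sup>T)))"
      using mult_smult_distrib[OF J, of "?J * (?u * ?u\<^sup>T)" n c] J uu by simp
    then show ?thesis using mult_left_cancel_mat[OF J J uu antidiag_square] by simp
  qed
  have wJ: "w * ?J = c \<cdot>\<^sub>m (?u * ?u\<^sup>T)"
  proof -
    have "w * ?J = c \<cdot>\<^sub>m (?u * ?u\<^sup>T * ?J * ?J)"
      unfolding w_def using mult_smult_assoc_mat[of "?u * ?u\<^sup>T * ?J" n n ?J n c] uu J by simp
    then show ?thesis using mult_right_cancel_mat[OF J J uu antidiag_square] by simp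
  qed
  have cc: "c + c = - 1"
    using two by (simp add: c_def field_simps)
  have zero: "?u * ?u\<^sup>T = 0\<^sub>m n n" if "T \<noteq> OddOrthogonal"
    using u that by (intro eq_matI) (auto simp: rdim_def scalar_prod_def)
  have cond: "case T of
       Symplectic \<Rightarrow> ?J * w\<^sup>T - w * ?J = 0\<^sub>m n n
     | EvenOrthogonal \<Rightarrow> ?J * w\<^sup>T + w * ?J = 0\<^sub>m n n
     | OddOrthogonal \<Rightarrow> ?J * w\<^sup>T + w * ?J = - (?u * ?u\<^sup>T)"
  proof (cases T)
    case OddOrthogonal
    define V where "V = ?u * ?u\<^sup>T"
    have V: "V \<in> carrier_mat n n" using uu by (simp add: V_def)
    have "c \<cdot>\<^sub>m V + c \<cdot>\<^sub>m V = - V"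
      using V cc by (intro eq_matI) (auto simp: distrib_right[symmetric])
    then show ?thesis using OddOrthogonal unfolding tw wJ V_def by simp
  qed (use zero in \<open>auto simp: tw wJ smult_zero_mat\<close>)
  define z where "z = block3 n ?r
        ?x (?x * ?u) (?x * w)
        (0\<^sub>m ?r n) (1\<^sub>m ?r) (- (?u\<^sup>T * ?J))
        (0\<^sub>m n n) (0\<^sub>m n ?r) (?J * (inv\<^bsub>GL n\<^esub> ?x)\<^sup>T * ?J)"
  have "z \<in> carrier (U T n)"
    unfolding carrier_U_explicit z_def using x(1) u w cond by blast
  moreover have "(g * z) $$ (i, k) = 0" if ik: "i < n" "i < k" "k < n + ?r" for i k
  proof -
    have S: "?J * (inv\<^bsub>GL n\<^esub> ?x)\<^sup>T * ?J \<in> carrier_mat n n"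
      using J unitriangular_carrier[OF unitriangular_inv(1)[OF x(1)]] by simp
    have f: "- (?u\<^sup>T * ?J) \<in> carrier_mat ?r n" using u J by simp
    have xu: "?x * ?u \<in> carrier_mat n ?r" "?x * w \<in> carrier_mat n n" using xc u w by auto
    have gz: "g * z = block3 n ?r
       (A * ?x + B * 0\<^sub>m ?r n + C * 0\<^sub>m n n) (A * (?x * ?u) + B * 1\<^sub>m ?r + C * 0\<^sub>m n ?r)
       (A * (?x * w) + B * (- (?u\<^sup>T * ?J)) + C * (?J * (inv\<^bsub>GL n\<^esub> ?x)\<^sup>T * ?J))
       (D * ?x + E * 0\<^sub>m ?r n + F * 0\<^sub>m n n) (D * (?x * ?u) + E * 1\<^sub>m ?r + F * 0\<^sub>m n ?r)
       (D * (?x * w) + E * (- (?u\<^sup>T * ?J)) + F * (?J * (inv\<^bsub>GL n\<^esub> ?x)\<^sup>T * ?J))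
       (G * ?x + H * 0\<^sub>m ?r n + K * 0\<^sub>m n n) (G * (?x * ?u) + H * 1\<^sub>m ?r + K * 0\<^sub>m n ?r)
       (G * (?x * w) + H * (- (?u\<^sup>T * ?J)) + K * (?J * (inv\<^bsub>GL n\<^esub> ?x)\<^sup>T * ?J))"
      unfolding gb z_def
      by (rule block3_mult[OF bl xc xu _ _ f _ _ S]) auto
    show ?thesis
    proof (cases "k < n")
      case True
      have "A * ?x + B * 0\<^sub>m ?r n + C * 0\<^sub>m n n = 1\<^sub>m n" using bl x(2) by simp
      moreover have "(g * z) $$ (i, k) = (A * ?x + B * 0\<^sub>m ?r n + C * 0\<^sub>m n n) $$ (i, k)"
        unfolding gz by (rule block3_index(1)[OF ik(1) True])
      ultimately have "(g * z) $$ (i, k) = 1\<^sub>m n $$ (i, k)" by (simp only:)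
      then show ?thesis using ik True by simp
    next
      case False
      then obtain k' where k': "k = n + k'" "k' < ?r" using ik(3) by (metis add_less_cancel_left le_iff_add not_less)
      have "A * (?x * ?u) = A * ?x * ?u" using assoc_mult_mat[OF bl(1) xc u] by simp
      also have "\<dots> = ?u" unfolding x(2) using u by simp
      finally have Au: "A * (?x * ?u) = ?u" .
      have "A * (?x * ?u) + B * 1\<^sub>m ?r + C * 0\<^sub>m n ?r = 0\<^sub>m n ?r"
        unfolding Au using bl by (intro eq_matI) (auto simp del: index_mult_mat(1))
      moreover have "(g * z) $$ (i, n + k') = (A * (?x * ?u) + B * 1\<^sub>m ?r + C * 0\<^sub>m n ?r) $$ (i, k')"
        unfolding gz by (rule block3_index(2)[OF ik(1) k'(2)])
      ultimately have "(g * z) $$ (i, n + k') = 0\<^sub>m n ?r $$ (i, k')" by (simp only:)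
      then show ?thesis using ik k' by simp
    qed
  qed
  ultimately show thesis by (rule that)
qed

text \<open>Zeros in a row up to column K pass from u to \<open>half_sum\<close>, then to its
  inverse by \<open>unitriangular_inv_row_zero\<close>; multiplication by the Gram matrix reflects
  column k to m - 1 - k. So nonlinear conditions never appear.\<close>

lemma row_zero_cayley_iff:
  fixes u :: "'a::field mat"
  assumes two: "(2::'a) \<noteq> 0" and u: "u \<in> carrier (U T n)" and a: "a < mdim T n" and K: "K \<le> mdim T n"
  shows "(\<forall>k. a < k \<and> k < K \<longrightarrow> u $$ (a, k) = 0) \<longleftrightarrow>
    (\<forall>d<mdim T n. mdim T n - K \<le> d \<longrightarrow> cayley T n u $$ (a, d) = 0)"
proof -
  let ?m = "mdim T n"
  interpret GL: group "GL ?m :: 'a mat monoid" by (rule group_GL)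
  define h where "h = half_sum ?m u"
  have h: "h \<in> unitriangular ?m"
    unfolding h_def by (rule half_sum_unitriangular[OF two U_unitriangular[OF u]])
  define v where "v = inv\<^bsub>GL ?m\<^esub> h"
  have v: "v \<in> unitriangular ?m" unfolding v_def by (rule unitriangular_inv(1)[OF h])
  have hv: "h = inv\<^bsub>GL ?m\<^esub> v" unfolding v_def using GL.inv_inv[OF unitriangular_in_GL[OF h]] by simp
  have yc: "1\<^sub>m ?m - v \<in> carrier_mat ?m ?m" by (rule minus_carrier_mat[OF unitriangular_carrier[OF v]])
  have cay: "cayley T n u $$ (a, d) = gram_sign T n d * (1\<^sub>m ?m - v) $$ (a, ?m - 1 - d)" if "d < ?m" for d
    unfolding cayley_def v_def[symmetric] h_def[symmetric] by (rule mult_gram_transpose_index[OF yc a that])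
  have "(\<forall>k. a < k \<and> k < K \<longrightarrow> u $$ (a, k) = 0) \<longleftrightarrow> (\<forall>k. a < k \<and> k < K \<longrightarrow> h $$ (a, k) = 0)"
    using a K two by (auto simp: h_def half_sum_def)
  also have "\<dots> \<longleftrightarrow> (\<forall>k. a < k \<and> k < K \<longrightarrow> v $$ (a, k) = 0)"
    using unitriangular_inv_row_zero[OF h a K] unitriangular_inv_row_zero[OF v a K]
    unfolding hv[symmetric] v_def[symmetric] by blast
  also have "\<dots> \<longleftrightarrow> (\<forall>d<?m. ?m - K \<le> d \<longrightarrow> cayley T n u $$ (a, d) = 0)"
  proof (intro iffI allI impI)
    fix d assume *: "\<forall>k. a < k \<and> k < K \<longrightarrow> v $$ (a, k) = 0" and d: "d < ?m" "?m - K \<le> d"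
    show "cayley T n u $$ (a, d) = 0"
    proof (cases "a < ?m - 1 - d")
      case True
      moreover have "?m - 1 - d < K" using d K by linarith
      ultimately have "v $$ (a, ?m - 1 - d) = 0" using * by blast
      then show ?thesis using cay[OF d(1)] True d a unitriangular_carrier[OF v] by simp
    next
      case False
      then show ?thesis using corner_forms_zero[OF cayley_corner_forms[OF two u] a d(1)] by linarith
    qed
  next
    fix k assume *: "\<forall>d<?m. ?m - K \<le> d \<longrightarrow> cayley T n u $$ (a, d) = 0" and k: "a < k \<and> k < K"
    have d: "?m - 1 - k < ?m" "?m - K \<le> ?m - 1 - k" "?m - 1 - (?m - 1 - k) = k" using k K by linarith+
    have "gram_sign T n (?m - 1 - k) \<noteq> (0::'a)" by (simp add: gram_sign_def)
    moreover have "gram_sign T n (?m - 1 - k) * (1\<^sub>m ?m - v) $$ (a, k) = 0"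
      using cay[OF d(1)] * d by metis
    ultimately show "v $$ (a, k) = 0" using k K a unitriangular_carrier[OF v] by simp
  qed
  finally show ?thesis .
qed

lemma row_subgroup_cayley_iff:
  fixes u :: "'a::field mat"
  assumes two: "(2::'a) \<noteq> 0" and u: "u \<in> carrier (U T n)" and ab: "a < mdim T n" "b < mdim T n"
    and K: "K \<le> mdim T n"
  shows "u \<in> row_subgroup (mdim T n) a b K \<longleftrightarrow>
    (\<forall>d<mdim T n. mdim T n - K \<le> d \<longrightarrow> cayley T n u $$ (a, d) = 0) \<and>
    (\<forall>c<mdim T n. K \<le> c \<longrightarrow> cayley T n u $$ (b, c) = 0)"
  using row_zero_cayley_iff[OF two u ab(1) K] row_zero_cayley_iff[OF two u ab(2), of "mdim T n - K"]
    U_unitriangular[OF u] K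
  by (simp add: row_subgroup_def)

text \<open>On the subgroup the transform is linear in this entry. In h v = 1, with h the
  \<open>half_sum\<close> and v its inverse, row a of h vanishes between a and K, and column m - 1 -
  b of v vanishes from K up to its diagonal, by the condition on row b and the symmetry of the form.
  Two terms remain; the 2 comes from u = 2 h - 1.\<close>

lemma entry_cayley:
  fixes u :: "'a::field mat"
  assumes two: "(2::'a) \<noteq> 0" and u: "u \<in> carrier (U T n)" "u \<in> row_subgroup (mdim T n) a b K"
    and K: "a < K" "K \<le> mdim T n" "b < mdim T n - K"
  shows "u $$ (a, mdim T n - 1 - b) = 2 * gram_sign T n b * cayley T n u $$ (a, b)"
proof -
  let ?m = "mdim T n" and ?b = "mdim T n - 1 - b"
  have lt: "a < ?m" "b < ?m" "?b < ?m" "a < ?b" "K \<le> ?b" using K by linarith+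
  define h where "h = half_sum ?m u"
  have h: "h \<in> unitriangular ?m"
    unfolding h_def by (rule half_sum_unitriangular[OF two U_unitriangular[OF u(1)]])
  define v where "v = inv\<^bsub>GL ?m\<^esub> h"
  have v: "v \<in> unitriangular ?m" "h * v = 1\<^sub>m ?m" unfolding v_def by (rule unitriangular_inv[OF h])+
  have yc: "1\<^sub>m ?m - v \<in> carrier_mat ?m ?m" by (rule minus_carrier_mat[OF unitriangular_carrier[OF v(1)]])
  have cay: "cayley T n u $$ (i, b) = gram_sign T n b * (1\<^sub>m ?m - v) $$ (i, ?b)" if "i < ?m" for i
    unfolding cayley_def v_def[symmetric] h_def[symmetric] by (rule mult_gram_transpose_index[OF yc that lt(2)])
  have gs: "gram_sign T n b \<noteq> (0::'a)" by (simp add: gram_sign_def)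
  have S: "cayley T n u \<in> corner_forms (form_sign T) ?m" by (rule cayley_corner_forms[OF two u(1)])
  have bc: "cayley T n u $$ (c, b) = 0" if "c < ?m" "K \<le> c" for c
    using row_subgroup_cayley_iff[OF two u(1) lt(1,2) K(2)] u(2) corner_forms_sym[OF S lt(2) that(1)] that by simp
  have "0 = (h * v) $$ (a, ?b)" using lt by (simp add: v(2))
  also have "\<dots> = (\<Sum>k<?m. h $$ (a, k) * v $$ (k, ?b))"
    by (rule mult_index[OF unitriangular_carrier[OF h] unitriangular_carrier[OF v(1)] lt(1,3)])
  also have "\<dots> = (\<Sum>k<?m. (if k = a then v $$ (a, ?b) else 0) + (if k = ?b then h $$ (a, ?b) else 0))"
  proof (rule sum.cong[OF refl])
    fix k assume "k \<in> {..<?m}"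
    then have k: "k < ?m" by simp
    consider "k < a" | "k = a" | "a < k" "k < K" | "K \<le> k" "k < ?b" | "k = ?b" | "?b < k" by linarith
    then show "h $$ (a, k) * v $$ (k, ?b) = (if k = a then v $$ (a, ?b) else 0) + (if k = ?b then h $$ (a, ?b) else 0)"
    proof cases
      case 1 then show ?thesis using unitriangular_index[OF h lt(1), of k] lt by simp
    next
      case 2 then show ?thesis using unitriangular_index[OF h lt(1), of a] lt by simp
    next
      case 3
      then have "u $$ (a, k) = 0" using u(2) by (simp add: row_subgroup_def)
      then have "h $$ (a, k) = 0" using 3 k lt by (simp add: h_def half_sum_def)
      then show ?thesis using 3 lt by simp
    next
      case 4
      have "gram_sign T n b * (1\<^sub>m ?m - v) $$ (k, ?b) = 0" using bc[OF k 4(1)] cay[OF k] by simp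
      then have "v $$ (k, ?b) = 0" using gs 4 k lt unitriangular_carrier[OF v(1)] by simp
      then show ?thesis using 4 K by simp
    next
      case 5 then show ?thesis using unitriangular_index[OF v(1) lt(3), of ?b] lt by simp
    next
      case 6 then show ?thesis using unitriangular_index[OF v(1) k, of ?b] lt by simp
    qed
  qed
  also have "\<dots> = v $$ (a, ?b) + h $$ (a, ?b)" using lt by (simp add: sum.distrib)
  finally have "h $$ (a, ?b) = - v $$ (a, ?b)" by (simp add: eq_neg_iff_add_eq_0 add.commute)
  moreover have "cayley T n u $$ (a, b) = - (gram_sign T n b * v $$ (a, ?b))"
    using cay[OF lt(1)] lt unitriangular_carrier[OF v(1)] by simp
  moreover have "u $$ (a, ?b) = 2 * h $$ (a, ?b)" using lt two by (simp add: h_def half_sum_def)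
  ultimately show ?thesis by (simp add: mult.assoc[symmetric] gram_sign_square)
qed

text \<open>An element of U can clear the first n rows of g up to and including the middle column,
  if there is one. The hypothesis on b says that the condition on row b lies in this range or is
  void.\<close>

lemma row_subgroup_mult_U:
  assumes two: "(2::'a::field) \<noteq> 0" and ab: "a < n" "b < mdim T n" and K: "K \<le> n"
    and b: "b < n \<and> mdim T n - K \<le> n + rdim T \<or> mdim T n - K = Suc b"
  shows "row_subgroup (mdim T n) a b K <#>\<^bsub>GL (mdim T n)\<^esub> carrier (U T n) = (unitriangular (mdim T n) :: 'a mat set)"
proof
  let ?m = "mdim T n" and ?Q = "row_subgroup (mdim T n) a b K :: 'a mat set"
  show "?Q <#>\<^bsub>GL ?m\<^esub> carrier (U T n) \<subseteq> unitriangular ?m"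
    unfolding set_mult_def using row_subgroup_unitriangular U_unitriangular unitriangular_mult
    by (fastforce simp: GL_simps)
  show "unitriangular ?m \<subseteq> ?Q <#>\<^bsub>GL ?m\<^esub> carrier (U T n)"
  proof
    fix g :: "'a mat" assume g: "g \<in> unitriangular ?m"
    obtain z where z: "z \<in> carrier (U T n)"
      and gz: "\<And>i k. i < n \<Longrightarrow> i < k \<Longrightarrow> k < n + rdim T \<Longrightarrow> (g * z) $$ (i, k) = 0"
      using U_clear_rows[OF two g] by blast
    have zu: "z \<in> unitriangular ?m" by (rule U_unitriangular[OF z])
    have "g * z \<in> ?Q"
      unfolding row_subgroup_def using unitriangular_mult[OF g zu] gz ab K b by auto
    moreover have "inv\<^bsub>GL ?m\<^esub> z \<in> carrier (U T n)"
      by (rule subgroup.m_inv_closed[OF subgroup_U z])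
    moreover have "g = (g * z) * inv\<^bsub>GL ?m\<^esub> z"
      using mult_right_cancel_mat[OF unitriangular_carrier[OF zu] _ unitriangular_carrier[OF g] unitriangular_inv(2)[OF zu]]
        unitriangular_carrier[OF unitriangular_inv(1)[OF zu]] by simp
    ultimately show "g \<in> ?Q <#>\<^bsub>GL ?m\<^esub> carrier (U T n)"
      unfolding set_mult_def GL_simps by blast
  qed
qed

section \<open>Induction from the intersections with U\<close>

lemma row_subgroup_U_subgroup:
  assumes "a < mdim T n" "b < mdim T n" "K \<le> mdim T n"
  shows "subgroup (carrier (U T n) \<inter> row_subgroup (mdim T n) a b K) (U T n :: 'a::field mat monoid)"
proof -
  interpret group "U T n :: 'a mat monoid" by (rule group_U)
  show ?thesis
  proof (rule subgroup.intro)
    show "\<one>\<^bsub>U T n\<^esub> \<in> carrier (U T n) \<inter> (row_subgroup (mdim T n) a b K :: 'a mat set)"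
      using one_closed subgroup.one_closed[OF row_subgroup_subgroup[OF assms]] by (simp add: U_simps GL_simps)
  next
    fix x y :: "'a mat" assume "x \<in> carrier (U T n) \<inter> row_subgroup (mdim T n) a b K"
      "y \<in> carrier (U T n) \<inter> row_subgroup (mdim T n) a b K"
    then show "x \<otimes>\<^bsub>U T n\<^esub> y \<in> carrier (U T n) \<inter> row_subgroup (mdim T n) a b K"
      using m_closed[of x y] row_subgroup_mult[OF assms, of x y] by (simp add: U_simps)
  next
    fix x :: "'a mat" assume "x \<in> carrier (U T n) \<inter> row_subgroup (mdim T n) a b K"
    then show "inv\<^bsub>U T n\<^esub> x \<in> carrier (U T n) \<inter> row_subgroup (mdim T n) a b K"
      using inv_closed[of x] row_subgroup_inv[OF assms, of x] U_inv[of x T n] by simp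
  qed auto
qed

text \<open>Intermediate terms of the product vanish: row a of x is zero before column K, and column
  m - 1 - b of y is zero from row K up to its diagonal.\<close>

lemma row_subgroup_U_entry_mult:
  fixes x :: "'a::field mat"
  assumes K: "a < K" "K \<le> mdim T n" "b < mdim T n - K"
    and x: "x \<in> carrier (U T n)" "x \<in> row_subgroup (mdim T n) a b K"
    and y: "y \<in> carrier (U T n)" "y \<in> row_subgroup (mdim T n) a b K"
  shows "(x * y) $$ (a, mdim T n - 1 - b) = x $$ (a, mdim T n - 1 - b) + y $$ (a, mdim T n - 1 - b)"
proof -
  let ?m = "mdim T n" and ?b = "mdim T n - 1 - b"
  have lt: "a < ?m" "b < ?m" "?b < ?m" "a < ?b" "K \<le> ?b" using K by linarith+
  note xu = U_unitriangular[OF x(1)] and yu = U_unitriangular[OF y(1)]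
  note c = unitriangular_carrier[OF xu] unitriangular_carrier[OF yu]
  let ?i = "inv\<^bsub>GL ?m\<^esub> y"
  have iQ: "?i \<in> row_subgroup ?m a b K" by (rule row_subgroup_inv[OF lt(1,2) K(2) y(2)])
  note iu = unitriangular_carrier[OF row_subgroup_unitriangular[OF iQ]]
  \<comment> \<open>In U, inversion is reflection in the antidiagonal up to signs: this entry is, up
    to sign, the entry (b, m - 1 - k) of the inverse of y, which has prescribed zeros in row
    b.\<close>
  have y0: "y $$ (k, ?b) = 0" if k: "K \<le> k" "k < ?b" for k
  proof -
    have km: "k < ?m" "b < ?m - 1 - k" "?m - 1 - k < ?m - K" using k lt K by linarith+
    have tc: "y\<^sup>T \<in> carrier_mat ?m ?m" using c(2) by simp
    have "gram_sign T n ?b * y $$ (k, ?b) = ((y\<^sup>T)\<^sup>T * gram T n) $$ (k, b)"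
      unfolding transpose_mult_gram_index[OF tc km(1) lt(2)] using km(1) lt(3) c(2) by simp
    also have "\<dots> = (y * gram T n)\<^sup>T $$ (b, k)"
      using km(1) lt(2) c(2) gram_carrier[of T n, where 'a='a] by (simp del: index_mult_mat(1))
    also have "\<dots> = (?i * (gram T n)\<^sup>T) $$ (b, k)"
      by (simp only: U_inverse_gram[OF y(1)] transpose_mult[OF c(2) gram_carrier])
    also have "\<dots> = gram_sign T n k * ?i $$ (b, ?m - 1 - k)"
      by (rule mult_gram_transpose_index[OF iu lt(2) km(1)])
    also have "?i $$ (b, ?m - 1 - k) = 0"
      using iQ km by (simp add: row_subgroup_def)
    finally show ?thesis by (simp add: gram_sign_def split: if_splits)
  qed
  have "(x * y) $$ (a, ?b) = (\<Sum>k<?m. x $$ (a, k) * y $$ (k, ?b))"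
    by (rule mult_index[OF c lt(1,3)])
  also have "\<dots> = (\<Sum>k<?m. (if k = a then y $$ (a, ?b) else 0) + (if k = ?b then x $$ (a, ?b) else 0))"
  proof (rule sum.cong[OF refl])
    fix k assume "k \<in> {..<?m}"
    then have k: "k < ?m" by simp
    consider "k < a" | "k = a" | "a < k" "k < K" | "K \<le> k" "k < ?b" | "k = ?b" | "?b < k" by linarith
    then show "x $$ (a, k) * y $$ (k, ?b) = (if k = a then y $$ (a, ?b) else 0) + (if k = ?b then x $$ (a, ?b) else 0)"
    proof cases
      case 1 then show ?thesis using unitriangular_index[OF xu lt(1), of k] lt by simp
    next
      case 2 then show ?thesis using unitriangular_index[OF xu lt(1), of a] lt by simp
    next
      case 3
      then have "x $$ (a, k) = 0" using x(2) by (simp add: row_subgroup_def)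
      then show ?thesis using 3 lt by simp
    next
      case 4
      then show ?thesis using y0[OF 4] K by simp
    next
      case 5 then show ?thesis using unitriangular_index[OF yu lt(3), of ?b] lt by simp
    next
      case 6 then show ?thesis using unitriangular_index[OF yu k, of ?b] lt by simp
    qed
  qed
  also have "\<dots> = x $$ (a, ?b) + y $$ (a, ?b)" using lt by (simp add: sum.distrib add.commute)
  finally show ?thesis .
qed

lemma induced_row_subgroup_pos_def:
  fixes \<theta> :: "'a::{field,finite} \<Rightarrow> complex"
  assumes \<theta>: "linear_character_add \<theta>" and K: "a < K" "K \<le> mdim T n" "b < mdim T n - K"
  shows "pos_def (U T n) (induced (U T n) (carrier (U T n) \<inter> row_subgroup (mdim T n) a b K)
    (\<lambda>x. \<theta> (r * x $$ (a, mdim T n - 1 - b))))"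
proof -
  interpret group "U T n :: 'a mat monoid" by (rule group_U)
  have lt: "a < mdim T n" "b < mdim T n" using K by linarith+
  show ?thesis
  proof (rule pos_def_induced[OF finite_U row_subgroup_U_subgroup[OF lt K(2)]])
    fix x y :: "'a mat" assume "x \<in> carrier (U T n) \<inter> row_subgroup (mdim T n) a b K"
      "y \<in> carrier (U T n) \<inter> row_subgroup (mdim T n) a b K"
    then have "(x * y) $$ (a, mdim T n - 1 - b) = x $$ (a, mdim T n - 1 - b) + y $$ (a, mdim T n - 1 - b)"
      by (intro row_subgroup_U_entry_mult[OF K]) auto
    then show "\<theta> (r * (x \<otimes>\<^bsub>U T n\<^esub> y) $$ (a, mdim T n - 1 - b)) =
        \<theta> (r * x $$ (a, mdim T n - 1 - b)) * \<theta> (r * y $$ (a, mdim T n - 1 - b))"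
      using \<theta> unfolding U_simps linear_character_add_def by (metis distrib_left)
  qed (rule linear_character_add_unit[OF \<theta>])
qed

text \<open>By \<open>sum_row_subgroup\<close> each summand of the induced character is an average
  over the row subgroup Q. Every unitriangular matrix is a product of elements of Q and U in as many
  ways as their intersection has elements, and this number cancels the denominator of
  induction.\<close>

lemma induced_row_subgroup:
  fixes \<theta> :: "'a::{field,finite} \<Rightarrow> complex"
  assumes \<theta>: "linear_character_add \<theta>" "\<exists>a. \<theta> a \<noteq> 1" and two: "(2::'a) \<noteq> 0"
    and K: "a < K" "K \<le> n" "b < mdim T n - K"
    and b: "b < n \<and> mdim T n - K \<le> n + rdim T \<or> mdim T n - K = Suc b"
    and ab: "a = b \<Longrightarrow> 2 * K = mdim T n \<and> T = Symplectic"
    and r: "r \<noteq> 0" and u: "u \<in> carrier (U T n)"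
  shows "induced (U T n) (carrier (U T n) \<inter> row_subgroup (mdim T n) a b K)
      (\<lambda>x. \<theta> (r * x $$ (a, mdim T n - 1 - b))) u =
    (\<Sum>g\<in>unitriangular (mdim T n).
       \<theta> (2 * r * gram_sign T n b * (g * cayley T n u * g\<^sup>T) $$ (a, b)))
    / of_nat (card (row_subgroup (mdim T n) a b K :: 'a mat set))"
proof -
  let ?m = "mdim T n" and ?Q = "row_subgroup (mdim T n) a b K :: 'a mat set"
  let ?U = "carrier (U T n :: 'a mat monoid)"
  let ?S = "cayley T n u" and ?\<sigma> = "form_sign T :: 'a"
  \<comment> \<open>The factor 2 and the sign are those of \<open>entry_cayley\<close>.\<close>
  define t where "t = 2 * r * gram_sign T n b"
  have t: "t \<noteq> 0" using r two by (simp add: t_def gram_sign_def)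
  have Km: "K \<le> ?m" using K by (simp add: mdim_def)
  have lt: "a < ?m" "b < ?m" "a < n" using K by (simp_all add: mdim_def)
  interpret GL: group "GL ?m :: 'a mat monoid" by (rule group_GL)
  let ?f = "\<lambda>g. \<theta> (t * (g * ?S * g\<^sup>T) $$ (a, b))"
  let ?conj = "\<lambda>z. z \<otimes>\<^bsub>U T n\<^esub> u \<otimes>\<^bsub>U T n\<^esub> inv\<^bsub>U T n\<^esub> z"
  have conj: "?conj z \<in> ?U" "cayley T n (?conj z) = z * ?S * z\<^sup>T" if z: "z \<in> ?U" for z
  proof -
    interpret U: group "U T n :: 'a mat monoid" by (rule group_U)
    show "?conj z \<in> ?U" using z u by simp
    show "cayley T n (?conj z) = z * ?S * z\<^sup>T"
      unfolding U_simps U_inv[OF z] by (rule cayley_conj[OF two u z])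
  qed
  have Sc: "?S \<in> carrier_mat ?m ?m" by (rule corner_forms_carrier[OF cayley_corner_forms[OF two u]])
  have cQ: "card ?Q \<noteq> 0"
    using subgroup.one_closed[OF row_subgroup_subgroup[OF lt(1,2) Km]] finite_row_subgroup[of ?m a b K, where 'a='a]
    by (metis card_eq_0_iff empty_iff)
  have inner: "(if ?conj z \<in> ?U \<inter> ?Q then \<theta> (r * ?conj z $$ (a, ?m - 1 - b)) else 0) =
      (\<Sum>q\<in>?Q. ?f (q * z)) / of_nat (card ?Q)" if z: "z \<in> ?U" for z
  proof -
    let ?w = "?conj z"
    note w = conj[OF z]
    have zc: "z \<in> carrier_mat ?m ?m" by (rule unitriangular_carrier[OF U_unitriangular[OF z]])
    have "(\<Sum>q\<in>?Q. ?f (q * z)) = (\<Sum>q\<in>?Q. \<theta> (t * (q * cayley T n ?w * q\<^sup>T) $$ (a, b)))"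
    proof (rule sum.cong[OF refl])
      fix q assume "q \<in> ?Q"
      then have "q \<in> carrier_mat ?m ?m" by (intro unitriangular_carrier row_subgroup_unitriangular)
      then show "?f (q * z) = \<theta> (t * (q * cayley T n ?w * q\<^sup>T) $$ (a, b))"
        unfolding w(2) using congr_mult[of q ?m z ?S] zc Sc by simp
    qed
    also have "\<dots> = (if ?w \<in> ?Q then of_nat (card ?Q) * \<theta> (t * cayley T n ?w $$ (a, b)) else 0)"
      unfolding row_subgroup_cayley_iff[OF two w(1) lt(1,2) Km]
      by (rule sum_row_subgroup[OF \<theta> two form_sign_square cayley_corner_forms[OF two w(1)] K(1) Km K(3) _ t])
        (use ab in \<open>auto simp: form_sign_def\<close>)
    finally show ?thesis
      using w(1) cQ entry_cayley[OF two w(1) _ K(1) Km K(3)] by (simp add: t_def mult_ac)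
  qed
  have "induced (U T n) (?U \<inter> ?Q) (\<lambda>x. \<theta> (r * x $$ (a, ?m - 1 - b))) u =
    (\<Sum>z\<in>?U. if ?conj z \<in> ?U \<inter> ?Q then \<theta> (r * ?conj z $$ (a, ?m - 1 - b)) else 0) / of_nat (card (?U \<inter> ?Q))"
    unfolding induced_def by (simp only: sum.inter_filter[OF finite_U])
  also have "\<dots> = (\<Sum>z\<in>?U. (\<Sum>q\<in>?Q. ?f (q * z)) / of_nat (card ?Q)) / of_nat (card (?U \<inter> ?Q))"
    by (simp only: inner cong: sum.cong)
  also have "\<dots> = (\<Sum>q\<in>?Q. \<Sum>z\<in>?U. ?f (q * z)) / of_nat (card ?Q) / of_nat (card (?U \<inter> ?Q))"
    unfolding sum_divide_distrib[symmetric] by (subst sum.swap) simp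
  also have "(\<Sum>q\<in>?Q. \<Sum>z\<in>?U. ?f (q * z)) = of_nat (card (?Q \<inter> ?U)) * (\<Sum>g\<in>unitriangular ?m. ?f g)"
    using GL.sum_subgroup_product[OF row_subgroup_subgroup[OF lt(1,2) Km] subgroup_U finite_row_subgroup finite_U, of ?f]
    unfolding row_subgroup_mult_U[OF two lt(3,2) K(2) b] by (simp add: GL_simps)
  also have "of_nat (card (?Q \<inter> ?U)) * (\<Sum>g\<in>unitriangular ?m. ?f g) / of_nat (card ?Q) / of_nat (card (?U \<inter> ?Q)) =
      (\<Sum>g\<in>unitriangular ?m. ?f g) / (of_nat (card ?Q) :: complex)"
  proof -
    have "\<one>\<^bsub>GL ?m\<^esub> \<in> ?U \<inter> ?Q"
      using subgroup.one_closed[OF row_subgroup_subgroup[OF lt(1,2) Km]] subgroup.one_closed[OF subgroup_U] by blast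
    then have "card (?U \<inter> ?Q) \<noteq> 0" using finite_U[of T n, where 'a='a] by (metis card_eq_0_iff empty_iff finite_Int)
    then show ?thesis by (simp add: Int_commute)
  qed
  finally show ?thesis by (simp only: t_def)
qed

section \<open>Roots and forms\<close>

text \<open>A root \<open>\<alpha>\<close> with distinguished entry \<open>(i, j)\<close> is encoded by the positions of the labels
  \<open>i\<close> and \<open>- j\<close>; \<open>root_cut\<close> is the column bound occurring in the definition of \<open>U\<^sub>\<alpha>\<close>.\<close>

fun root_fst :: "eps_root \<Rightarrow> nat" where
  "root_fst (EpsMinus i j) = nat i - 1"
| "root_fst (EpsPlus i j) = nat i - 1"
| "root_fst (TwoEps i) = nat i - 1"
| "root_fst (Eps i) = nat i - 1"

fun root_snd :: "gtype \<Rightarrow> nat \<Rightarrow> eps_root \<Rightarrow> nat" where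
  "root_snd T n (EpsMinus i j) = mdim T n - nat j"
| "root_snd T n (EpsPlus i j) = nat j - 1"
| "root_snd T n (TwoEps i) = nat i - 1"
| "root_snd T n (Eps i) = n"

fun root_cut :: "nat \<Rightarrow> eps_root \<Rightarrow> nat" where
  "root_cut n (EpsMinus i j) = nat j - 1"
| "root_cut n (EpsPlus i j) = n"
| "root_cut n (TwoEps i) = n"
| "root_cut n (Eps i) = n"

lemma root_cases [consumes 1, case_names EpsMinus EpsPlus TwoEps Eps]:
  assumes "\<alpha> \<in> \<Phi> T n"
  obtains i j where "\<alpha> = EpsMinus i j" "1 \<le> i" "i < j" "j \<le> int n"
    | i j where "\<alpha> = EpsPlus i j" "1 \<le> i" "i < j" "j \<le> int n"
    | i where "\<alpha> = TwoEps i" "T = Symplectic" "1 \<le> i" "i \<le> int n"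
    | i where "\<alpha> = Eps i" "T = OddOrthogonal" "1 \<le> i" "i \<le> int n"
  using assms by (auto simp: \<Phi>_def split: gtype.splits)

text \<open>Gathers the side conditions of \<open>induced_row_subgroup\<close>. The fourth clause
  says that the second row is among the first n with its condition in reach of
  \<open>U_clear_rows\<close>, or that this condition is void; the last one places the pair strictly
  above the antidiagonal.\<close>

lemma root_bounds:
  assumes "\<alpha> \<in> \<Phi> T n"
  shows "root_fst \<alpha> < root_cut n \<alpha>" "root_cut n \<alpha> \<le> n" "root_snd T n \<alpha> < mdim T n - root_cut n \<alpha>"
    "root_snd T n \<alpha> < n \<and> mdim T n - root_cut n \<alpha> \<le> n + rdim T \<or> mdim T n - root_cut n \<alpha> = Suc (root_snd T n \<alpha>)"
    "root_fst \<alpha> \<le> root_snd T n \<alpha>"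
    "root_fst \<alpha> = root_snd T n \<alpha> \<Longrightarrow> 2 * root_cut n \<alpha> = mdim T n \<and> T = Symplectic"
    "root_fst \<alpha> + root_snd T n \<alpha> + 1 < mdim T n"
  using assms by (cases rule: root_cases; auto simp: mdim_def rdim_def)+

lemma root_eqI:
  assumes "\<alpha> \<in> \<Phi> T n" "\<beta> \<in> \<Phi> T n" "root_fst \<alpha> = root_fst \<beta>" "root_snd T n \<alpha> = root_snd T n \<beta>"
  shows "\<alpha> = \<beta>"
  using assms(1)
proof (cases rule: root_cases)
  case (EpsMinus i j)
  with assms(2) show ?thesis
    using assms(3,4) by (cases rule: root_cases) (auto simp: mdim_def rdim_def)
next
  case (EpsPlus i j)
  with assms(2) show ?thesis
    using assms(3,4) by (cases rule: root_cases) (auto simp: mdim_def rdim_def)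
next
  case (TwoEps i)
  with assms(2) show ?thesis
    using assms(3,4) by (cases rule: root_cases) (auto simp: mdim_def rdim_def)
next
  case (Eps i)
  with assms(2) show ?thesis
    using assms(3,4) by (cases rule: root_cases) (auto simp: mdim_def rdim_def)
qed

text \<open>With \<open>root_eqI\<close> this makes roots correspond to the free coordinates of
  \<open>corner_forms\<close>: pairs a \<le> b above the antidiagonal, with a = b only for symmetric
  forms.\<close>

lemma root_exists:
  assumes ab: "a \<le> b" "a + b + 1 < mdim T n" and d: "a = b \<Longrightarrow> T = Symplectic"
  obtains \<alpha> where "\<alpha> \<in> \<Phi> T n" "root_fst \<alpha> = a" "root_snd T n \<alpha> = b"
proof -
  consider "a = b" | "a < b" "b < n" | "b = n" "T = OddOrthogonal" | "n + rdim T \<le> b"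
  proof -
    have "a = b \<or> a < b \<and> b < n \<or> b = n \<and> T = OddOrthogonal \<or> n + rdim T \<le> b"
      using ab(1) by (auto simp: rdim_def)
    then show ?thesis using that by blast
  qed
  then show thesis
  proof cases
    case 1
    then show thesis
      using that[of "TwoEps (int a + 1)"] ab d by (auto simp: \<Phi>_def mdim_def rdim_def)
  next
    case 2
    then show thesis
      using that[of "EpsPlus (int a + 1) (int b + 1)"] by (auto simp: \<Phi>_def)
  next
    case 3
    then show thesis
      using that[of "Eps (int a + 1)"] ab by (auto simp: \<Phi>_def mdim_def rdim_def)
  next
    case 4
    then show thesis
      using that[of "EpsMinus (int a + 1) (int (mdim T n) - int b)"] ab
      by (auto simp: \<Phi>_def mdim_def nat_diff_distrib)
  qed
qed

lemma finite_\<Phi>: "finite (\<Phi> T n)"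
proof (rule finite_imageD)
  let ?f = "\<lambda>\<alpha>. (root_fst \<alpha>, root_snd T n \<alpha>)"
  show "inj_on ?f (\<Phi> T n)" by (rule inj_onI) (auto intro: root_eqI)
  have "?f ` \<Phi> T n \<subseteq> {..<mdim T n} \<times> {..<mdim T n}"
    using root_bounds(7) by fastforce
  then show "finite (?f ` \<Phi> T n)" by (rule finite_subset) simp
qed

section \<open>Basic subsets and root subgroups in terms of positions\<close>

lemma pos_inj:
  assumes "x \<in> labels T n" "y \<in> labels T n" "pos T n x = pos T n y"
  shows "x = y"
  using assms by (auto simp: labels_def pos_def mdim_def rdim_def split: if_splits)

lemma entries_labels:
  assumes "\<alpha> \<in> \<Phi> T n" "(x, y) \<in> entries \<alpha>"
  shows "x \<in> labels T n" "y \<in> labels T n" "- y \<in> labels T n"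
  using assms by (cases rule: root_cases; auto simp: labels_def)+

text \<open>Placing the column label y at the position of - y is the column reversal of the Gram
  matrix; it turns the entries of a root into a symmetric set of positions.\<close>

lemma entries_pos:
  assumes "\<alpha> \<in> \<Phi> T n"
  shows "(\<lambda>(x, y). (pos T n x, pos T n (- y))) ` entries \<alpha> =
    {(root_fst \<alpha>, root_snd T n \<alpha>), (root_snd T n \<alpha>, root_fst \<alpha>)}"
  using assms by (cases rule: root_cases) (auto simp: pos_def)

lemma entries_pos_inj:
  assumes "\<alpha> \<in> \<Phi> T n" "\<beta> \<in> \<Phi> T n" "e \<in> entries \<alpha>" "e' \<in> entries \<beta>"
  shows "pos T n (fst e) = pos T n (fst e') \<longleftrightarrow> fst e = fst e'"
    "pos T n (- snd e) = pos T n (- snd e') \<longleftrightarrow> snd e = snd e'"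
  using assms entries_labels[of \<alpha> T n "fst e" "snd e"] entries_labels[of \<beta> T n "fst e'" "snd e'"]
  by (auto dest: pos_inj)

text \<open>In these coordinates the entries of a root form a symmetric set meeting exactly the rows
  \<open>root_fst\<close> and \<open>root_snd\<close>. One entry per row and one per column
  therefore both amount to disjointness of these sets of rows.\<close>

lemma basic_subset_iff:
  "basic_subset T n D \<longleftrightarrow> D \<subseteq> \<Phi> T n \<and> (\<forall>\<alpha>\<in>D. \<forall>\<beta>\<in>D. \<alpha> \<noteq> \<beta> \<longrightarrow>
     {root_fst \<alpha>, root_snd T n \<alpha>} \<inter> {root_fst \<beta>, root_snd T n \<beta>} = {})"
proof (cases "D \<subseteq> \<Phi> T n")
  case D: True
  let ?P = "\<lambda>\<alpha>. {root_fst \<alpha>, root_snd T n \<alpha>}"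
  let ?f = "\<lambda>e. (pos T n (fst e), pos T n (- snd e))"
  have im: "?f ` entries \<alpha> = {(root_fst \<alpha>, root_snd T n \<alpha>), (root_snd T n \<alpha>, root_fst \<alpha>)}" if "\<alpha> \<in> D" for \<alpha>
    using entries_pos[of \<alpha> T n] that D by (auto simp: case_prod_unfold)
  have hit: "\<exists>e\<in>entries \<alpha>. pos T n (fst e) = p" if "\<alpha> \<in> D" "p \<in> ?P \<alpha>" for \<alpha> p
  proof -
    have "\<exists>q. (p, q) \<in> ?f ` entries \<alpha>" unfolding im[OF that(1)] using that(2) by auto
    then show ?thesis by auto
  qed
  have same: "\<alpha> = \<beta>" if "\<alpha> \<in> D" "\<beta> \<in> D" "e \<in> entries \<alpha>" "e \<in> entries \<beta>" for \<alpha> \<beta> e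
  proof -
    have "?f e \<in> ?f ` entries \<alpha>" "?f e \<in> ?f ` entries \<beta>" using that by blast+
    then have "root_fst \<alpha> = root_fst \<beta> \<and> root_snd T n \<alpha> = root_snd T n \<beta>"
      unfolding im[OF that(1)] im[OF that(2)]
      using root_bounds(5)[OF subsetD[OF D that(1)]] root_bounds(5)[OF subsetD[OF D that(2)]] by auto
    then show ?thesis using root_eqI that D by blast
  qed
  have "basic_entries (\<Union>\<alpha>\<in>D. entries \<alpha>) \<longleftrightarrow> (\<forall>\<alpha>\<in>D. \<forall>\<beta>\<in>D. \<alpha> \<noteq> \<beta> \<longrightarrow> ?P \<alpha> \<inter> ?P \<beta> = {})"
  proof
    assume "basic_entries (\<Union>\<alpha>\<in>D. entries \<alpha>)"
    then have inj: "inj_on fst (\<Union>\<alpha>\<in>D. entries \<alpha>)" by (simp add: basic_entries_def)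
    show "\<forall>\<alpha>\<in>D. \<forall>\<beta>\<in>D. \<alpha> \<noteq> \<beta> \<longrightarrow> ?P \<alpha> \<inter> ?P \<beta> = {}"
    proof (intro ballI impI, rule ccontr)
      fix \<alpha> \<beta> assume ab: "\<alpha> \<in> D" "\<beta> \<in> D" "\<alpha> \<noteq> \<beta>" "?P \<alpha> \<inter> ?P \<beta> \<noteq> {}"
      then obtain p where p: "p \<in> ?P \<alpha>" "p \<in> ?P \<beta>" by blast
      obtain e e' where e: "e \<in> entries \<alpha>" "pos T n (fst e) = p" "e' \<in> entries \<beta>" "pos T n (fst e') = p"
        using hit[OF ab(1) p(1)] hit[OF ab(2) p(2)] by blast
      then have "fst e = fst e'" using entries_pos_inj(1)[of \<alpha> T n \<beta> e e'] ab D by auto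
      then have "e = e'" using inj_onD[OF inj, of e e'] e ab by blast
      then show False using same[of \<alpha> \<beta> e] e ab by blast
    qed
  next
    assume disj: "\<forall>\<alpha>\<in>D. \<forall>\<beta>\<in>D. \<alpha> \<noteq> \<beta> \<longrightarrow> ?P \<alpha> \<inter> ?P \<beta> = {}"
    have eq: "e = e'" if "\<alpha> \<in> D" "\<beta> \<in> D" "e \<in> entries \<alpha>" "e' \<in> entries \<beta>"
      and fs: "fst e = fst e' \<or> snd e = snd e'" for \<alpha> \<beta> e e'
    proof -
      have f: "?f e \<in> ?f ` entries \<alpha>" "?f e' \<in> ?f ` entries \<beta>" using that by blast+
      have fs': "fst (?f e) = fst (?f e') \<or> snd (?f e) = snd (?f e')" using fs by auto
      then have "?P \<alpha> \<inter> ?P \<beta> \<noteq> {}"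
        using f unfolding im[OF that(1)] im[OF that(2)] by auto
      then have "\<alpha> = \<beta>" using disj that by blast
      then have "?f e = ?f e'" using f fs' unfolding im[OF that(1)] im[OF that(2)] by auto
      then show ?thesis
        using entries_pos_inj[of \<alpha> T n \<beta> e e'] that D by (auto intro: prod_eqI)
    qed
    have "inj_on fst (\<Union>\<alpha>\<in>D. entries \<alpha>)" "inj_on snd (\<Union>\<alpha>\<in>D. entries \<alpha>)"
      by (rule inj_onI; use eq in blast)+
    then show "basic_entries (\<Union>\<alpha>\<in>D. entries \<alpha>)" by (simp add: basic_entries_def)
  qed
  then show ?thesis using D by (simp add: basic_subset_def)
qed (simp add: basic_subset_def)

lemma all_pos_conv:
  "(\<forall>k::int. i < k \<and> k < j \<longrightarrow> P (nat k - 1)) \<longleftrightarrow> (\<forall>k. nat i - 1 < k \<and> k < nat j - 1 \<longrightarrow> P k)" if "1 \<le> i"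
proof (intro iffI allI impI)
  fix k assume *: "\<forall>k::int. i < k \<and> k < j \<longrightarrow> P (nat k - 1)" and k: "nat i - 1 < k \<and> k < nat j - 1"
  have "i < int k + 1 \<and> int k + 1 < j" using k that by linarith
  then have "P (nat (int k + 1) - 1)" using * by blast
  then show "P k" by (simp add: nat_add_distrib)
next
  fix k :: int assume *: "\<forall>k. nat i - 1 < k \<and> k < nat j - 1 \<longrightarrow> P k" and k: "i < k \<and> k < j"
  have "nat i - 1 < nat k - 1 \<and> nat k - 1 < nat j - 1" using k that by linarith
  then show "P (nat k - 1)" using * by blast
qed

text \<open>For \<open>EpsMinus\<close> and \<open>Eps\<close> the second row condition ranges over
  no columns, and for \<open>TwoEps\<close> it repeats the first. For \<open>EpsPlus\<close> the
  bound l \<preceq> 0 includes column 0 exactly in the odd orthogonal case, which is what the bound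
  m - n expresses.\<close>

lemma U_root_eq:
  assumes "\<alpha> \<in> \<Phi> T n"
  shows "(U_root T n \<alpha> :: 'a::field mat set) =
    carrier (U T n) \<inter> row_subgroup (mdim T n) (root_fst \<alpha>) (root_snd T n \<alpha>) (root_cut n \<alpha>)"
proof -
  have row: "(\<forall>k. i < k \<and> k < j \<longrightarrow> coef T n x i k = 0) \<longleftrightarrow>
      (\<forall>k. nat i - 1 < k \<and> k < nat j - 1 \<longrightarrow> x $$ (nat i - 1, k) = 0)" if "1 \<le> i" for i j and x :: "'a mat"
    using all_pos_conv[OF that, of j "\<lambda>k. x $$ (nat i - 1, k) = 0"] that by (auto simp: coef_def pos_def)
  have row': "(\<forall>k. i < k \<and> k \<le> int n \<longrightarrow> coef T n x i k = 0) \<longleftrightarrow>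
      (\<forall>k. nat i - 1 < k \<and> k < n \<longrightarrow> x $$ (nat i - 1, k) = 0)" if "1 \<le> i" for i and x :: "'a mat"
    using row[OF that, of "int n + 1" x] by (simp add: nat_add_distrib zle_add1_eq_le[symmetric] del: zle_add1_eq_le)
  have mU: "x \<in> unitriangular (mdim T n)" if "x \<in> carrier (U T n)" for x :: "'a mat"
    by (rule U_unitriangular[OF that])
  show ?thesis
    using assms
  proof (cases rule: root_cases)
    case (EpsMinus i j)
    have v: "\<not> (mdim T n - nat j < k \<and> k < mdim T n - (nat j - 1))" for k using EpsMinus by (auto simp: mdim_def)
    then show ?thesis
      unfolding EpsMinus(1) U_root.simps row[OF EpsMinus(2)] using mU by (auto simp: row_subgroup_def)
  next
    case (EpsPlus i j)
    have j1: "1 \<le> j" using EpsPlus by simp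
    have lab: "(\<forall>l\<in>labels T n. j \<prec> l \<and> l \<preceq> 0 \<longrightarrow> coef T n x j l = 0) \<longleftrightarrow>
      (\<forall>k. nat j - 1 < k \<and> k < mdim T n - n \<longrightarrow> x $$ (nat j - 1, k) = 0)" for x :: "'a mat"
    proof (cases "T = OddOrthogonal")
      case True
      have "(\<forall>l\<in>labels T n. j \<prec> l \<and> l \<preceq> 0 \<longrightarrow> coef T n x j l = 0) \<longleftrightarrow>
          (\<forall>k. j < k \<and> k \<le> int n \<longrightarrow> coef T n x j k = 0) \<and> coef T n x j 0 = 0"
        using True EpsPlus by (auto simp: labels_def prec_def preceq_def)
      also have "\<dots> \<longleftrightarrow> (\<forall>k. nat j - 1 < k \<and> k < n \<longrightarrow> x $$ (nat j - 1, k) = 0) \<and> x $$ (nat j - 1, n) = 0"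
        unfolding row'[OF j1] using j1 by (simp add: coef_def pos_def)
      also have "\<dots> \<longleftrightarrow> (\<forall>k. nat j - 1 < k \<and> k < Suc n \<longrightarrow> x $$ (nat j - 1, k) = 0)"
        using EpsPlus by (auto simp: less_Suc_eq)
      finally show ?thesis using True by (simp add: mdim_def rdim_def)
    next
      case False
      have "(\<forall>l\<in>labels T n. j \<prec> l \<and> l \<preceq> 0 \<longrightarrow> coef T n x j l = 0) \<longleftrightarrow>
          (\<forall>k. j < k \<and> k \<le> int n \<longrightarrow> coef T n x j k = 0)"
        using False EpsPlus by (auto simp: labels_def prec_def preceq_def)
      then show ?thesis unfolding row'[OF j1] using False by (simp add: mdim_def rdim_def)
    qed
    show ?thesis
      unfolding EpsPlus(1) U_root.simps row'[OF EpsPlus(2)] lab using mU by (auto simp: row_subgroup_def)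
  next
    case (TwoEps i)
    have "mdim T n - n = n" using TwoEps by (simp add: mdim_def rdim_def)
    then show ?thesis
      unfolding TwoEps(1) U_root.simps row'[OF TwoEps(3)] using mU by (auto simp: row_subgroup_def)
  next
    case (Eps i)
    have v: "\<not> (n < k \<and> k < mdim T n - n)" for k using Eps by (auto simp: mdim_def rdim_def)
    then show ?thesis
      unfolding Eps(1) U_root.simps row'[OF Eps(3)] using mU by (auto simp: row_subgroup_def)
  qed
qed

lemma lin_char_eq:
  assumes "\<alpha> \<in> \<Phi> T n"
  shows "lin_char T n \<theta> \<alpha> r = (\<lambda>x. \<theta> (r * x $$ (root_fst \<alpha>, mdim T n - 1 - root_snd T n \<alpha>)))"
  using assms
  by (cases rule: root_cases)
    (use assms in \<open>auto simp: lin_char_def dist_entry_eq coef_def pos_def fun_eq_iff mdim_def rdim_def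
       diff_diff_left intro!: arg_cong[of _ _ \<theta>]\<close>)

section \<open>Forms attached to sets of roots\<close>

definition root_coeff :: "gtype \<Rightarrow> nat \<Rightarrow> (eps_root \<Rightarrow> 'a::field) \<Rightarrow> eps_root \<Rightarrow> 'a" where
  "root_coeff T n \<phi> \<alpha> = \<phi> \<alpha> * gram_sign T n (root_snd T n \<alpha>)"

text \<open>The sign inside \<open>root_coeff\<close> is the one relating a matrix entry to its
  Cayley coordinate in \<open>entry_cayley\<close>, so the form describes the characters
  \<open>lin_char\<close> directly.\<close>

definition root_form :: "gtype \<Rightarrow> nat \<Rightarrow> eps_root set \<Rightarrow> (eps_root \<Rightarrow> 'a::field) \<Rightarrow> 'a mat" where
  "root_form T n D \<phi> = mat (mdim T n) (mdim T n) (\<lambda>(i, j). \<Sum>\<alpha>\<in>D.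
     (root_coeff T n \<phi> \<alpha> \<cdot>\<^sub>m sym_unit (form_sign T) (mdim T n) (root_fst \<alpha>) (root_snd T n \<alpha>)) $$ (i, j))"

lemma root_lt:
  assumes "\<alpha> \<in> \<Phi> T n" shows "root_fst \<alpha> < mdim T n" "root_snd T n \<alpha> < mdim T n"
  using root_bounds(7)[OF assms] by linarith+

lemma root_form_corner_forms:
  fixes \<phi> :: "eps_root \<Rightarrow> 'a::field"
  assumes D: "D \<subseteq> \<Phi> T n"
  shows "root_form T n D \<phi> \<in> corner_forms (form_sign T) (mdim T n)"
proof -
  have c: "root_coeff T n \<phi> \<alpha> \<cdot>\<^sub>m sym_unit (form_sign T) (mdim T n) (root_fst \<alpha>) (root_snd T n \<alpha>)
      \<in> corner_forms (form_sign T) (mdim T n)" if "\<alpha> \<in> D" for \<alpha>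
    by (rule sym_unit_corner_forms[OF form_sign_square root_bounds(7)[OF subsetD[OF D that]]])
  show ?thesis
  proof (rule corner_formsI)
    fix i j assume ij: "i < mdim T n" "j < mdim T n"
    show "root_form T n D \<phi> $$ (j, i) = form_sign T * root_form T n D \<phi> $$ (i, j)"
      unfolding root_form_def using ij corner_forms_sym[OF c ij]
      by (simp add: sum_distrib_left del: index_smult_mat)
    assume "mdim T n \<le> i + j + 1"
    then show "root_form T n D \<phi> $$ (i, j) = 0"
      unfolding root_form_def using ij corner_forms_zero[OF c ij] by (simp del: index_smult_mat)
  qed (simp add: root_form_def)
qed

text \<open>The 2 stems from the two symmetric positions of each root and equals the one in
  \<open>elementary_character_avg\<close>.\<close>

lemma pairing_root_form:
  fixes \<phi> :: "eps_root \<Rightarrow> 'a::field"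
  assumes D: "D \<subseteq> \<Phi> T n" and S: "S \<in> corner_forms (form_sign T) (mdim T n)"
  shows "pairing (mdim T n) (root_form T n D \<phi>) S =
    (\<Sum>\<alpha>\<in>D. 2 * root_coeff T n \<phi> \<alpha> * S $$ (root_fst \<alpha>, root_snd T n \<alpha>))"
proof -
  let ?m = "mdim T n"
  let ?E = "\<lambda>\<alpha>. root_coeff T n \<phi> \<alpha> \<cdot>\<^sub>m sym_unit (form_sign T) ?m (root_fst \<alpha>) (root_snd T n \<alpha>)"
  have "pairing ?m (root_form T n D \<phi>) S = (\<Sum>i<?m. \<Sum>j<?m. \<Sum>\<alpha>\<in>D. ?E \<alpha> $$ (i, j) * S $$ (i, j))"
    by (simp add: pairing_def root_form_def sum_distrib_right del: index_smult_mat)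
  also have "\<dots> = (\<Sum>i<?m. \<Sum>\<alpha>\<in>D. \<Sum>j<?m. ?E \<alpha> $$ (i, j) * S $$ (i, j))"
    by (intro sum.cong refl sum.swap)
  also have "\<dots> = (\<Sum>\<alpha>\<in>D. pairing ?m (?E \<alpha>) S)"
    unfolding pairing_def by (rule sum.swap)
  also have "\<dots> = (\<Sum>\<alpha>\<in>D. 2 * root_coeff T n \<phi> \<alpha> * S $$ (root_fst \<alpha>, root_snd T n \<alpha>))"
  proof (rule sum.cong[OF refl])
    fix \<alpha> assume "\<alpha> \<in> D"
    then have a: "\<alpha> \<in> \<Phi> T n" using D by blast
    have "S $$ (root_fst \<alpha>, root_snd T n \<alpha>) = form_sign T * S $$ (root_snd T n \<alpha>, root_fst \<alpha>)"
      by (rule corner_forms_sym[OF S root_lt(2,1)[OF a]])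
    then show "pairing ?m (?E \<alpha>) S = 2 * root_coeff T n \<phi> \<alpha> * S $$ (root_fst \<alpha>, root_snd T n \<alpha>)"
      unfolding pairing_sym_unit[OF root_lt[OF a]] by simp
  qed
  finally show ?thesis .
qed

lemma root_form_index:
  fixes \<phi> :: "eps_root \<Rightarrow> 'a::field"
  assumes D: "D \<subseteq> \<Phi> T n" and a: "\<alpha> \<in> \<Phi> T n"
  shows "root_form T n D \<phi> $$ (root_fst \<alpha>, root_snd T n \<alpha>) =
    (if \<alpha> \<in> D then root_coeff T n \<phi> \<alpha> * (if root_fst \<alpha> = root_snd T n \<alpha> then 2 else 1) else 0)"
proof -
  let ?a = "root_fst \<alpha>" and ?b = "root_snd T n \<alpha>"
  have finD: "finite D" using finite_subset[OF D finite_\<Phi>] .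
  have "root_form T n D \<phi> $$ (?a, ?b) = (\<Sum>\<beta>\<in>D.
      (root_coeff T n \<phi> \<beta> \<cdot>\<^sub>m sym_unit (form_sign T) (mdim T n) (root_fst \<beta>) (root_snd T n \<beta>)) $$ (?a, ?b))"
    unfolding root_form_def using root_lt[OF a] by (simp del: index_smult_mat)
  also have "\<dots> = (\<Sum>\<beta>\<in>D. if \<beta> = \<alpha> then root_coeff T n \<phi> \<alpha> * (if ?a = ?b then 2 else 1) else 0)"
  proof (rule sum.cong[OF refl])
    fix \<beta> assume "\<beta> \<in> D"
    then have b: "\<beta> \<in> \<Phi> T n" using D by blast
    have 1: "?a = root_fst \<beta> \<and> ?b = root_snd T n \<beta> \<longleftrightarrow> \<beta> = \<alpha>" using root_eqI[OF b a] by auto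
    \<comment> \<open>Because \<open>root_fst\<close> never exceeds \<open>root_snd\<close>, a
      transposed unit hits this position only on the diagonal, where the two terms add up to
      2.\<close>
    have 2: "?a = root_snd T n \<beta> \<and> ?b = root_fst \<beta> \<longleftrightarrow> \<beta> = \<alpha> \<and> ?a = ?b"
      using root_bounds(5)[OF a] root_bounds(5)[OF b] root_eqI[OF b a] by auto
    have 3: "form_sign T = (1::'a)" if "?a = ?b" using root_bounds(6)[OF a that] by (simp add: form_sign_def)
    show "(root_coeff T n \<phi> \<beta> \<cdot>\<^sub>m sym_unit (form_sign T) (mdim T n) (root_fst \<beta>) (root_snd T n \<beta>)) $$ (?a, ?b) =
      (if \<beta> = \<alpha> then root_coeff T n \<phi> \<alpha> * (if ?a = ?b then 2 else 1) else 0)"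
      unfolding sym_unit_def using root_lt[OF a] 1 2 3 by (cases "\<beta> = \<alpha>"; cases "?a = ?b") auto
  qed
  finally show ?thesis using finD by simp
qed

lemma root_form_nonzero:
  assumes D: "D \<subseteq> \<Phi> T n" and ij: "i < mdim T n" "j < mdim T n" and nz: "root_form T n D \<phi> $$ (i, j) \<noteq> (0::'a::field)"
  obtains \<alpha> where "\<alpha> \<in> D" "i = root_fst \<alpha> \<and> j = root_snd T n \<alpha> \<or> i = root_snd T n \<alpha> \<and> j = root_fst \<alpha>"
proof -
  have "\<exists>\<alpha>\<in>D. (root_coeff T n \<phi> \<alpha> \<cdot>\<^sub>m sym_unit (form_sign T) (mdim T n) (root_fst \<alpha>) (root_snd T n \<alpha>)) $$ (i, j) \<noteq> 0"
  proof (rule ccontr)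
    assume "\<not> ?thesis"
    then have "root_form T n D \<phi> $$ (i, j) = 0"
      unfolding root_form_def using ij by (simp del: index_smult_mat)
    then show False using nz by simp
  qed
  then obtain \<alpha> where \<alpha>: "\<alpha> \<in> D"
    "(root_coeff T n \<phi> \<alpha> \<cdot>\<^sub>m sym_unit (form_sign T) (mdim T n) (root_fst \<alpha>) (root_snd T n \<alpha>)) $$ (i, j) \<noteq> 0"
    by blast
  show thesis
  proof (rule that[OF \<alpha>(1)], rule ccontr)
    assume "\<not> (i = root_fst \<alpha> \<and> j = root_snd T n \<alpha> \<or> i = root_snd T n \<alpha> \<and> j = root_fst \<alpha>)"
    then have "\<not> (i = root_fst \<alpha> \<and> j = root_snd T n \<alpha>)" "\<not> (i = root_snd T n \<alpha> \<and> j = root_fst \<alpha>)"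
      by blast+
    then show False using \<alpha>(2) ij by (auto simp: sym_unit_def of_bool_def split: if_splits)
  qed
qed

lemma root_form_matching:
  fixes \<phi> :: "eps_root \<Rightarrow> 'a::field"
  assumes "basic_subset T n D"
  shows "matching (mdim T n) (root_form T n D \<phi>)"
  unfolding matching_def
proof (intro allI impI)
  fix i j l assume ij: "i < mdim T n" "j < mdim T n" and l: "l < mdim T n"
    and nz: "root_form T n D \<phi> $$ (i, j) \<noteq> 0 \<and> root_form T n D \<phi> $$ (i, l) \<noteq> 0"
  have D: "D \<subseteq> \<Phi> T n" using assms by (simp add: basic_subset_iff)
  obtain \<alpha> where \<alpha>: "\<alpha> \<in> D" "i = root_fst \<alpha> \<and> j = root_snd T n \<alpha> \<or> i = root_snd T n \<alpha> \<and> j = root_fst \<alpha>"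
    using root_form_nonzero[OF D ij] nz by blast
  obtain \<beta> where \<beta>: "\<beta> \<in> D" "i = root_fst \<beta> \<and> l = root_snd T n \<beta> \<or> i = root_snd T n \<beta> \<and> l = root_fst \<beta>"
    using root_form_nonzero[OF D ij(1) l] nz by blast
  have "\<alpha> = \<beta>" using assms \<alpha> \<beta> unfolding basic_subset_iff by blast
  then show "j = l" using \<alpha> \<beta> by auto
qed

text \<open>Nonzero values make D visible as the support of the form, and membership in the
  extensional product fixes \<phi> by its values on D.\<close>

lemma root_form_inj:
  fixes \<phi> \<phi>' :: "eps_root \<Rightarrow> 'a::field"
  assumes two: "(2::'a) \<noteq> 0" and D: "D \<subseteq> \<Phi> T n" "D' \<subseteq> \<Phi> T n"
    and \<phi>: "\<phi> \<in> D \<rightarrow>\<^sub>E UNIV - {0}" "\<phi>' \<in> D' \<rightarrow>\<^sub>E UNIV - {0}"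
    and eq: "root_form T n D \<phi> = root_form T n D' \<phi>'"
  shows "D = D'" "\<phi> = \<phi>'"
proof -
  have gs: "gram_sign T n i \<noteq> (0::'a)" for i by (simp add: gram_sign_def)
  have e: "(if \<alpha> \<in> D then root_coeff T n \<phi> \<alpha> * (if root_fst \<alpha> = root_snd T n \<alpha> then 2 else 1) else 0) =
    (if \<alpha> \<in> D' then root_coeff T n \<phi>' \<alpha> * (if root_fst \<alpha> = root_snd T n \<alpha> then 2 else 1) else 0)"
    if "\<alpha> \<in> \<Phi> T n" for \<alpha>
    using root_form_index[OF D(1) that, of \<phi>] root_form_index[OF D(2) that, of \<phi>'] eq by simp
  have nz: "root_coeff T n \<phi> \<alpha> \<noteq> 0" if "\<alpha> \<in> D" for \<alpha> using \<phi>(1) that gs by (auto simp: root_coeff_def)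
  have nz': "root_coeff T n \<phi>' \<alpha> \<noteq> 0" if "\<alpha> \<in> D'" for \<alpha> using \<phi>(2) that gs by (auto simp: root_coeff_def)
  have iff: "\<alpha> \<in> D \<longleftrightarrow> \<alpha> \<in> D'" for \<alpha>
    using e[of \<alpha>] nz[of \<alpha>] nz'[of \<alpha>] two D by (auto split: if_splits)
  then show DD: "D = D'" by blast
  have "\<phi> \<alpha> = \<phi>' \<alpha>" if "\<alpha> \<in> D" for \<alpha>
    using e[of \<alpha>] that iff[of \<alpha>] D two gs by (auto simp: root_coeff_def split: if_splits)
  then show "\<phi> = \<phi>'" using \<phi> unfolding DD by (intro PiE_ext) auto
qed

lemma root_form_surj:
  fixes S :: "'a::field mat"
  assumes two: "(2::'a) \<noteq> 0" and S: "S \<in> corner_forms (form_sign T) (mdim T n)" and M: "matching (mdim T n) S"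
  obtains D \<phi> where "basic_subset T n D" "\<phi> \<in> D \<rightarrow>\<^sub>E UNIV - {0}" "root_form T n D \<phi> = S"
proof -
  let ?m = "mdim T n"
  define D where "D = {\<alpha> \<in> \<Phi> T n. S $$ (root_fst \<alpha>, root_snd T n \<alpha>) \<noteq> 0}"
  \<comment> \<open>Solves \<open>root_form_index\<close> for \<phi>: the sign is its own inverse
    and the diagonal factor is divided out.\<close>
  define \<phi> where "\<phi> = restrict (\<lambda>\<alpha>. S $$ (root_fst \<alpha>, root_snd T n \<alpha>) * gram_sign T n (root_snd T n \<alpha>)
    / (if root_fst \<alpha> = root_snd T n \<alpha> then 2 else 1)) D"
  have D: "D \<subseteq> \<Phi> T n" by (auto simp: D_def)
  have gs: "gram_sign T n i \<noteq> (0::'a)" for i by (simp add: gram_sign_def)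
  have \<phi>: "\<phi> \<in> D \<rightarrow>\<^sub>E UNIV - {0}" using two gs by (auto simp: \<phi>_def D_def)
  have "basic_subset T n D"
    unfolding basic_subset_iff
  proof (intro conjI ballI impI D, rule ccontr)
    fix \<alpha> \<beta> assume ab: "\<alpha> \<in> D" "\<beta> \<in> D" "\<alpha> \<noteq> \<beta>"
      and ne: "{root_fst \<alpha>, root_snd T n \<alpha>} \<inter> {root_fst \<beta>, root_snd T n \<beta>} \<noteq> {}"
    obtain p where p: "p \<in> {root_fst \<alpha>, root_snd T n \<alpha>}" "p \<in> {root_fst \<beta>, root_snd T n \<beta>}" using ne by blast
    have partner: "\<exists>c<?m. S $$ (p, c) \<noteq> 0 \<and> {p, c} = {root_fst \<gamma>, root_snd T n \<gamma>}"
      if g: "\<gamma> \<in> D" "p \<in> {root_fst \<gamma>, root_snd T n \<gamma>}" for \<gamma>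
    proof -
      have G: "\<gamma> \<in> \<Phi> T n" "S $$ (root_fst \<gamma>, root_snd T n \<gamma>) \<noteq> 0" using g by (auto simp: D_def)
      then have "S $$ (root_snd T n \<gamma>, root_fst \<gamma>) \<noteq> 0"
        using corner_forms_nonzero_sym[OF S form_sign_square root_lt[OF G(1)]] by simp
      then show ?thesis using g(2) G root_lt[OF G(1)] by (auto simp: insert_commute)
    qed
    obtain c c' where c: "c < ?m" "S $$ (p, c) \<noteq> 0" "{p, c} = {root_fst \<alpha>, root_snd T n \<alpha>}"
      "c' < ?m" "S $$ (p, c') \<noteq> 0" "{p, c'} = {root_fst \<beta>, root_snd T n \<beta>}"
      using partner[OF ab(1) p(1)] partner[OF ab(2) p(2)] by blast
    have A: "\<alpha> \<in> \<Phi> T n" and B: "\<beta> \<in> \<Phi> T n" using ab D by auto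
    have "p < ?m" using p(1) root_lt[OF A] by auto
    then have "c = c'" using M c unfolding matching_def by blast
    then have "{root_fst \<alpha>, root_snd T n \<alpha>} = {root_fst \<beta>, root_snd T n \<beta>}" using c by simp
    then have "root_fst \<alpha> = root_fst \<beta> \<and> root_snd T n \<alpha> = root_snd T n \<beta>"
      using root_bounds(5)[OF A] root_bounds(5)[OF B] by (auto simp: doubleton_eq_iff)
    then show False using root_eqI[OF A B] ab(3) by simp
  qed
  moreover have "root_form T n D \<phi> = S"
  proof -
    note R = root_form_corner_forms[OF D, of \<phi>]
    have le: "root_form T n D \<phi> $$ (i, j) = S $$ (i, j)" if ij: "i < ?m" "j < ?m" "i \<le> j" for i j
    proof (cases "?m \<le> i + j + 1")
      case True
      then show ?thesis using corner_forms_zero[OF R ij(1,2)] corner_forms_zero[OF S ij(1,2)] by simp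
    next
      case False
      show ?thesis
      proof (cases "i = j \<and> T \<noteq> Symplectic")
        case True
        \<comment> \<open>Diagonal positions of alternating forms belong to no root, but both forms
          vanish there since 2 is invertible.\<close>
        have "X $$ (i, i) = 0" if X: "X \<in> corner_forms (form_sign T) ?m" for X :: "'a mat"
        proof -
          have "X $$ (i, i) = - X $$ (i, i)"
            using corner_forms_sym[OF X ij(1) ij(1)] True by (simp add: form_sign_def)
          then have "2 * X $$ (i, i) = 0" by (metis add.left_inverse mult_2)
          then show ?thesis using two by simp
        qed
        then show ?thesis using True R S by simp
      next
        case diag: False
        obtain \<alpha> where \<alpha>: "\<alpha> \<in> \<Phi> T n" "root_fst \<alpha> = i" "root_snd T n \<alpha> = j"
          using root_exists[OF ij(3), of T n] False diag by auto
        have "root_form T n D \<phi> $$ (root_fst \<alpha>, root_snd T n \<alpha>) = S $$ (root_fst \<alpha>, root_snd T n \<alpha>)"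
          unfolding root_form_index[OF D \<alpha>(1)] using \<alpha>(1) two
          by (auto simp: D_def \<phi>_def root_coeff_def gram_sign_square mult.assoc)
        then show ?thesis by (simp add: \<alpha>)
      qed
    qed
    show ?thesis
    proof (rule eq_matI)
      fix i j assume "i < dim_row S" "j < dim_col S"
      then have ij: "i < ?m" "j < ?m" using corner_forms_carrier[OF S] by auto
      show "root_form T n D \<phi> $$ (i, j) = S $$ (i, j)"
      proof (cases "i \<le> j")
        case False
        then show ?thesis
          using le[OF ij(2,1)] corner_forms_sym[OF R ij(2,1)] corner_forms_sym[OF S ij(2,1)] by simp
      qed (use le ij in simp)
    qed (use corner_forms_carrier[OF S] in \<open>auto simp: root_form_def\<close>)
  qed
  ultimately show thesis using that \<phi> by blast
qed

section \<open>Products of averages over independent rows\<close>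

text \<open>The rows of a uniformly chosen unitriangular matrix are independent, so functions
  depending on disjoint sets of rows are independent random variables.\<close>

definition row_dep :: "nat \<Rightarrow> nat set \<Rightarrow> ('a::field mat \<Rightarrow> complex) \<Rightarrow> bool" where
  "row_dep m R F \<longleftrightarrow> (\<forall>g\<in>unitriangular m. \<forall>g'\<in>unitriangular m.
     (\<forall>i<m. \<forall>j<m. i \<in> R \<longrightarrow> g $$ (i, j) = g' $$ (i, j)) \<longrightarrow> F g = F g')"

lemma row_depD:
  assumes "row_dep m R F" "g \<in> unitriangular m" "g' \<in> unitriangular m"
    and "\<And>i j. i < m \<Longrightarrow> j < m \<Longrightarrow> i \<in> R \<Longrightarrow> g $$ (i, j) = g' $$ (i, j)"
  shows "F g = F g'"
  using assms unfolding row_dep_def by blast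

lemma row_dep_prod:
  fixes F :: "'i \<Rightarrow> 'a::field mat \<Rightarrow> complex"
  assumes "\<And>i. i \<in> I \<Longrightarrow> row_dep m (R i) (F i)"
  shows "row_dep m (\<Union>i\<in>I. R i) (\<lambda>g. \<Prod>i\<in>I. F i g)"
  unfolding row_dep_def
proof (intro ballI impI prod.cong refl)
  fix g g' :: "'a mat" and i assume g: "g \<in> unitriangular m" "g' \<in> unitriangular m"
    and eq: "\<forall>k<m. \<forall>j<m. k \<in> (\<Union>i\<in>I. R i) \<longrightarrow> g $$ (k, j) = g' $$ (k, j)" and i: "i \<in> I"
  show "F i g = F i g'" by (rule row_depD[OF assms[OF i] g]) (use eq i in blast)
qed

text \<open>Exchanging the rows in \<open>R\<close> between \<open>g\<close> and \<open>g'\<close> permutes the pairs of unitriangular matrices.\<close>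

lemma sum_mult_row_dep:
  fixes F H :: "'a::{field,finite} mat \<Rightarrow> complex"
  assumes F: "row_dep m R F" and H: "row_dep m R' H" and disj: "R \<inter> R' = {}"
  shows "(\<Sum>g\<in>unitriangular m. F g) * (\<Sum>g\<in>unitriangular m. H g) =
    of_nat (card (unitriangular m :: 'a mat set)) * (\<Sum>g\<in>unitriangular m. F g * H g)"
proof -
  let ?G = "unitriangular m :: 'a mat set"
  define mix :: "'a mat \<Rightarrow> 'a mat \<Rightarrow> 'a mat" where
    "mix g g' = mat m m (\<lambda>(i, j). if i \<in> R then g $$ (i, j) else g' $$ (i, j))" for g g'
  have mix: "mix g g' \<in> ?G" if "g \<in> ?G" "g' \<in> ?G" for g g'
    by (rule unitriangularI) (use that in \<open>auto simp: mix_def unitriangular_index\<close>)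
  have inv: "mix (mix g g') (mix g' g) = g" if "g \<in> ?G" "g' \<in> ?G" for g g'
    using unitriangular_carrier[OF that(1)] by (intro eq_matI) (auto simp: mix_def)
  have "(\<Sum>g\<in>?G. F g) * (\<Sum>g\<in>?G. H g) = (\<Sum>p\<in>?G \<times> ?G. F (fst p) * H (snd p))"
    by (simp add: sum_product sum.cartesian_product case_prod_unfold)
  also have "\<dots> = (\<Sum>p\<in>?G \<times> ?G. F (fst p) * H (fst p))"
  proof (rule sum.reindex_bij_witness[of _ "\<lambda>p. (mix (fst p) (snd p), mix (snd p) (fst p))"
        "\<lambda>p. (mix (fst p) (snd p), mix (snd p) (fst p))"])
    fix p assume "p \<in> ?G \<times> ?G"
    then have p: "fst p \<in> ?G" "snd p \<in> ?G" by auto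
    have "F (mix (fst p) (snd p)) = F (fst p)"
      by (rule row_depD[OF F mix[OF p] p(1)]) (simp add: mix_def)
    moreover have "H (mix (fst p) (snd p)) = H (snd p)"
      by (rule row_depD[OF H mix[OF p] p(2)]) (use disj in \<open>auto simp: mix_def\<close>)
    ultimately show "F (fst (mix (fst p) (snd p), mix (snd p) (fst p))) * H (fst (mix (fst p) (snd p), mix (snd p) (fst p))) =
        F (fst p) * H (snd p)" by simp
  qed (auto simp: mix inv)
  also have "\<dots> = (\<Sum>g\<in>?G. \<Sum>g'\<in>?G. F g * H g)"
    by (simp only: sum.cartesian_product case_prod_unfold)
  finally show ?thesis by (simp add: sum_distrib_left)
qed

lemma prod_avg_row_dep:
  fixes F :: "'i \<Rightarrow> 'a::{field,finite} mat \<Rightarrow> complex"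
  assumes "finite I" "\<And>i. i \<in> I \<Longrightarrow> row_dep m (R i) (F i)"
    and "\<And>i j. i \<in> I \<Longrightarrow> j \<in> I \<Longrightarrow> i \<noteq> j \<Longrightarrow> R i \<inter> R j = {}"
  shows "(\<Prod>i\<in>I. (\<Sum>g\<in>unitriangular m. F i g) / of_nat (card (unitriangular m :: 'a mat set))) =
    (\<Sum>g\<in>unitriangular m. \<Prod>i\<in>I. F i g) / of_nat (card (unitriangular m :: 'a mat set))"
  using assms
proof (induction I rule: finite_induct)
  case empty
  then show ?case using card_unitriangular_pos[of m, where 'a='a] by simp
next
  case (insert x I)
  let ?N = "of_nat (card (unitriangular m :: 'a mat set)) :: complex"
  have N: "?N \<noteq> 0" using card_unitriangular_pos[of m, where 'a='a] by simp
  have IH: "(\<Prod>i\<in>I. (\<Sum>g\<in>unitriangular m. F i g) / ?N) = (\<Sum>g\<in>unitriangular m. \<Prod>i\<in>I. F i g) / ?N"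
    using insert by simp
  have "R x \<inter> (\<Union>i\<in>I. R i) = {}" using insert.prems(2)[of x] insert.hyps(2) by blast
  then have "(\<Sum>g\<in>unitriangular m. F x g) * (\<Sum>g\<in>unitriangular m. \<Prod>i\<in>I. F i g) =
      ?N * (\<Sum>g\<in>unitriangular m. F x g * (\<Prod>i\<in>I. F i g))"
    using insert.prems(1) by (intro sum_mult_row_dep[of m "R x" _ "\<Union>i\<in>I. R i"] row_dep_prod) auto
  then show ?case
    using insert.hyps N by (simp add: IH)
qed

section \<open>Supercharacters as orbit averages\<close>

lemma elementary_character_pos_def:
  fixes \<theta> :: "'a::{field,finite} \<Rightarrow> complex"
  assumes \<theta>: "linear_character_add \<theta>" and a: "\<alpha> \<in> \<Phi> T n"
  shows "pos_def (U T n) (elementary_character T n \<theta> \<alpha> r)"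
proof -
  have "root_cut n \<alpha> \<le> mdim T n" using root_bounds(2)[OF a] by (simp add: mdim_def)
  then show ?thesis
    unfolding elementary_character_def U_root_eq[OF a] lin_char_eq[OF a]
    using root_bounds[OF a] by (intro induced_row_subgroup_pos_def[OF \<theta>])
qed

text \<open>The constant is the index of the row subgroup of \<alpha> in the unitriangular group.
  Keeping only that it is nonzero suffices, as just the vanishing of scalar products is at
  stake.\<close>

lemma elementary_character_avg:
  fixes \<theta> :: "'a::{field,finite} \<Rightarrow> complex"
  assumes \<theta>: "linear_character_add \<theta>" "\<exists>a. \<theta> a \<noteq> 1" and two: "(2::'a) \<noteq> 0"
    and a: "\<alpha> \<in> \<Phi> T n" and r: "\<phi> \<alpha> \<noteq> 0"
  shows "\<exists>c. c \<noteq> 0 \<and> (\<forall>u\<in>carrier (U T n). elementary_character T n \<theta> \<alpha> (\<phi> \<alpha>) u =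
    c * ((\<Sum>g\<in>unitriangular (mdim T n). \<theta> (2 * root_coeff T n \<phi> \<alpha> *
        (g * cayley T n u * g\<^sup>T) $$ (root_fst \<alpha>, root_snd T n \<alpha>)))
      / of_nat (card (unitriangular (mdim T n) :: 'a mat set))))"
proof -
  let ?Q = "row_subgroup (mdim T n) (root_fst \<alpha>) (root_snd T n \<alpha>) (root_cut n \<alpha>) :: 'a mat set"
  let ?N = "of_nat (card (unitriangular (mdim T n) :: 'a mat set)) :: complex"
  have N: "?N \<noteq> 0" using card_unitriangular_pos[of "mdim T n", where 'a='a] by simp
  have "root_cut n \<alpha> \<le> mdim T n" using root_bounds(2)[OF a] by (simp add: mdim_def)
  then have "card ?Q \<noteq> 0"
    using subgroup.one_closed[OF row_subgroup_subgroup[OF root_lt[OF a]]] finite_row_subgroup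
    by (metis card_eq_0_iff empty_iff)
  then have c: "?N / of_nat (card ?Q) \<noteq> 0" using N by simp
  show ?thesis
  proof (intro exI conjI ballI, rule c)
    fix u :: "'a mat" assume u: "u \<in> carrier (U T n)"
    show "elementary_character T n \<theta> \<alpha> (\<phi> \<alpha>) u = ?N / of_nat (card ?Q) *
       ((\<Sum>g\<in>unitriangular (mdim T n). \<theta> (2 * root_coeff T n \<phi> \<alpha> *
        (g * cayley T n u * g\<^sup>T) $$ (root_fst \<alpha>, root_snd T n \<alpha>))) / ?N)"
      unfolding elementary_character_def U_root_eq[OF a] lin_char_eq[OF a]
      using induced_row_subgroup[OF \<theta> two root_bounds(1-4)[OF a] root_bounds(6)[OF a] r u] N
      by (simp add: root_coeff_def mult.assoc)
  qed
qed

lemma supercharacter_orbit_avg: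
  fixes \<theta> :: "'a::{field,finite} \<Rightarrow> complex"
  assumes \<theta>: "linear_character_add \<theta>" "\<exists>a. \<theta> a \<noteq> 1" and two: "(2::'a) \<noteq> 0"
    and D: "basic_subset T n D" and \<phi>: "\<phi> \<in> D \<rightarrow>\<^sub>E UNIV - {0}"
  obtains c where "c \<noteq> 0" "\<And>u. u \<in> carrier (U T n) \<Longrightarrow>
    supercharacter T n \<theta> D \<phi> u = c * orbit_avg \<theta> (mdim T n) (root_form T n D \<phi>) (cayley T n u)"
proof -
  let ?m = "mdim T n" and ?G = "unitriangular (mdim T n) :: 'a mat set"
  let ?N = "of_nat (card (unitriangular (mdim T n) :: 'a mat set)) :: complex"
  let ?F = "\<lambda>u \<alpha> g. \<theta> (2 * root_coeff T n \<phi> \<alpha> * (g * cayley T n u * g\<^sup>T) $$ (root_fst \<alpha>, root_snd T n \<alpha>))"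
  have D\<Phi>: "D \<subseteq> \<Phi> T n" using D by (simp add: basic_subset_iff)
  have finD: "finite D" by (rule finite_subset[OF D\<Phi> finite_\<Phi>])
  have "\<forall>\<alpha>\<in>D. \<exists>c. c \<noteq> 0 \<and> (\<forall>u\<in>carrier (U T n). elementary_character T n \<theta> \<alpha> (\<phi> \<alpha>) u = c * ((\<Sum>g\<in>?G. ?F u \<alpha> g) / ?N))"
  proof
    fix \<alpha> assume "\<alpha> \<in> D"
    then have "\<alpha> \<in> \<Phi> T n" "\<phi> \<alpha> \<noteq> 0" using D\<Phi> \<phi> by auto
    then show "\<exists>c. c \<noteq> 0 \<and> (\<forall>u\<in>carrier (U T n). elementary_character T n \<theta> \<alpha> (\<phi> \<alpha>) u = c * ((\<Sum>g\<in>?G. ?F u \<alpha> g) / ?N))"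
      by (rule elementary_character_avg[OF \<theta> two])
  qed
  then obtain c where c': "\<forall>\<alpha>\<in>D. c \<alpha> \<noteq> 0 \<and> (\<forall>u\<in>carrier (U T n).
      elementary_character T n \<theta> \<alpha> (\<phi> \<alpha>) u = c \<alpha> * ((\<Sum>g\<in>?G. ?F u \<alpha> g) / ?N))"
    unfolding bchoice_iff by (elim exE)
  have c: "\<And>\<alpha>. \<alpha> \<in> D \<Longrightarrow> c \<alpha> \<noteq> 0"
    "\<And>\<alpha> u. \<alpha> \<in> D \<Longrightarrow> u \<in> carrier (U T n) \<Longrightarrow>
       elementary_character T n \<theta> \<alpha> (\<phi> \<alpha>) u = c \<alpha> * ((\<Sum>g\<in>?G. ?F u \<alpha> g) / ?N)"
    using c' by simp_all
  show thesis
  proof (rule that)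
    show "(\<Prod>\<alpha>\<in>D. c \<alpha>) \<noteq> 0" using c(1) finD by simp
    fix u :: "'a mat" assume u: "u \<in> carrier (U T n)"
    note S = cayley_corner_forms[OF two u]
    \<comment> \<open>Entry (a, b) of a congruence by g involves only the rows a and b of g.\<close>
    have dep: "row_dep ?m {root_fst \<alpha>, root_snd T n \<alpha>} (?F u \<alpha>)" if "\<alpha> \<in> D" for \<alpha>
      unfolding row_dep_def
    proof (intro ballI impI)
      fix g g' :: "'a mat" assume g: "g \<in> ?G" "g' \<in> ?G"
        and eq: "\<forall>i<?m. \<forall>j<?m. i \<in> {root_fst \<alpha>, root_snd T n \<alpha>} \<longrightarrow> g $$ (i, j) = g' $$ (i, j)"
      have a: "\<alpha> \<in> \<Phi> T n" using that D\<Phi> by blast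
      show "?F u \<alpha> g = ?F u \<alpha> g'"
        unfolding congr_index[OF unitriangular_carrier[OF g(1)] corner_forms_carrier[OF S] root_lt[OF a]]
          congr_index[OF unitriangular_carrier[OF g(2)] corner_forms_carrier[OF S] root_lt[OF a]]
        using eq root_lt[OF a] by simp
    qed
    have "supercharacter T n \<theta> D \<phi> u = (\<Prod>\<alpha>\<in>D. c \<alpha>) * (\<Prod>\<alpha>\<in>D. (\<Sum>g\<in>?G. ?F u \<alpha> g) / ?N)"
      unfolding supercharacter_def prod.distrib[symmetric] by (rule prod.cong) (use c(2) u in auto)
    also have "(\<Prod>\<alpha>\<in>D. (\<Sum>g\<in>?G. ?F u \<alpha> g) / ?N) = (\<Sum>g\<in>?G. \<Prod>\<alpha>\<in>D. ?F u \<alpha> g) / ?N"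
      by (rule prod_avg_row_dep[OF finD dep]) (use D in \<open>auto simp: basic_subset_iff\<close>)
    \<comment> \<open>As \<theta> is additive, the product over D is \<theta> of the pairing with
      \<open>root_form\<close>.\<close>
    also have "\<dots> = orbit_avg \<theta> ?m (root_form T n D \<phi>) (cayley T n u)"
      unfolding orbit_avg_def
      by (intro arg_cong[of _ _ "\<lambda>x. x / _"] sum.cong refl)
        (simp only: pairing_root_form[OF D\<Phi> corner_forms_congr[OF _ S]] linear_character_add_sum[OF \<theta>(1)])
    finally show "supercharacter T n \<theta> D \<phi> u = (\<Prod>\<alpha>\<in>D. c \<alpha>) * orbit_avg \<theta> ?m (root_form T n D \<phi>) (cayley T n u)" .
  qed
qed

lemma supercharacter_pos_def:
  fixes \<theta> :: "'a::{field,finite} \<Rightarrow> complex"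
  assumes "linear_character_add \<theta>" "D \<subseteq> \<Phi> T n"
  shows "pos_def (U T n) (supercharacter T n \<theta> D \<phi>)"
proof -
  have "supercharacter T n \<theta> D \<phi> = (\<lambda>x. \<Prod>\<alpha>\<in>D. elementary_character T n \<theta> \<alpha> (\<phi> \<alpha>) x)"
    by (simp add: supercharacter_def fun_eq_iff)
  moreover have "pos_def (U T n) (\<lambda>x. \<Prod>\<alpha>\<in>D. elementary_character T n \<theta> \<alpha> (\<phi> \<alpha>) x)"
    using assms(2) by (intro pos_def_prod elementary_character_pos_def[OF assms(1)]) blast
  ultimately show ?thesis by simp
qed

lemma supercharacter_class_function:
  fixes \<theta> :: "'a::{field,finite} \<Rightarrow> complex"
  assumes "x \<in> carrier (U T n)" "g \<in> carrier (U T n)"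
  shows "supercharacter T n \<theta> D \<phi> (g \<otimes>\<^bsub>U T n\<^esub> x \<otimes>\<^bsub>U T n\<^esub> inv\<^bsub>U T n\<^esub> g) = supercharacter T n \<theta> D \<phi> x"
  unfolding supercharacter_def elementary_character_def
  using group.induced_class_function[OF group_U assms] by simp

text \<open>The Cayley bijection turns the sum over U into a sum over all corner forms. Different
  pairs give different matching forms, hence disjoint orbits.\<close>

lemma supercharacter_orthogonal:
  fixes \<theta> :: "'a::{field,finite} \<Rightarrow> complex"
  assumes \<theta>: "linear_character_add \<theta>" "\<exists>a. \<theta> a \<noteq> 1" and two: "(2::'a) \<noteq> 0"
    and D: "basic_subset T n D" "\<phi> \<in> D \<rightarrow>\<^sub>E UNIV - {0}"
    and D': "basic_subset T n D'" "\<phi>' \<in> D' \<rightarrow>\<^sub>E UNIV - {0}"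
    and ne: "(D, \<phi>) \<noteq> (D', \<phi>')"
  shows "scalar_product (U T n) (supercharacter T n \<theta> D \<phi>) (supercharacter T n \<theta> D' \<phi>') = 0"
proof -
  let ?m = "mdim T n" and ?\<sigma> = "form_sign T :: 'a"
  let ?R = "root_form T n D \<phi>" and ?R' = "root_form T n D' \<phi>'"
  have sub: "D \<subseteq> \<Phi> T n" "D' \<subseteq> \<Phi> T n" using D(1) D'(1) by (simp_all add: basic_subset_iff)
  note R = root_form_corner_forms[OF sub(1), of \<phi>] root_form_matching[OF D(1), of \<phi>]
  note R' = root_form_corner_forms[OF sub(2), of \<phi>'] root_form_matching[OF D'(1), of \<phi>']
  obtain c where c: "\<And>u. u \<in> carrier (U T n) \<Longrightarrow>
      supercharacter T n \<theta> D \<phi> u = c * orbit_avg \<theta> ?m ?R (cayley T n u)"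
    using supercharacter_orbit_avg[OF \<theta> two D] by blast
  obtain c' where c': "\<And>u. u \<in> carrier (U T n) \<Longrightarrow>
      supercharacter T n \<theta> D' \<phi>' u = c' * orbit_avg \<theta> ?m ?R' (cayley T n u)"
    using supercharacter_orbit_avg[OF \<theta> two D'] by blast
  have "coact ?m ?R g \<noteq> coact ?m ?R' g'" if "g \<in> unitriangular ?m" "g' \<in> unitriangular ?m" for g g'
    using matching_coact_unique[OF form_sign_square R R' that] root_form_inj[OF two sub D(2) D'(2)] ne by blast
  then have orth: "(\<Sum>S\<in>corner_forms ?\<sigma> ?m. orbit_avg \<theta> ?m ?R S * cnj (orbit_avg \<theta> ?m ?R' S)) = 0"
    by (rule orbit_avg_orthogonal[OF \<theta> two form_sign_square R(1) R'(1)])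
  have "(\<Sum>u\<in>carrier (U T n). supercharacter T n \<theta> D \<phi> u * cnj (supercharacter T n \<theta> D' \<phi>' u)) =
    (\<Sum>u\<in>carrier (U T n). c * cnj c' * (orbit_avg \<theta> ?m ?R (cayley T n u) * cnj (orbit_avg \<theta> ?m ?R' (cayley T n u))))"
    by (rule sum.cong) (simp_all add: c c')
  also have "\<dots> = c * cnj c' * (\<Sum>S\<in>corner_forms ?\<sigma> ?m. orbit_avg \<theta> ?m ?R S * cnj (orbit_avg \<theta> ?m ?R' S))"
    unfolding sum_distrib_left[symmetric]
    using sum.reindex_bij_betw[OF cayley_bij[OF two, of T n],
      of "\<lambda>S. orbit_avg \<theta> ?m ?R S * cnj (orbit_avg \<theta> ?m ?R' S)"] by simp
  finally show ?thesis by (simp add: scalar_product_def orth)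
qed

text \<open>Pairing \<chi> with the orbit averages of all forms and adding up leaves \<chi>(1) times
  the number of forms, because these averages sum to a point mass at the identity. So some form
  contributes, and a matching form in its orbit has the same average.\<close>

lemma supercharacter_exists:
  fixes \<theta> :: "'a::{field,finite} \<Rightarrow> complex"
  assumes \<theta>: "linear_character_add \<theta>" "\<exists>a. \<theta> a \<noteq> 1" and two: "(2::'a) \<noteq> 0"
    and chi: "\<chi> (1\<^sub>m (mdim T n)) \<noteq> 0"
  obtains D \<phi> where "basic_subset T n D" "\<phi> \<in> D \<rightarrow>\<^sub>E UNIV - {0}"
    "scalar_product (U T n) \<chi> (supercharacter T n \<theta> D \<phi>) \<noteq> 0"
proof -
  let ?m = "mdim T n" and ?\<sigma> = "form_sign T :: 'a" and ?U = "carrier (U T n :: 'a mat monoid)"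
  let ?C = "corner_forms ?\<sigma> ?m"
  note bij = cayley_bij[OF two, of T n]
  interpret group "U T n :: 'a mat monoid" by (rule group_U)
  have oneU: "1\<^sub>m ?m \<in> ?U" using one_closed by (simp add: U_simps)
  have cay0: "cayley T n u = 0\<^sub>m ?m ?m \<longleftrightarrow> u = 1\<^sub>m ?m" if "u \<in> ?U" for u
    using cayley_one[OF two, of T n] bij that oneU unfolding bij_betw_def inj_on_def by metis
  have "(\<Sum>S\<in>?C. \<Sum>u\<in>?U. \<chi> u * cnj (orbit_avg \<theta> ?m S (cayley T n u))) =
    (\<Sum>u\<in>?U. \<chi> u * cnj (\<Sum>S\<in>?C. orbit_avg \<theta> ?m S (cayley T n u)))"
    by (subst sum.swap) (simp add: sum_distrib_left)
  also have "\<dots> = (\<Sum>u\<in>?U. if u = 1\<^sub>m ?m then \<chi> (1\<^sub>m ?m) * of_nat (card ?C) else 0)"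
    by (rule sum.cong[OF refl])
      (simp add: sum_orbit_avg[OF \<theta> two form_sign_square cayley_corner_forms[OF two]] cay0)
  also have "\<dots> = \<chi> (1\<^sub>m ?m) * of_nat (card ?C)"
    using oneU finite_U[of T n, where 'a='a] by simp
  also have "\<dots> \<noteq> 0"
    using chi zero_corner_forms[of ?m ?\<sigma>] finite_corner_forms[of ?\<sigma> ?m] by auto
  finally obtain S where S: "S \<in> ?C" "(\<Sum>u\<in>?U. \<chi> u * cnj (orbit_avg \<theta> ?m S (cayley T n u))) \<noteq> 0"
    using sum.neutral by meson
  obtain g where g: "g \<in> unitriangular ?m" "matching ?m (coact ?m S g)"
    using coact_matching[OF form_sign_square two S(1)] by blast
  have S': "coact ?m S g \<in> ?C" by (rule coact_corner_forms[OF unitriangular_carrier[OF g(1)] S(1)])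
  obtain D \<phi> where D: "basic_subset T n D" "\<phi> \<in> D \<rightarrow>\<^sub>E UNIV - {0}" "root_form T n D \<phi> = coact ?m S g"
    using root_form_surj[OF two S' g(2)] by blast
  obtain c where c: "c \<noteq> 0" "\<And>u. u \<in> ?U \<Longrightarrow>
      supercharacter T n \<theta> D \<phi> u = c * orbit_avg \<theta> ?m (root_form T n D \<phi>) (cayley T n u)"
    using supercharacter_orbit_avg[OF \<theta> two D(1,2)] by blast
  have "(\<Sum>u\<in>?U. \<chi> u * cnj (supercharacter T n \<theta> D \<phi> u)) =
      (\<Sum>u\<in>?U. cnj c * (\<chi> u * cnj (orbit_avg \<theta> ?m S (cayley T n u))))"
    by (rule sum.cong)
      (simp_all add: c(2) D(3) orbit_avg_coact[OF g(1) S(1) cayley_corner_forms[OF two]])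
  also have "\<dots> \<noteq> 0" using S(2) c(1) by (simp add: sum_distrib_left[symmetric])
  finally have "scalar_product (U T n) \<chi> (supercharacter T n \<theta> D \<phi>) \<noteq> 0"
    using oneU finite_U[of T n, where 'a='a] by (auto simp: scalar_product_def)
  then show thesis using that D by blast
qed

lemma odd_card_two_neq_zero:
  assumes "prime p" "p \<ge> 3" "card (UNIV :: 'a::{field,finite} set) = p ^ e"
  shows "(2::'a) \<noteq> 0"
proof
  assume "(2::'a) = 0"
  then have "CHAR('a) dvd 2" using of_nat_eq_0_iff_char_dvd[of 2, where 'a='a] by simp
  moreover have "CHAR('a) \<noteq> 1" by (simp add: CHAR_not_1)
  ultimately have "CHAR('a) = 2" by (metis two_is_prime_nat prime_nat_iff)
  then have "2 dvd p ^ e" using CHAR_dvd_CARD[where 'a='a] assms(3) by simp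
  then have "2 dvd p" by (rule prime_dvd_power[OF two_is_prime_nat])
  then have "2 = p" by (rule primes_dvd_imp_eq[OF two_is_prime_nat assms(1)])
  then show False using assms(2) by simp
qed

theorem theorem2p1:
  fixes T :: gtype and p e n :: nat
    and \<theta> :: "'a::{field,finite} \<Rightarrow> complex"
    and \<chi> :: "'a mat \<Rightarrow> complex"
  assumes "prime p" and "p \<ge> 3" and "e \<ge> 1" and "card (UNIV :: 'a set) = p ^ e" and "n \<ge> 1"
    and "linear_character_add \<theta>" and "\<exists>a. \<theta> a \<noteq> 1"
    and "irreducible_character (U T n) \<chi>"
  shows "\<exists>!(D, \<phi>). basic_subset T n D \<and> \<phi> \<in> D \<rightarrow>\<^sub>E UNIV - {0} \<and>
           scalar_product (U T n) \<chi> (supercharacter T n \<theta> D \<phi>) \<noteq> 0"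
proof -
  have two: "(2::'a) \<noteq> 0" by (rule odd_card_two_neq_zero[OF assms(1,2,4)])
  interpret group "U T n :: 'a mat monoid" by (rule group_U)
  have "\<chi> (1\<^sub>m (mdim T n)) \<noteq> 0"
    using irreducible_character_one[OF assms(8)] by (simp add: U_simps)
  then obtain D \<phi> where D: "basic_subset T n D" "\<phi> \<in> D \<rightarrow>\<^sub>E UNIV - {0}"
    "scalar_product (U T n) \<chi> (supercharacter T n \<theta> D \<phi>) \<noteq> 0"
    by (rule supercharacter_exists[OF assms(6,7) two])
  show ?thesis
  proof (rule ex1I[of _ "(D, \<phi>)"])
    fix q assume "case q of (D, \<phi>) \<Rightarrow> basic_subset T n D \<and> \<phi> \<in> D \<rightarrow>\<^sub>E UNIV - {0} \<and>
      scalar_product (U T n) \<chi> (supercharacter T n \<theta> D \<phi>) \<noteq> 0"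
    then obtain D' \<phi>' where q: "q = (D', \<phi>')" and D': "basic_subset T n D'" "\<phi>' \<in> D' \<rightarrow>\<^sub>E UNIV - {0}"
      "scalar_product (U T n) \<chi> (supercharacter T n \<theta> D' \<phi>') \<noteq> 0"
      by (cases q) auto
    \<comment> \<open>Supercharacters sharing the constituent \<chi> are not orthogonal, whereas
      those of different pairs are.\<close>
    have "scalar_product (U T n) (supercharacter T n \<theta> D' \<phi>') (supercharacter T n \<theta> D \<phi>) \<noteq> 0"
    proof (rule irreducible_character_common_constituent[OF finite_U assms(8) _ _ _ _ D'(3) D(3)])
      show "pos_def (U T n) (supercharacter T n \<theta> D' \<phi>')" "pos_def (U T n) (supercharacter T n \<theta> D \<phi>)"
        using D(1) D'(1) by (auto simp: basic_subset_iff intro: supercharacter_pos_def[OF assms(6)])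
    qed (rule supercharacter_class_function, assumption+)+
    then show "q = (D, \<phi>)"
      using supercharacter_orthogonal[OF assms(6,7) two D'(1,2) D(1,2)] q by blast
  qed (use D in simp)
qed

end
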